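(* Let $\phi:B\to A$ be a smooth map between manifolds. The Schwartz transform $\mathcal{S}:\overline{T^*A}\times T^*B\to T^*(A\times B)$ induces a one-to-one correspondence between the symplectic micromorphisms from $T^*A$ to $T^*B$ with core map $\phi:B\to A$ and the clean lagrangian submicrofolds in $T^*(A\times B)$ with core $\operatorname{gr}\phi$.
   Context: A microfold $[G,A]$ is a germ of a manifold $G$ around a closed submanifold $A$ (the core). A vector bundle $E\to A$ is regarded as the microfold $[E,Z_A]$, $Z_A$ the zero section, identified with $A$. A submicrofold $[H,B]\subset[G,A]$ is a microfold with representatives such that $B\subset A$, $H\subset G$ are submanifolds and $H\cap A=B$; it is clean if $TH\cap TA=TB$ along $B$, and lagrangian if $H$ is lagrangian in the symplectic manifold $G$. $\overline{M}$ denotes $M$ with the opposite symplectic form, and $\operatorname{gr}\phi=\{(\phi(x),x):x\in B\}\subset A\times B$. A symplectic micromorphism $([V],\phi):T^*A\to T^*B$ is a lagrangian submicrofold $[V,\operatorname{gr}\phi]\subset[\overline{T^*A}\times T^*B,A\times B]$, with $\phi:B\to A$ smooth (the core map), such that $TV$ is transverse along $\operatorname{gr}\phi$ to the lagrangian subbundle $TZ_A\times V(T^*B)$, where $V(T^*B)$ is the vertical subbundle of $T(T^*B)$. The Schwartz transform is the symplectomorphism $\mathcal{S}((p_1,x_1),(p_2,x_2))=(-p_1,p_2,x_1,x_2)$. The correspondence is $[V,\operatorname{gr}\phi]\mapsto[\mathcal{S}(V),\operatorname{gr}\phi]$. *)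

theory Defs
  imports "HOL-Analysis.Analysis"
begin

section \<open>Model spaces\<close>

text \<open>
  Manifolds are modelled on finite-dimensional inner product spaces.  The library class
  \<^class>\<open>euclidean_space\<close> demands a nonempty basis and so leaves out manifolds of dimension 0; the
  class below admits them, with \<^typ>\<open>unit\<close> as the model space.
\<close>

class finite_dim_inner = real_inner +
  assumes finite_dim_exists: "\<exists>B. finite B \<and> (\<forall>x. \<exists>r. x = (\<Sum>b\<in>B. r b *\<^sub>R b))"

lemma finite_dim: "\<exists>B. finite B \<and> span B = (UNIV :: 'a::finite_dim_inner set)"
proof -
  obtain B :: "'a set" where B: "finite B" "\<forall>x. \<exists>r. x = (\<Sum>b\<in>B. r b *\<^sub>R b)"
    using finite_dim_exists by blast
  have "x \<in> span B" for x
  proof -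
    obtain r where "x = (\<Sum>b\<in>B. r b *\<^sub>R b)" using B by blast
    then show ?thesis by (simp add: span_sum span_scale span_base)
  qed
  then show ?thesis using B(1) by auto
qed

lemma finite_dim_classI:
  assumes "finite B" "span B = (UNIV :: 'a::real_inner set)"
  shows "\<exists>B. finite B \<and> (\<forall>x::'a. \<exists>r. x = (\<Sum>b\<in>B. r b *\<^sub>R b))"
proof -
  have "x \<in> range (\<lambda>r. \<Sum>b\<in>B. r b *\<^sub>R b)" for x
    using span_finite [OF assms(1)] assms(2) by simp
  then have "\<exists>r. x = (\<Sum>b\<in>B. r b *\<^sub>R b)" for x
    by blast
  then show ?thesis using assms(1) by blast
qed

instance euclidean_space \<subseteq> finite_dim_inner
  by standard (rule finite_dim_classI [of Basis], simp_all)

instance prod :: (finite_dim_inner, finite_dim_inner) finite_dim_inner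
proof
  obtain B :: "'a set" where B: "finite B" "span B = UNIV" using finite_dim by blast
  obtain C :: "'b set" where C: "finite C" "span C = UNIV" using finite_dim by blast
  let ?S = "(\<lambda>x. (x, 0)) ` B \<union> (\<lambda>y. (0, y)) ` C :: ('a \<times> 'b) set"
  have lin: "linear (\<lambda>x::'a. (x, 0::'b))" "linear (\<lambda>y::'b. (0::'a, y))"
    by (auto intro!: linearI)
  have "(x, y) \<in> span ?S" for x y
  proof -
    have "span ((\<lambda>x. (x, 0::'b)) ` B) = (\<lambda>x. (x, 0)) ` UNIV"
      using span_linear_image [OF lin(1), of B] B(2) by simp
    moreover have "span ((\<lambda>y. (0::'a, y)) ` C) = (\<lambda>y. (0, y)) ` UNIV"
      using span_linear_image [OF lin(2), of C] C(2) by simp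
    ultimately have "(x, 0) \<in> span ((\<lambda>x. (x, 0::'b)) ` B)" "(0, y) \<in> span ((\<lambda>y. (0::'a, y)) ` C)"
      by blast+
    then have "(x, 0) \<in> span ?S" "(0, y) \<in> span ?S"
      using span_mono [of "(\<lambda>x. (x, 0)) ` B" ?S] span_mono [of "(\<lambda>y. (0, y)) ` C" ?S]
      by blast+
    then have "(x, 0) + (0, y) \<in> span ?S" by (rule span_add)
    then show ?thesis by simp
  qed
  then have "span ?S = UNIV" by auto
  moreover have "finite ?S" using B C by simp
  ultimately
  show "\<exists>S. finite S \<and> (\<forall>x::'a \<times> 'b. \<exists>r. x = (\<Sum>b\<in>S. r b *\<^sub>R b))"
    by (intro finite_dim_classI)
qed

instantiation unit :: real_inner
begin

definition zero_unit :: unit where "zero_unit = ()"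
definition plus_unit :: "unit \<Rightarrow> unit \<Rightarrow> unit" where "plus_unit x y = ()"
definition minus_unit :: "unit \<Rightarrow> unit \<Rightarrow> unit" where "minus_unit x y = ()"
definition uminus_unit :: "unit \<Rightarrow> unit" where "uminus_unit x = ()"
definition scaleR_unit :: "real \<Rightarrow> unit \<Rightarrow> unit" where "scaleR_unit r x = ()"
definition inner_unit :: "unit \<Rightarrow> unit \<Rightarrow> real" where "inner_unit x y = 0"
definition norm_unit :: "unit \<Rightarrow> real" where "norm_unit x = 0"
definition sgn_unit :: "unit \<Rightarrow> unit" where "sgn_unit x = ()"
definition dist_unit :: "unit \<Rightarrow> unit \<Rightarrow> real" where "dist_unit x y = 0"
definition uniformity_unit :: "(unit \<times> unit) filter"
  where "uniformity_unit = (INF e\<in>{0<..}. principal {(x, y). dist x y < e})"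
definition open_unit :: "unit set \<Rightarrow> bool"
  where "open_unit U \<longleftrightarrow> (\<forall>x\<in>U. eventually (\<lambda>(x', y). x' = x \<longrightarrow> y \<in> U) uniformity)"

instance
proof
  show "uniformity = (INF e\<in>{0<..}. principal {(x::unit, y). dist x y < e})"
    by (rule uniformity_unit_def)
  show "open U \<longleftrightarrow> (\<forall>x\<in>U. eventually (\<lambda>(x', y). x' = x \<longrightarrow> y \<in> U) uniformity)"
    for U :: "unit set"
    by (rule open_unit_def)
qed (simp_all add: inner_unit_def norm_unit_def dist_unit_def)

end

instance unit :: finite_dim_inner
  by standard (rule exI [of _ "{}"], simp)

section \<open>Smooth manifolds and smooth maps\<close>

text \<open>Continuous differentiability of order \<open>k\<close> on an open set, through iterated directional
  derivatives (this keeps the type of the function fixed along the recursion).\<close>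

primrec Ck_on :: "nat \<Rightarrow> ('e::real_normed_vector \<Rightarrow> 'f::real_normed_vector) \<Rightarrow> 'e set \<Rightarrow> bool" where
  "Ck_on 0 f S \<longleftrightarrow> continuous_on S f"
| "Ck_on (Suc k) f S \<longleftrightarrow>
     (\<forall>x\<in>S. f differentiable at x) \<and> (\<forall>v. Ck_on k (\<lambda>x. frechet_derivative f (at x) v) S)"

definition smooth_on :: "('e::real_normed_vector \<Rightarrow> 'f::real_normed_vector) \<Rightarrow> 'e set \<Rightarrow> bool"
  where "smooth_on f S \<longleftrightarrow> (\<forall>k. Ck_on k f S)"

text \<open>A chart is a pair of a domain and a coordinate map (whose values off the domain are
  irrelevant); a manifold is given by an atlas, which need not be maximal.\<close>

type_synonym ('m, 'e) chart = "'m set \<times> ('m \<Rightarrow> 'e)"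
type_synonym ('m, 'e) atlas = "('m, 'e) chart set"

definition points :: "('m, 'e) atlas \<Rightarrow> 'm set"
  where "points M = (\<Union>c\<in>M. fst c)"

definition charts_at :: "('m, 'e) atlas \<Rightarrow> 'm \<Rightarrow> ('m, 'e) chart set"
  where "charts_at M x = {c \<in> M. x \<in> fst c}"

definition chart_inv :: "('m, 'e) chart \<Rightarrow> 'e \<Rightarrow> 'm"
  where "chart_inv c = inv_into (fst c) (snd c)"

definition is_chart :: "('m, 'e::real_normed_vector) chart \<Rightarrow> bool"
  where "is_chart c \<longleftrightarrow> inj_on (snd c) (fst c) \<and> open (snd c ` fst c)"

definition compatible :: "('m, 'e::real_normed_vector) chart \<Rightarrow> ('m, 'e) chart \<Rightarrow> bool"
  where "compatible c d \<longleftrightarrow>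
    open (snd c ` (fst c \<inter> fst d)) \<and> smooth_on (snd d \<circ> chart_inv c) (snd c ` (fst c \<inter> fst d)) \<and>
    open (snd d ` (fst c \<inter> fst d)) \<and> smooth_on (snd c \<circ> chart_inv d) (snd d ` (fst c \<inter> fst d))"

definition manifold_topology :: "('m, 'e::real_normed_vector) atlas \<Rightarrow> 'm topology"
  where "manifold_topology M =
    topology (\<lambda>W. W \<subseteq> points M \<and> (\<forall>c\<in>M. open (snd c ` (W \<inter> fst c))))"

definition smooth_manifold :: "('m, 'e::finite_dim_inner) atlas \<Rightarrow> bool"
  where "smooth_manifold M \<longleftrightarrow>
    (\<forall>c\<in>M. is_chart c) \<and> (\<forall>c\<in>M. \<forall>d\<in>M. compatible c d) \<and>
    Hausdorff_space (manifold_topology M) \<and> second_countable (manifold_topology M)"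

definition smooth_map ::
    "('m, 'e::real_normed_vector) atlas \<Rightarrow> ('n, 'f::real_normed_vector) atlas \<Rightarrow> ('m \<Rightarrow> 'n) \<Rightarrow> bool"
  where "smooth_map M N F \<longleftrightarrow>
    F ` points M \<subseteq> points N \<and>
    continuous_map (manifold_topology M) (manifold_topology N) F \<and>
    (\<forall>c\<in>M. \<forall>d\<in>N. smooth_on (snd d \<circ> F \<circ> chart_inv c) (snd c ` (fst c \<inter> F -` fst d)))"

definition prod_atlas :: "('m, 'e) atlas \<Rightarrow> ('n, 'f) atlas \<Rightarrow> ('m \<times> 'n, 'e \<times> 'f) atlas"
  where "prod_atlas M N =
    {(fst c \<times> fst d, map_prod (snd c) (snd d)) | c d. c \<in> M \<and> d \<in> N}"

section \<open>Tangent spaces\<close>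

text \<open>A tangent vector at \<open>x\<close> is the family of its coordinate representations in all charts
  around \<open>x\<close>, related by the derivatives of the changes of coordinates; entries for other
  charts are set to 0, so that the vector space operations are pointwise.\<close>

type_synonym ('m, 'e) tvec = "('m, 'e) chart \<Rightarrow> 'e"

definition tangent_space :: "('m, 'e::real_normed_vector) atlas \<Rightarrow> 'm \<Rightarrow> ('m, 'e) tvec set"
  where "tangent_space M x =
    {v. (\<forall>c. c \<notin> charts_at M x \<longrightarrow> v c = 0) \<and>
        (\<forall>c\<in>charts_at M x. \<forall>d\<in>charts_at M x.
           v d = frechet_derivative (snd d \<circ> chart_inv c) (at (snd c x)) (v c))}"

text \<open>The tangent vector at \<open>x\<close> represented by \<open>e\<close> in the chart \<open>c\<close>.\<close>

definition chart_vector ::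
    "('m, 'e::real_normed_vector) atlas \<Rightarrow> ('m, 'e) chart \<Rightarrow> 'm \<Rightarrow> 'e \<Rightarrow> ('m, 'e) tvec"
  where "chart_vector M c x e =
    (\<lambda>d. if d \<in> charts_at M x then frechet_derivative (snd d \<circ> chart_inv c) (at (snd c x)) e else 0)"

text \<open>For smooth \<open>F\<close> the result does not depend on the chart selected at \<open>x\<close>.\<close>

definition tangent_map ::
    "('m, 'e::real_normed_vector) atlas \<Rightarrow> ('n, 'f::real_normed_vector) atlas \<Rightarrow> ('m \<Rightarrow> 'n) \<Rightarrow>
     'm \<Rightarrow> ('m, 'e) tvec \<Rightarrow> ('n, 'f) tvec"
  where "tangent_map M N F x v =
    (let c = (SOME c. c \<in> charts_at M x) in
     (\<lambda>d. if d \<in> charts_at N (F x)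
          then frechet_derivative (snd d \<circ> F \<circ> chart_inv c) (at (snd c x)) (v c) else 0))"

section \<open>Submanifolds\<close>

text \<open>Embedded submanifolds of constant dimension: locally the zero set of slice coordinates,
  taken from the maximal atlas.\<close>

definition embedded_submanifold :: "('m, 'e::real_normed_vector) atlas \<Rightarrow> 'm set \<Rightarrow> bool"
  where "embedded_submanifold M H \<longleftrightarrow>
    H \<subseteq> points M \<and>
    (\<exists>k. \<forall>x\<in>H. \<exists>c S. x \<in> fst c \<and> fst c \<subseteq> points M \<and> is_chart c \<and> (\<forall>d\<in>M. compatible c d) \<and>
       subspace S \<and> dim S = k \<and> snd c ` (fst c \<inter> H) = snd c ` fst c \<inter> S)"

text \<open>The tangent space of a submanifold \<open>H\<close> of \<open>M\<close>, as a subspace of that of \<open>M\<close>: the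
  velocities at time 0 of the smooth curves in \<open>H\<close>.\<close>

definition velocity :: "('m, 'e::real_normed_vector) atlas \<Rightarrow> (real \<Rightarrow> 'm) \<Rightarrow> ('m, 'e) tvec"
  where "velocity M \<gamma> =
    (\<lambda>c. if c \<in> charts_at M (\<gamma> 0) then vector_derivative (snd c \<circ> \<gamma>) (at 0) else 0)"

definition sub_tangent_space ::
    "('m, 'e::real_normed_vector) atlas \<Rightarrow> 'm set \<Rightarrow> 'm \<Rightarrow> ('m, 'e) tvec set"
  where "sub_tangent_space M H x =
    {velocity M \<gamma> | \<gamma>. \<exists>\<epsilon>>0. smooth_map {({-\<epsilon><..<\<epsilon>}, \<lambda>t. t)} M \<gamma> \<and>
                           \<gamma> ` {-\<epsilon><..<\<epsilon>} \<subseteq> H \<and> \<gamma> 0 = x}"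

section \<open>Microfolds\<close>

text \<open>\<open>microfold_in M H B\<close>: the submanifold \<open>H\<close> of \<open>M\<close>, together with the core \<open>B\<close>, a closed
  submanifold of \<open>H\<close>, represents a microfold.  The germ \<open>[H, B]\<close> is the class of all such
  representatives which agree with \<open>H\<close> near \<open>B\<close>.\<close>

definition microfold_in :: "('m, 'e::real_normed_vector) atlas \<Rightarrow> 'm set \<Rightarrow> 'm set \<Rightarrow> bool"
  where "microfold_in M H B \<longleftrightarrow>
    embedded_submanifold M H \<and> embedded_submanifold M B \<and>
    closedin (subtopology (manifold_topology M) H) B"

definition germ :: "('m, 'e::real_normed_vector) atlas \<Rightarrow> 'm set \<Rightarrow> 'm set \<Rightarrow> 'm set set"
  where "germ M H B =
    {H'. microfold_in M H' B \<and> (\<exists>W. openin (manifold_topology M) W \<and> B \<subseteq> W \<and> H \<inter> W = H' \<inter> W)}"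

text \<open>\<open>submicrofold_rep M Z H B\<close>: \<open>(H, B)\<close> represents a submicrofold of the microfold \<open>[M, Z]\<close>.
  The submicrofold itself is \<open>germ M H B\<close>.\<close>

definition submicrofold_rep ::
    "('m, 'e::real_normed_vector) atlas \<Rightarrow> 'm set \<Rightarrow> 'm set \<Rightarrow> 'm set \<Rightarrow> bool"
  where "submicrofold_rep M Z H B \<longleftrightarrow> microfold_in M H B \<and> B \<subseteq> Z \<and> H \<inter> Z = B"

definition clean_along ::
    "('m, 'e::real_normed_vector) atlas \<Rightarrow> 'm set \<Rightarrow> 'm set \<Rightarrow> 'm set \<Rightarrow> bool"
  where "clean_along M Z H B \<longleftrightarrow>
    (\<forall>x\<in>B. sub_tangent_space M H x \<inter> sub_tangent_space M Z x = sub_tangent_space M B x)"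

section \<open>Differential forms and lagrangian submanifolds\<close>

type_synonym ('m, 'e) one_form = "'m \<Rightarrow> ('m, 'e) tvec \<Rightarrow> real"
type_synonym ('m, 'e) two_form = "'m \<Rightarrow> ('m, 'e) tvec \<Rightarrow> ('m, 'e) tvec \<Rightarrow> real"

text \<open>The exterior derivative of a 1-form, \<open>d\<theta>(u, v) = u(\<theta>(v)) - v(\<theta>(u))\<close> for the constant
  extensions of \<open>u\<close> and \<open>v\<close> in a chart; independent of the chart for smooth \<open>\<theta>\<close>.\<close>

definition ext_deriv ::
    "('m, 'e::real_normed_vector) atlas \<Rightarrow> ('m, 'e) one_form \<Rightarrow> ('m, 'e) two_form"
  where "ext_deriv M \<theta> x u v =
    (let c = (SOME c. c \<in> charts_at M x);
         coeff = (\<lambda>e y. \<theta> (chart_inv c y) (chart_vector M c (chart_inv c y) e))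
     in frechet_derivative (coeff (v c)) (at (snd c x)) (u c) -
        frechet_derivative (coeff (u c)) (at (snd c x)) (v c))"

definition lagrangian ::
    "('m, 'e::real_normed_vector) atlas \<Rightarrow> ('m, 'e) two_form \<Rightarrow> 'm set \<Rightarrow> bool"
  where "lagrangian M \<omega> H \<longleftrightarrow> embedded_submanifold M H \<and>
    (\<forall>x\<in>H. sub_tangent_space M H x =
       {u \<in> tangent_space M x. \<forall>v\<in>sub_tangent_space M H x. \<omega> x u v = 0})"

section \<open>Cotangent bundles\<close>

type_synonym ('m, 'e) covec = "('m, 'e) tvec \<Rightarrow> real"
type_synonym ('m, 'e) cotangent = "'m \<times> ('m, 'e) covec"

text \<open>Covectors are linear functionals on the tangent space, extended by 0 off it.\<close>

definition cotangent_space :: "('m, 'e::real_normed_vector) atlas \<Rightarrow> 'm \<Rightarrow> ('m, 'e) covec set"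
  where "cotangent_space M x =
    {p. (\<forall>v. v \<notin> tangent_space M x \<longrightarrow> p v = 0) \<and>
        (\<forall>u\<in>tangent_space M x. \<forall>v\<in>tangent_space M x. p (\<lambda>c. u c + v c) = p u + p v) \<and>
        (\<forall>r. \<forall>v\<in>tangent_space M x. p (\<lambda>c. r *\<^sub>R v c) = r * p v)}"

text \<open>The bundle chart over a chart \<open>c\<close> of the base: \<open>(x, p)\<close> has the coordinates of \<open>x\<close> in \<open>c\<close>
  and the coefficient vector of \<open>p\<close> with respect to \<open>c\<close>; the inner product of the model space
  identifies it with its dual.\<close>

definition cotangent_chart ::
    "('m, 'e::real_inner) atlas \<Rightarrow> ('m, 'e) chart \<Rightarrow> (('m, 'e) cotangent, 'e \<times> 'e) chart"
  where "cotangent_chart M c =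
    ({(x, p). x \<in> fst c \<and> p \<in> cotangent_space M x},
     \<lambda>(x, p). (snd c x, THE g. \<forall>v\<in>tangent_space M x. p v = g \<bullet> v c))"

definition cotangent_bundle ::
    "('m, 'e::real_inner) atlas \<Rightarrow> (('m, 'e) cotangent, 'e \<times> 'e) atlas"
  where "cotangent_bundle M = cotangent_chart M ` M"

definition zero_covector :: "'m \<Rightarrow> ('m, 'e) cotangent"
  where "zero_covector x = (x, \<lambda>_. 0)"

definition zero_section :: "('m, 'e) atlas \<Rightarrow> ('m, 'e) cotangent set"
  where "zero_section M = zero_covector ` points M"

definition liouville_form ::
    "('m, 'e::real_inner) atlas \<Rightarrow> (('m, 'e) cotangent, 'e \<times> 'e) one_form"
  where "liouville_form M z w = snd z (tangent_map (cotangent_bundle M) M fst z w)"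

definition symplectic_form ::
    "('m, 'e::real_inner) atlas \<Rightarrow> (('m, 'e) cotangent, 'e \<times> 'e) two_form"
  where "symplectic_form M = ext_deriv (cotangent_bundle M) (liouville_form M)"

definition vertical_space ::
    "('m, 'e::real_inner) atlas \<Rightarrow> ('m, 'e) cotangent \<Rightarrow> (('m, 'e) cotangent, 'e \<times> 'e) tvec set"
  where "vertical_space M z =
    {w \<in> tangent_space (cotangent_bundle M) z.
       tangent_map (cotangent_bundle M) M fst z w = (\<lambda>_. 0)}"

section \<open>Symplectic micromorphisms\<close>

abbreviation cotangent_prod ::
    "('a, 'e::real_inner) atlas \<Rightarrow> ('b, 'f::real_inner) atlas \<Rightarrow>
     (('a, 'e) cotangent \<times> ('b, 'f) cotangent, ('e \<times> 'e) \<times> ('f \<times> 'f)) atlas"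
  where "cotangent_prod A B \<equiv> prod_atlas (cotangent_bundle A) (cotangent_bundle B)"

text \<open>The symplectic form of \<open>T\<^sup>*A \<times> T\<^sup>*B\<close> with the opposite form on the first factor.\<close>

definition prod_form ::
    "('a, 'e::real_inner) atlas \<Rightarrow> ('b, 'f::real_inner) atlas \<Rightarrow>
     (('a, 'e) cotangent \<times> ('b, 'f) cotangent, ('e \<times> 'e) \<times> ('f \<times> 'f)) two_form"
  where "prod_form A B z u v =
    - symplectic_form A (fst z)
        (tangent_map (cotangent_prod A B) (cotangent_bundle A) fst z u)
        (tangent_map (cotangent_prod A B) (cotangent_bundle A) fst z v)
    + symplectic_form B (snd z)
        (tangent_map (cotangent_prod A B) (cotangent_bundle B) snd z u)
        (tangent_map (cotangent_prod A B) (cotangent_bundle B) snd z v)"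

text \<open>The fibre at \<open>z\<close> of \<open>TZ\<^sub>A \<times> V(T\<^sup>*B)\<close>.\<close>

definition zero_vertical_space ::
    "('a, 'e::real_inner) atlas \<Rightarrow> ('b, 'f::real_inner) atlas \<Rightarrow>
     ('a, 'e) cotangent \<times> ('b, 'f) cotangent \<Rightarrow>
     (('a, 'e) cotangent \<times> ('b, 'f) cotangent, ('e \<times> 'e) \<times> ('f \<times> 'f)) tvec set"
  where "zero_vertical_space A B z =
    {w \<in> tangent_space (cotangent_prod A B) z.
       tangent_map (cotangent_prod A B) (cotangent_bundle A) fst z w
         \<in> sub_tangent_space (cotangent_bundle A) (zero_section A) (fst z) \<and>
       tangent_map (cotangent_prod A B) (cotangent_bundle B) snd z w
         \<in> vertical_space B (snd z)}"

definition transverse_at ::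
    "('m, 'e::real_normed_vector) atlas \<Rightarrow> 'm \<Rightarrow> ('m, 'e) tvec set \<Rightarrow> ('m, 'e) tvec set \<Rightarrow> bool"
  where "transverse_at M x U W \<longleftrightarrow>
    tangent_space M x = {\<lambda>c. u c + w c | u w. u \<in> U \<and> w \<in> W}"

definition gr :: "('b, 'f) atlas \<Rightarrow> ('b \<Rightarrow> 'a) \<Rightarrow> ('a \<times> 'b) set"
  where "gr B \<phi> = {(\<phi> x, x) | x. x \<in> points B}"

text \<open>The graph of \<open>\<phi>\<close> in the zero section \<open>Z\<^sub>A \<times> Z\<^sub>B\<close> of \<open>T\<^sup>*A \<times> T\<^sup>*B\<close>, and in that of
  \<open>T\<^sup>*(A \<times> B)\<close>.\<close>

definition gr_prod ::
    "('b, 'f) atlas \<Rightarrow> ('b \<Rightarrow> 'a) \<Rightarrow> (('a, 'e) cotangent \<times> ('b, 'f) cotangent) set"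
  where "gr_prod B \<phi> = map_prod zero_covector zero_covector ` gr B \<phi>"

definition gr_cot :: "('b, 'f) atlas \<Rightarrow> ('b \<Rightarrow> 'a) \<Rightarrow> ('a \<times> 'b, 'e \<times> 'f) cotangent set"
  where "gr_cot B \<phi> = zero_covector ` gr B \<phi>"

definition symplectic_micromorphism_rep ::
    "('a, 'e::real_inner) atlas \<Rightarrow> ('b, 'f::real_inner) atlas \<Rightarrow> ('b \<Rightarrow> 'a) \<Rightarrow>
     (('a, 'e) cotangent \<times> ('b, 'f) cotangent) set \<Rightarrow> bool"
  where "symplectic_micromorphism_rep A B \<phi> V \<longleftrightarrow>
    submicrofold_rep (cotangent_prod A B) (zero_section A \<times> zero_section B) V (gr_prod B \<phi>) \<and>
    lagrangian (cotangent_prod A B) (prod_form A B) V \<and>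
    (\<forall>z\<in>gr_prod B \<phi>. transverse_at (cotangent_prod A B) z
       (sub_tangent_space (cotangent_prod A B) V z) (zero_vertical_space A B z))"

text \<open>The symplectic micromorphisms from \<open>T\<^sup>*A\<close> to \<open>T\<^sup>*B\<close> with core map \<open>\<phi>\<close>.\<close>

definition symplectic_micromorphisms ::
    "('a, 'e::real_inner) atlas \<Rightarrow> ('b, 'f::real_inner) atlas \<Rightarrow> ('b \<Rightarrow> 'a) \<Rightarrow>
     (('a, 'e) cotangent \<times> ('b, 'f) cotangent) set set set"
  where "symplectic_micromorphisms A B \<phi> =
    {germ (cotangent_prod A B) V (gr_prod B \<phi>) | V. symplectic_micromorphism_rep A B \<phi> V}"

text \<open>The clean lagrangian submicrofolds of \<open>[T\<^sup>*Q, Q]\<close> with core \<open>C\<close>.\<close>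

definition clean_lagrangian_submicrofolds ::
    "('m, 'e::real_inner) atlas \<Rightarrow> ('m, 'e) cotangent set \<Rightarrow> ('m, 'e) cotangent set set set"
  where "clean_lagrangian_submicrofolds Q C =
    {germ (cotangent_bundle Q) L C | L.
       submicrofold_rep (cotangent_bundle Q) (zero_section Q) L C \<and>
       lagrangian (cotangent_bundle Q) (symplectic_form Q) L \<and>
       clean_along (cotangent_bundle Q) (zero_section Q) L C}"

text \<open>The Schwartz transform \<open>((p\<^sub>1, x\<^sub>1), (p\<^sub>2, x\<^sub>2)) \<mapsto> (-p\<^sub>1, p\<^sub>2, x\<^sub>1, x\<^sub>2)\<close>, where \<open>(-p\<^sub>1, p\<^sub>2)\<close> is the
  covector \<open>-p\<^sub>1 \<circ> d pr\<^sub>A + p\<^sub>2 \<circ> d pr\<^sub>B\<close> on \<open>A \<times> B\<close>.\<close>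

definition schwartz ::
    "('a, 'e::real_normed_vector) atlas \<Rightarrow> ('b, 'f::real_normed_vector) atlas \<Rightarrow>
     ('a, 'e) cotangent \<times> ('b, 'f) cotangent \<Rightarrow> ('a \<times> 'b, 'e \<times> 'f) cotangent"
  where "schwartz A B = (\<lambda>((x1, p1), (x2, p2)).
    ((x1, x2),
     \<lambda>v. if v \<in> tangent_space (prod_atlas A B) (x1, x2)
         then - p1 (tangent_map (prod_atlas A B) A fst (x1, x2) v)
              + p2 (tangent_map (prod_atlas A B) B snd (x1, x2) v)
         else 0))"

end

theory Submission
  imports Defs
begin

text \<open>
  Over charts \<open>a\<close> of \<open>A\<close> and \<open>b\<close> of \<open>B\<close>, the Schwartz transform is the fixed linear map
  \<open>((q\<^sub>1, g\<^sub>1), (q\<^sub>2, g\<^sub>2)) \<mapsto> ((q\<^sub>1, q\<^sub>2), (-g\<^sub>1, g\<^sub>2))\<close>, which pulls the canonical form back to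
  the form of \<open>T\<^sup>*A \<times> T\<^sup>*B\<close> with the first summand negated; it therefore carries lagrangian
  submicrofolds with core \<open>gr \<phi>\<close> to such submicrofolds bijectively.  It remains to match the two
  conditions along the core, which is linear algebra.  Let \<open>K\<close> be the lagrangian tangent space,
  which contains all \<open>((D\<phi> w, 0), (w, 0))\<close>, and let \<open>W\<close> be the lagrangian space of all
  \<open>((e, 0), (0, f))\<close>.  Transversality means \<open>K \<inter> W = 0\<close>.  If this holds and
  \<open>((e, 0), (f, 0)) \<in> K\<close>, subtracting \<open>((D\<phi> f, 0), (f, 0))\<close> gives an element of \<open>K \<inter> W\<close>, so
  \<open>e = D\<phi> f\<close>, which is cleanness.  Conversely, pairing \<open>((e, 0), (0, f)) \<in> K\<close> with
  \<open>((D\<phi> w, 0), (w, 0))\<close> shows \<open>f = 0\<close>, and then cleanness gives \<open>e = 0\<close>.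
\<close>

section \<open>Smooth functions\<close>

text \<open>Tangent spaces of subsets are sets of velocities, and that of a lagrangian submicrofold
  is never shown directly to be a vector space. Along the core the lagrangian condition supplies
  this: a set that equals its own orthogonal is closed under sums and multiples. Explicit
  computations are made for a whole manifold, for zero sections and for \<open>gr \<phi>\<close>,
  with upper bounds from equations that hold on the set and lower bounds from explicit curves.

  The other obstacle is that symplectic forms and tangent maps are evaluated in charts selected by
  \<open>SOME\<close>, and the selection on a product is unrelated to those on its factors. Each of
  them is first shown to have the same coordinate expression in every chart of the atlas; only then
  can the two sides be compared in matching charts. For the symplectic form this costs the symmetry
  of second derivatives.\<close>

lemma Ck_on_cong:
  assumes "open S" "\<And>x. x \<in> S \<Longrightarrow> f x = g x" "Ck_on k f S"
  shows "Ck_on k g S"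
  using assms(2,3)
proof (induction k arbitrary: f g)
  case 0
  then show ?case by (auto intro: continuous_on_eq)
next
  case (Suc k)
  \<comment> \<open>\<open>Ck_on\<close> differentiates the total function, so agreement on
    \<open>S\<close> must pass to the derivatives; this is where the openness of \<open>S\<close>
    enters.\<close>
  have der: "(g has_derivative frechet_derivative f (at x)) (at x)" if "x \<in> S" for x
  proof (rule has_derivative_transform_within_open [OF _ \<open>open S\<close> that])
    show "(f has_derivative frechet_derivative f (at x)) (at x)"
      using Suc.prems(2) that by (simp flip: frechet_derivative_works)
  qed (use Suc.prems(1) in auto)
  then have "frechet_derivative f (at x) = frechet_derivative g (at x)" if "x \<in> S" for x
    using that frechet_derivative_at by blast
  moreover have "Ck_on k (\<lambda>x. frechet_derivative f (at x) v) S" for v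
    using Suc.prems(2) by simp
  ultimately have "Ck_on k (\<lambda>x. frechet_derivative g (at x) v) S" for v
    by (rule Suc.IH [OF fun_cong])
  moreover have "g differentiable at x" if "x \<in> S" for x
    using der [OF that] by (rule differentiableI)
  ultimately show ?case by simp
qed

lemma smooth_on_cong:
  "open S \<Longrightarrow> smooth_on f S \<Longrightarrow> (\<And>x. x \<in> S \<Longrightarrow> f x = g x) \<Longrightarrow> smooth_on g S"
  unfolding smooth_on_def using Ck_on_cong by blast

lemma Ck_on_subset: "Ck_on k f S \<Longrightarrow> T \<subseteq> S \<Longrightarrow> Ck_on k f T"
  by (induction k arbitrary: f) (auto intro: continuous_on_subset)

lemma smooth_on_subset: "smooth_on f S \<Longrightarrow> T \<subseteq> S \<Longrightarrow> smooth_on f T"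
  unfolding smooth_on_def using Ck_on_subset by blast

lemma smooth_on_imp_continuous_on: "smooth_on f S \<Longrightarrow> continuous_on S f"
  unfolding smooth_on_def by (metis Ck_on.simps(1))

lemma smooth_on_imp_differentiable: "smooth_on f S \<Longrightarrow> x \<in> S \<Longrightarrow> f differentiable at x"
  unfolding smooth_on_def by (metis Ck_on.simps(2))

lemma smooth_on_derivative:
  "smooth_on f S \<Longrightarrow> smooth_on (\<lambda>x. frechet_derivative f (at x) v) S"
  unfolding smooth_on_def by (metis Ck_on.simps(2))

text \<open>The directional derivatives of \<open>L \<circ> f\<close> are \<open>L\<close> applied
  to those of \<open>f\<close>, so the induction meets a function of the same shape. Together with
  precomposition by affine maps and pairing, this replaces a chain rule for smooth maps.\<close>

lemma smooth_on_linear_left: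
  assumes "open S" "bounded_linear L" "smooth_on f S"
  shows "smooth_on (\<lambda>x. L (f x)) S"
proof -
  have "Ck_on k f S \<Longrightarrow> Ck_on k (\<lambda>x. L (f x)) S" for k
  proof (induction k arbitrary: f)
    case 0
    then show ?case using assms(2) by (auto intro: bounded_linear.continuous_on)
  next
    case (Suc k)
    have der: "((\<lambda>x. L (f x)) has_derivative (\<lambda>v. L (frechet_derivative f (at x) v))) (at x)"
      if "x \<in> S" for x
      using Suc.prems that
      by (intro bounded_linear.has_derivative [OF assms(2)]) (simp flip: frechet_derivative_works)
    then have "L (frechet_derivative f (at x) v) = frechet_derivative (\<lambda>x. L (f x)) (at x) v"
      if "x \<in> S" for x v
      by - (rule fun_cong [OF frechet_derivative_at [OF der [OF that]]])
    then have "Ck_on k (\<lambda>x. frechet_derivative (\<lambda>x. L (f x)) (at x) v) S" for v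
      by (rule Ck_on_cong [OF assms(1) _ Suc.IH]) (use Suc.prems in simp_all)
    moreover have "(\<lambda>x. L (f x)) differentiable at x" if "x \<in> S" for x
      using der [OF that] by (rule differentiableI)
    ultimately show ?case by simp
  qed
  then show ?thesis using assms(3) unfolding smooth_on_def by blast
qed

lemma open_affine_vimage:
  fixes l :: "'a::real_normed_vector \<Rightarrow> 'b::real_normed_vector"
  assumes "open S" "bounded_linear l"
  shows "open {t. q + l t \<in> S}"
proof -
  have "continuous_on UNIV (\<lambda>t. q + l t)"
    by (intro continuous_intros bounded_linear.continuous_on [OF assms(2)])
  then have "open ((\<lambda>t. q + l t) -` S)"
    using assms(1) by (simp add: continuous_on_open_vimage)
  then show ?thesis by (simp add: vimage_def)
qed

text \<open>The derivative of \<open>f (q + l t)\<close> in direction \<open>v\<close> is the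
  derivative of \<open>f\<close> in the fixed direction \<open>l v\<close>, precomposed with the
  same affine map, so the shape persists along the induction. The constant \<open>q\<close> allows
  for straight lines through a point of a chart.\<close>

lemma smooth_on_affine_right:
  fixes l :: "'a::real_normed_vector \<Rightarrow> 'b::real_normed_vector"
  assumes "open S" "bounded_linear l" "smooth_on f S"
  shows "smooth_on (\<lambda>t. f (q + l t)) {t. q + l t \<in> S}"
proof -
  let ?T = "{t. q + l t \<in> S}"
  have T: "open ?T" by (rule open_affine_vimage [OF assms(1,2)])
  have "Ck_on k f S \<Longrightarrow> Ck_on k (\<lambda>t. f (q + l t)) ?T" for k
  proof (induction k arbitrary: f)
    case 0
    then have "continuous_on S f" by simp
    then have "continuous_on ?T (\<lambda>t. f (q + l t))"
      by (rule continuous_on_compose2)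
        (auto intro!: continuous_intros bounded_linear.continuous_on [OF assms(2)])
    then show ?case by simp
  next
    case (Suc k)
    have aff: "((\<lambda>t. q + l t) has_derivative l) (at t)" for t
      using has_derivative_add [OF has_derivative_const bounded_linear_imp_has_derivative [OF assms(2)]]
      by simp
    have der: "((\<lambda>t. f (q + l t)) has_derivative (\<lambda>v. frechet_derivative f (at (q + l t)) (l v))) (at t)"
      if "t \<in> ?T" for t
      using Suc.prems that
      by (intro has_derivative_compose [OF aff]) (simp flip: frechet_derivative_works)
    then have "frechet_derivative f (at (q + l t)) (l v) = frechet_derivative (\<lambda>t. f (q + l t)) (at t) v"
      if "t \<in> ?T" for t v
      by - (rule fun_cong [OF frechet_derivative_at [OF der [OF that]]])
    then have "Ck_on k (\<lambda>t. frechet_derivative (\<lambda>t. f (q + l t)) (at t) v) ?T" for v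
      by (rule Ck_on_cong [OF T _ Suc.IH [of "\<lambda>x. frechet_derivative f (at x) (l v)"]])
        (use Suc.prems in simp_all)
    moreover have "(\<lambda>t. f (q + l t)) differentiable at t" if "t \<in> ?T" for t
      using der [OF that] by (rule differentiableI)
    ultimately show ?case by simp
  qed
  then show ?thesis using assms(3) unfolding smooth_on_def by blast
qed

lemma smooth_on_linear_right:
  assumes "open S" "bounded_linear l" "smooth_on f S"
  shows "smooth_on (\<lambda>t. f (l t)) (l -` S)"
  using smooth_on_affine_right [OF assms, of 0] by (simp add: vimage_def)

lemma smooth_on_Pair:
  assumes "open S" "smooth_on f S" "smooth_on g S"
  shows "smooth_on (\<lambda>x. (f x, g x)) S"
proof -
  have "Ck_on k f S \<Longrightarrow> Ck_on k g S \<Longrightarrow> Ck_on k (\<lambda>x. (f x, g x)) S" for k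
  proof (induction k arbitrary: f g)
    case 0
    then show ?case by (auto intro: continuous_on_Pair)
  next
    case (Suc k)
    have der: "((\<lambda>x. (f x, g x)) has_derivative
        (\<lambda>v. (frechet_derivative f (at x) v, frechet_derivative g (at x) v))) (at x)"
      if "x \<in> S" for x
      using Suc.prems that
      by (intro has_derivative_Pair) (simp_all flip: frechet_derivative_works)
    then have "(frechet_derivative f (at x) v, frechet_derivative g (at x) v)
        = frechet_derivative (\<lambda>x. (f x, g x)) (at x) v" if "x \<in> S" for x v
      by - (rule fun_cong [OF frechet_derivative_at [OF der [OF that]]])
    then have "Ck_on k (\<lambda>x. frechet_derivative (\<lambda>x. (f x, g x)) (at x) v) S" for v
      by (rule Ck_on_cong [OF assms(1) _ Suc.IH]) (use Suc.prems in simp_all)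
    moreover have "(\<lambda>x. (f x, g x)) differentiable at x" if "x \<in> S" for x
      using der [OF that] by (rule differentiableI)
    ultimately show ?case by simp
  qed
  then show ?thesis using assms(2,3) unfolding smooth_on_def by blast
qed

lemma has_derivative_eq_at:
  "(f has_derivative D) (at y) \<Longrightarrow> (f has_derivative D') (at y) \<Longrightarrow> D w = D' w"
  by (rule fun_cong [OF has_derivative_unique])

section \<open>Symmetry of second derivatives\<close>

lemma mean_value_direction:
  fixes f :: "'a::real_normed_vector \<Rightarrow> real"
  assumes "0 < s" "\<And>r. 0 \<le> r \<Longrightarrow> r \<le> s \<Longrightarrow> f differentiable at (y + r *\<^sub>R u)"
  obtains r where "0 < r" "r < s" "f (y + s *\<^sub>R u) - f y = s * frechet_derivative f (at (y + r *\<^sub>R u)) u"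
proof -
  have der: "((\<lambda>r. f (y + r *\<^sub>R u)) has_derivative
      (\<lambda>t. t * frechet_derivative f (at (y + r *\<^sub>R u)) u)) (at r)" if r: "0 \<le> r" "r \<le> s" for r
  proof -
    have D: "(f has_derivative frechet_derivative f (at (y + r *\<^sub>R u))) (at (y + r *\<^sub>R u))"
      using assms(2) [OF r] frechet_derivative_works by blast
    have "((\<lambda>r. f (y + r *\<^sub>R u)) has_derivative
      (\<lambda>t. frechet_derivative f (at (y + r *\<^sub>R u)) (t *\<^sub>R u))) (at r)"
      by (rule has_derivative_compose [where f = "\<lambda>r. y + r *\<^sub>R u", OF _ D]) (auto intro!: derivative_eq_intros)
    moreover have "linear (frechet_derivative f (at (y + r *\<^sub>R u)))"
      using assms(2) [OF r] linear_frechet_derivative by blast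
    ultimately show ?thesis by (simp add: linear_cmul)
  qed
  then have "continuous_on {0..s} (\<lambda>r. f (y + r *\<^sub>R u))"
    by (meson atLeastAtMost_iff continuous_at_imp_continuous_on has_derivative_continuous)
  then obtain r where "0 < r" "r < s"
    "f (y + s *\<^sub>R u) - f (y + 0 *\<^sub>R u) = (s - 0) * frechet_derivative f (at (y + r *\<^sub>R u)) u"
    using mvt [OF assms(1), of "\<lambda>r. f (y + r *\<^sub>R u)"
        "\<lambda>r t. t * frechet_derivative f (at (y + r *\<^sub>R u)) u"] der by auto
  then show ?thesis using that by simp
qed

text \<open>Applied to \<open>(u, v)\<close> and to \<open>(v, u)\<close>, this yields the symmetry of second derivatives: the
  second difference is symmetric in \<open>u\<close> and \<open>v\<close>.\<close>

lemma second_difference_mean_value: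
  fixes f :: "'a::real_normed_vector \<Rightarrow> real"
  assumes "0 < s" "smooth_on f S"
    and S: "\<And>r t. 0 \<le> r \<Longrightarrow> r \<le> s \<Longrightarrow> 0 \<le> t \<Longrightarrow> t \<le> s \<Longrightarrow> x + r *\<^sub>R u + t *\<^sub>R v \<in> S"
  obtains r t where "0 < r" "r < s" "0 < t" "t < s"
    "f (x + s *\<^sub>R u + s *\<^sub>R v) - f (x + s *\<^sub>R u) - f (x + s *\<^sub>R v) + f x =
     s * s * frechet_derivative (\<lambda>y. frechet_derivative f (at y) u) (at (x + r *\<^sub>R u + t *\<^sub>R v)) v"
proof -
  let ?g = "\<lambda>y. f (y + s *\<^sub>R v) - f y"
  let ?D = "\<lambda>y. frechet_derivative f (at y) u"
  have dg: "(?g has_derivative (\<lambda>w. frechet_derivative f (at (x + r *\<^sub>R u + s *\<^sub>R v)) w -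
      frechet_derivative f (at (x + r *\<^sub>R u)) w)) (at (x + r *\<^sub>R u))" if r: "0 \<le> r" "r \<le> s" for r
  proof -
    have "f differentiable at (x + r *\<^sub>R u + s *\<^sub>R v)" "f differentiable at (x + r *\<^sub>R u)"
      using S [OF r, of s] S [OF r, of 0] assms(1) smooth_on_imp_differentiable [OF assms(2)] by auto
    then have D1: "(f has_derivative frechet_derivative f (at (x + r *\<^sub>R u + s *\<^sub>R v))) (at (x + r *\<^sub>R u + s *\<^sub>R v))"
      and D2: "(f has_derivative frechet_derivative f (at (x + r *\<^sub>R u))) (at (x + r *\<^sub>R u))"
      by (simp_all flip: frechet_derivative_works)
    have "((\<lambda>y. f (y + s *\<^sub>R v)) has_derivative frechet_derivative f (at (x + r *\<^sub>R u + s *\<^sub>R v))) (at (x + r *\<^sub>R u))"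
      by (rule has_derivative_compose [where f = "\<lambda>y. y + s *\<^sub>R v", OF _ D1])
        (auto intro!: derivative_eq_intros)
    then show ?thesis by (rule has_derivative_diff [OF _ D2])
  qed
  \<comment> \<open>The second difference is the increment of \<open>?g\<close> along
    \<open>u\<close>: the mean value theorem is applied to \<open>?g\<close> in direction
    \<open>u\<close>, and then to \<open>?D\<close> in direction \<open>v\<close>.\<close>
  obtain r where r: "0 < r" "r < s" "?g (x + s *\<^sub>R u) - ?g x = s * frechet_derivative ?g (at (x + r *\<^sub>R u)) u"
    by (rule mean_value_direction [OF assms(1), of ?g x u]) (rule differentiableI [OF dg])
  have gr: "frechet_derivative ?g (at (x + r *\<^sub>R u)) u = ?D (x + r *\<^sub>R u + s *\<^sub>R v) - ?D (x + r *\<^sub>R u)"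
    using r(1,2) by - (rule fun_cong [OF frechet_derivative_at [OF dg [of r]], symmetric]; simp)
  have "?D differentiable at (x + r *\<^sub>R u + t *\<^sub>R v)" if "0 \<le> t" "t \<le> s" for t
    using smooth_on_imp_differentiable [OF smooth_on_derivative [OF assms(2)]] S [of r t] that r by auto
  then obtain t where t: "0 < t" "t < s" "?D (x + r *\<^sub>R u + s *\<^sub>R v) - ?D (x + r *\<^sub>R u) =
      s * frechet_derivative ?D (at (x + r *\<^sub>R u + t *\<^sub>R v)) v"
    using mean_value_direction [OF assms(1), of ?D "x + r *\<^sub>R u" v] by metis
  show ?thesis
    by (rule that [OF r(1,2) t(1,2)]) (use r(3) gr t(3) in \<open>simp add: algebra_simps\<close>)
qed

text \<open>Divided by \<open>s * s\<close>, the second difference is a value of either mixed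
  derivative at some point near \<open>x\<close>; continuity of both identifies their values at
  \<open>x\<close>.\<close>

lemma symmetric_second_derivative_real:
  fixes f :: "'a::real_normed_vector \<Rightarrow> real"
  assumes "open S" "x \<in> S" "smooth_on f S"
  shows "frechet_derivative (\<lambda>y. frechet_derivative f (at y) u) (at x) v =
         frechet_derivative (\<lambda>y. frechet_derivative f (at y) v) (at x) u"
proof -
  let ?P = "\<lambda>y. frechet_derivative (\<lambda>y. frechet_derivative f (at y) u) (at y) v"
  let ?Q = "\<lambda>y. frechet_derivative (\<lambda>y. frechet_derivative f (at y) v) (at y) u"
  have cont: "continuous_on S ?P" "continuous_on S ?Q"
    by (intro smooth_on_imp_continuous_on smooth_on_derivative assms(3))+
  have "\<bar>?P x - ?Q x\<bar> \<le> e" if "e > 0" for e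
  proof -
    have "isCont ?P x" "isCont ?Q x"
      using cont continuous_on_eq_continuous_at [OF assms(1)] assms(2) by blast+
    then obtain d1 d2 where d1: "d1 > 0" "\<And>y. dist y x < d1 \<Longrightarrow> dist (?P y) (?P x) < e / 2"
      and d2: "d2 > 0" "\<And>y. dist y x < d2 \<Longrightarrow> dist (?Q y) (?Q x) < e / 2"
      using \<open>e > 0\<close> unfolding continuous_at_eps_delta by (metis half_gt_zero)
    obtain d3 where d3: "d3 > 0" "\<And>y. dist y x < d3 \<Longrightarrow> y \<in> S"
      using assms(1,2) unfolding open_dist by blast
    define d where "d = min d1 (min d2 d3)"
    \<comment> \<open>This \<open>s\<close> keeps the parallelogram spanned by
      \<open>s *\<^sub>R u\<close> and \<open>s *\<^sub>R v\<close> within distance \<open>d\<close>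
      of \<open>x\<close>; the summand 1 covers the case \<open>u = v = 0\<close>.\<close>
    define s where "s = d / (2 * (norm u + norm v + 1))"
    have d: "d > 0" using d1 d2 d3 by (simp add: d_def)
    have pos: "norm u + norm v + 1 > 0"
      by (metis add_nonneg_pos norm_ge_zero add_nonneg_nonneg zero_less_one)
    have s: "s > 0" using d pos by (simp add: s_def)
    have sd: "s * (norm u + norm v) < d"
    proof -
      have "s * (norm u + norm v) \<le> s * (norm u + norm v + 1)" using s by simp
      also have "\<dots> = d / 2" using pos unfolding s_def by (simp add: field_simps)
      also have "\<dots> < d" using d by simp
      finally show ?thesis .
    qed
    have near: "dist (x + r *\<^sub>R u + t *\<^sub>R v) x < d"
      if "0 \<le> r" "r \<le> s" "0 \<le> t" "t \<le> s" for r t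
    proof -
      have "norm (r *\<^sub>R u + t *\<^sub>R v) \<le> r * norm u + t * norm v"
        using norm_triangle_ineq [of "r *\<^sub>R u" "t *\<^sub>R v"] that by simp
      also have "\<dots> \<le> s * norm u + s * norm v"
        using that by (intro add_mono mult_right_mono) auto
      finally show ?thesis using sd by (simp add: dist_norm algebra_simps)
    qed
    have nearS: "x + r *\<^sub>R u + t *\<^sub>R v \<in> S" if "0 \<le> r" "r \<le> s" "0 \<le> t" "t \<le> s" for r t
      using near [OF that] d3(2) unfolding d_def by simp
    have nearS': "x + r *\<^sub>R v + t *\<^sub>R u \<in> S" if "0 \<le> r" "r \<le> s" "0 \<le> t" "t \<le> s" for r t
      using nearS [OF that(3,4,1,2)] by (simp add: add.assoc add.commute [of "r *\<^sub>R v"])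
    obtain r t where rt: "0 < r" "r < s" "0 < t" "t < s"
      "f (x + s *\<^sub>R u + s *\<^sub>R v) - f (x + s *\<^sub>R u) - f (x + s *\<^sub>R v) + f x = s * s * ?P (x + r *\<^sub>R u + t *\<^sub>R v)"
      by (rule second_difference_mean_value [OF s assms(3), of x u v]) (rule nearS)
    obtain r' t' where rt': "0 < r'" "r' < s" "0 < t'" "t' < s"
      "f (x + s *\<^sub>R v + s *\<^sub>R u) - f (x + s *\<^sub>R v) - f (x + s *\<^sub>R u) + f x = s * s * ?Q (x + r' *\<^sub>R v + t' *\<^sub>R u)"
      by (rule second_difference_mean_value [OF s assms(3), of x v u]) (rule nearS')
    have "s * s * ?P (x + r *\<^sub>R u + t *\<^sub>R v) = s * s * ?Q (x + r' *\<^sub>R v + t' *\<^sub>R u)"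
      using rt(5) rt'(5) by (simp add: algebra_simps)
    then have eq: "?P (x + r *\<^sub>R u + t *\<^sub>R v) = ?Q (x + t' *\<^sub>R u + r' *\<^sub>R v)"
      using s by (simp add: add.assoc add.commute [of "r' *\<^sub>R v"])
    have "dist (?P (x + r *\<^sub>R u + t *\<^sub>R v)) (?P x) < e / 2"
      using near [of r t] rt d1(2) unfolding d_def by simp
    moreover have "dist (?Q (x + t' *\<^sub>R u + r' *\<^sub>R v)) (?Q x) < e / 2"
      using near [of t' r'] rt' d2(2) unfolding d_def by simp
    ultimately show ?thesis using eq unfolding dist_real_def by linarith
  qed
  then have "\<bar>?P x - ?Q x\<bar> \<le> 0" by (rule field_le_epsilon) simp
  then show ?thesis by simp
qed

text \<open>Reduces to real functions by testing against every \<open>h\<close> with the inner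
  product.\<close>

lemma symmetric_second_derivative:
  fixes f :: "'a::real_normed_vector \<Rightarrow> 'b::real_inner"
  assumes "open S" "x \<in> S" "smooth_on f S"
  shows "frechet_derivative (\<lambda>y. frechet_derivative f (at y) u) (at x) v =
         frechet_derivative (\<lambda>y. frechet_derivative f (at y) v) (at x) u"
proof -
  let ?D = "\<lambda>u y. frechet_derivative f (at y) u"
  have "h \<bullet> frechet_derivative (?D u) (at x) v = h \<bullet> frechet_derivative (?D v) (at x) u" for h
  proof -
    note bl = bounded_linear_inner_right [of h]
    have sm: "smooth_on (\<lambda>y. h \<bullet> f y) S"
      by (rule smooth_on_linear_left [OF assms(1) bl assms(3)])
    have inner_D: "frechet_derivative (\<lambda>y. h \<bullet> g y) (at y) w = h \<bullet> frechet_derivative g (at y) w"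
      if "y \<in> S" "smooth_on g S" for g :: "'a \<Rightarrow> 'b" and y w
    proof -
      have "(g has_derivative frechet_derivative g (at y)) (at y)"
        using smooth_on_imp_differentiable [OF that(2,1)] frechet_derivative_works by blast
      from frechet_derivative_at [OF bounded_linear.has_derivative [OF bl this]]
      show ?thesis by metis
    qed
    have "frechet_derivative (\<lambda>y. frechet_derivative (\<lambda>y. h \<bullet> f y) (at y) u) (at x) =
        frechet_derivative (\<lambda>y. h \<bullet> ?D u y) (at x)" for u
    proof (rule frechet_derivative_transform_within_open [OF _ assms(1,2)])
      show "(\<lambda>y. frechet_derivative (\<lambda>y. h \<bullet> f y) (at y) u) differentiable at x"
        using smooth_on_imp_differentiable [OF smooth_on_derivative [OF sm] assms(2)] .
    qed (simp add: inner_D assms(3))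
    then show ?thesis
      using symmetric_second_derivative_real [OF assms(1,2) sm, of u v]
      by (simp add: inner_D assms(2) smooth_on_derivative assms(3))
  qed
  then show ?thesis using vector_eq_ldot by blast
qed

section \<open>Finite-dimensional inner product spaces\<close>

text \<open>Keeps the dimension of slices when charts are composed with a linear isomorphism of
  model spaces.\<close>

lemma dim_image_linear_inj:
  fixes L :: "'a::real_vector \<Rightarrow> 'b::real_vector"
  assumes "linear L" "inj L"
  shows "dim (L ` S) = dim S"
proof -
  obtain B where B: "B \<subseteq> S" "independent B" "S \<subseteq> span B" "card B = dim S"
    using basis_exists by blast
  have "independent (L ` B)"
    by (rule linear_independent_injective_image [OF assms(1) B(2)]) (rule inj_on_subset [OF assms(2) subset_UNIV])
  moreover have "L ` S \<subseteq> span (L ` B)"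
    using B(3) by (simp add: linear_span_image [OF assms(1)] image_mono)
  moreover have "card (L ` B) = card B"
    by (rule card_image) (rule inj_on_subset [OF assms(2) subset_UNIV])
  ultimately show ?thesis
    using B by (metis dim_unique image_mono)
qed

text \<open>An orthogonal spanning set serves in place of an orthonormal basis: it yields
  coordinates by one formula, which suits linear functionals and adjoints.\<close>

lemma orthogonal_expansion:
  "\<exists>B :: 'a::finite_dim_inner set. finite B \<and> (\<forall>x. x = (\<Sum>b\<in>B. (x \<bullet> b / (b \<bullet> b)) *\<^sub>R b))"
proof -
  obtain B0 :: "'a set" where "finite B0" "span B0 = UNIV" using finite_dim by blast
  then obtain B :: "'a set" where B: "finite B" "span B = UNIV" "pairwise orthogonal B"
    using basis_orthogonal by metis
  have "x = (\<Sum>b\<in>B. (x \<bullet> b / (b \<bullet> b)) *\<^sub>R b)" for x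
  proof -
    have "x \<in> span B" using B by simp
    then obtain r where r: "x = (\<Sum>b\<in>B. r b *\<^sub>R b)"
      using span_finite [OF B(1)] by auto
    have "x \<bullet> b = r b * (b \<bullet> b)" if "b \<in> B" for b
    proof -
      have "x \<bullet> b = (\<Sum>c\<in>B. r c * (c \<bullet> b))" by (simp add: r inner_sum_left)
      also have "\<dots> = (\<Sum>c\<in>B. if c = b then r b * (b \<bullet> b) else 0)"
        using B(3) that by (intro sum.cong) (auto simp: pairwise_def orthogonal_def)
      also have "\<dots> = r b * (b \<bullet> b)" using that B(1) by simp
      finally show ?thesis .
    qed
    \<comment> \<open>For \<open>b = 0\<close> both sides vanish, whatever their
      coefficients.\<close>
    then have "(x \<bullet> b / (b \<bullet> b)) *\<^sub>R b = r b *\<^sub>R b" if "b \<in> B" for b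
      using that by (cases "b = 0") auto
    then show ?thesis using r by (metis (no_types, lifting) sum.cong)
  qed
  with B(1) show ?thesis by blast
qed

lemma riesz_finite_dim:
  fixes l :: "'a::finite_dim_inner \<Rightarrow> real"
  assumes "linear l"
  shows "\<exists>g. \<forall>e. l e = g \<bullet> e"
proof -
  obtain B :: "'a set" where B: "finite B" "\<And>x. x = (\<Sum>b\<in>B. (x \<bullet> b / (b \<bullet> b)) *\<^sub>R b)"
    using orthogonal_expansion by blast
  have "l e = (\<Sum>b\<in>B. (l b / (b \<bullet> b)) *\<^sub>R b) \<bullet> e" for e
  proof -
    have "l e = l (\<Sum>b\<in>B. (e \<bullet> b / (b \<bullet> b)) *\<^sub>R b)" using B(2) [of e] by simp
    then show ?thesis
      by (simp add: linear_sum [OF assms] linear_cmul [OF assms] inner_sum_left inner_sum_right inner_commute mult.commute)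
  qed
  then show ?thesis by blast
qed

lemma orthogonal_vector_exists:
  fixes U :: "'a::finite_dim_inner set"
  assumes "subspace U" "U \<noteq> UNIV"
  obtains n where "n \<noteq> 0" "\<And>u. u \<in> U \<Longrightarrow> n \<bullet> u = 0"
proof -
  obtain B0 :: "'a set" where B0: "finite B0" "span B0 = UNIV" using finite_dim by blast
  obtain B where B: "B \<subseteq> U" "independent B" "U \<subseteq> span B"
    using maximal_independent_subset [of U] by blast
  have "finite B" using independent_span_bound [OF B0(1) B(2)] B0(2) by simp
  moreover have "span B = U" using B assms(1) by (simp add: span_minimal subset_antisym)
  ultimately obtain C where C: "finite C" "span C = U" "pairwise orthogonal C"
    using basis_orthogonal by metis
  obtain a where a: "a \<notin> U" using assms(2) by blast
  \<comment> \<open>The component of \<open>a\<close> orthogonal to \<open>U\<close>; it cannot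
    vanish, since the subtracted projection lies in \<open>U\<close> and \<open>a\<close> does
    not.\<close>
  define n where "n = a - (\<Sum>c\<in>C. (a \<bullet> c / (c \<bullet> c)) *\<^sub>R c)"
  have nc: "n \<bullet> c = 0" if "c \<in> C" for c
  proof -
    have "(\<Sum>b\<in>C. (a \<bullet> b / (b \<bullet> b)) *\<^sub>R b) \<bullet> c = (\<Sum>b\<in>C. if b = c then a \<bullet> c else 0)"
      unfolding inner_sum_left using C(3) that
      by (intro sum.cong) (auto simp: pairwise_def orthogonal_def)
    then show ?thesis using that C(1) by (simp add: n_def inner_diff_left)
  qed
  have "n \<bullet> u = 0" if "u \<in> U" for u
  proof -
    have "u \<in> range (\<lambda>r. \<Sum>b\<in>C. r b *\<^sub>R b)"
      using that C(2) span_finite [OF C(1)] by simp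
    then obtain r where "u = (\<Sum>b\<in>C. r b *\<^sub>R b)" by blast
    then show ?thesis by (simp add: inner_sum_right nc)
  qed
  moreover have "(\<Sum>c\<in>C. (a \<bullet> c / (c \<bullet> c)) *\<^sub>R c) \<in> U"
    unfolding C(2) [symmetric] by (intro span_sum span_scale span_base)
  then have "n \<noteq> 0" using a by (auto simp: n_def)
  ultimately show ?thesis using that by blast
qed

section \<open>Tangent vectors in a chart\<close>

text \<open>Cotangent charts are only needed to be differentiably compatible: the definitions of embedded
  submanifolds and smooth curves already quantify over all charts of the given atlas, so that no
  transition map of a cotangent bundle has to be smooth.\<close>

definition differentiable_atlas :: "('m, 'e::real_normed_vector) atlas \<Rightarrow> bool"
  where "differentiable_atlas M \<longleftrightarrow>
    (\<forall>c\<in>M. is_chart c) \<and>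
    (\<forall>c\<in>M. \<forall>d\<in>M. open (snd c ` (fst c \<inter> fst d)) \<and>
      (\<forall>y\<in>snd c ` (fst c \<inter> fst d). (snd d \<circ> chart_inv c) differentiable at y))"

lemma chart_inv_coord [simp]: "is_chart c \<Longrightarrow> x \<in> fst c \<Longrightarrow> chart_inv c (snd c x) = x"
  unfolding is_chart_def chart_inv_def by simp

lemma chart_inv_in: "y \<in> snd c ` fst c \<Longrightarrow> chart_inv c y \<in> fst c"
  unfolding chart_inv_def by (rule inv_into_into)

lemma coord_chart_inv: "y \<in> snd c ` fst c \<Longrightarrow> snd c (chart_inv c y) = y"
  unfolding chart_inv_def by (rule f_inv_into_f)

lemma charts_atD: "c \<in> charts_at M x \<Longrightarrow> c \<in> M \<and> x \<in> fst c"
  by (simp add: charts_at_def)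

lemma is_chart_at: "differentiable_atlas M \<Longrightarrow> c \<in> charts_at M x \<Longrightarrow> is_chart c"
  by (simp add: differentiable_atlas_def charts_at_def)

lemma charts_at_nonempty: "x \<in> points M \<Longrightarrow> \<exists>c. c \<in> charts_at M x"
  by (auto simp: points_def charts_at_def)

lemma open_chart_overlap:
  "differentiable_atlas M \<Longrightarrow> c \<in> charts_at M x \<Longrightarrow> d \<in> charts_at M x \<Longrightarrow>
    open (snd c ` (fst c \<inter> fst d)) \<and> snd c x \<in> snd c ` (fst c \<inter> fst d)"
  by (auto simp: differentiable_atlas_def charts_at_def)

lemma transition_has_derivative:
  assumes "differentiable_atlas M" "c \<in> charts_at M x" "d \<in> charts_at M x"
  shows "(snd d \<circ> chart_inv c has_derivative frechet_derivative (snd d \<circ> chart_inv c) (at (snd c x)))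
    (at (snd c x))"
  using assms by (auto simp: differentiable_atlas_def charts_at_def frechet_derivative_works [symmetric])

lemma has_derivative_change_chart:
  assumes M: "differentiable_atlas M" and c: "c \<in> charts_at M x" and d: "d \<in> charts_at M x"
    and h: "(h \<circ> chart_inv d has_derivative D) (at (snd d x))"
  shows "(h \<circ> chart_inv c has_derivative D \<circ> frechet_derivative (snd d \<circ> chart_inv c) (at (snd c x)))
    (at (snd c x))"
proof (rule has_derivative_transform_within_open)
  let ?O = "snd c ` (fst c \<inter> fst d)"
  show "open ?O" "snd c x \<in> ?O" using open_chart_overlap [OF M c d] by auto
  have "(h \<circ> chart_inv d has_derivative D) (at ((snd d \<circ> chart_inv c) (snd c x)))"
    using h is_chart_at [OF M c] charts_atD [OF c] by simp
  from diff_chain_at [OF transition_has_derivative [OF M c d] this]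
  show "((h \<circ> chart_inv d) \<circ> (snd d \<circ> chart_inv c) has_derivative
    D \<circ> frechet_derivative (snd d \<circ> chart_inv c) (at (snd c x))) (at (snd c x))" .
  show "((h \<circ> chart_inv d) \<circ> (snd d \<circ> chart_inv c)) y = (h \<circ> chart_inv c) y" if "y \<in> ?O" for y
    using that is_chart_at [OF M c] is_chart_at [OF M d] by auto
qed

lemma transition_derivative_comp:
  assumes "differentiable_atlas M" "c \<in> charts_at M x" "d \<in> charts_at M x" "b \<in> charts_at M x"
  shows "frechet_derivative (snd b \<circ> chart_inv c) (at (snd c x)) v =
    frechet_derivative (snd b \<circ> chart_inv d) (at (snd d x))
      (frechet_derivative (snd d \<circ> chart_inv c) (at (snd c x)) v)"
  using fun_cong [OF frechet_derivative_at [OF has_derivative_change_chart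
        [OF assms(1-3) transition_has_derivative [OF assms(1,3,4)]]], of v]
  by simp

lemma transition_derivative_refl:
  assumes "differentiable_atlas M" "c \<in> charts_at M x"
  shows "frechet_derivative (snd c \<circ> chart_inv c) (at (snd c x)) v = v"
proof -
  have "((\<lambda>y. y) has_derivative (\<lambda>v. v)) (at (snd c x))" by simp
  then have "(snd c \<circ> chart_inv c has_derivative (\<lambda>v. v)) (at (snd c x))"
    by (rule has_derivative_transform_within_open
        [OF _ conjunct1 [OF open_chart_overlap [OF assms assms(2)]]
          conjunct2 [OF open_chart_overlap [OF assms assms(2)]]])
      (use is_chart_at [OF assms] in auto)
  from fun_cong [OF frechet_derivative_at [OF this], of v] show ?thesis by simp
qed

lemma chart_vector_at_chart:
  assumes "differentiable_atlas M" "c \<in> charts_at M x"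
  shows "chart_vector M c x e c = e"
  using assms by (simp add: chart_vector_def transition_derivative_refl)

lemma tangent_spaceI:
  assumes "\<And>c. c \<notin> charts_at M x \<Longrightarrow> v c = 0"
    and "\<And>c d. c \<in> charts_at M x \<Longrightarrow> d \<in> charts_at M x \<Longrightarrow>
      v d = frechet_derivative (snd d \<circ> chart_inv c) (at (snd c x)) (v c)"
  shows "v \<in> tangent_space M x"
  using assms unfolding tangent_space_def by blast

lemma chart_vector_in_tangent_space:
  assumes "differentiable_atlas M" "c \<in> charts_at M x"
  shows "chart_vector M c x e \<in> tangent_space M x"
  by (auto simp: tangent_space_def chart_vector_def intro: transition_derivative_comp [OF assms])

lemma tangent_change_chart:
  assumes "v \<in> tangent_space M x" "c \<in> charts_at M x" "d \<in> charts_at M x"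
  shows "frechet_derivative (snd d \<circ> chart_inv c) (at (snd c x)) (v c) = v d"
  using assms unfolding tangent_space_def mem_Collect_eq by metis

lemma tangent_off_charts: "v \<in> tangent_space M x \<Longrightarrow> c \<notin> charts_at M x \<Longrightarrow> v c = 0"
  unfolding tangent_space_def by blast

lemma tangent_eq_chart_vector:
  assumes "v \<in> tangent_space M x" "c \<in> charts_at M x"
  shows "chart_vector M c x (v c) = v"
proof
  fix d
  show "chart_vector M c x (v c) d = v d"
    using tangent_change_chart [OF assms, of d] tangent_off_charts [OF assms(1), of d]
    by (simp add: chart_vector_def)
qed

lemma tangent_eqI:
  assumes "c \<in> charts_at M x" "u \<in> tangent_space M x" "v \<in> tangent_space M x" "u c = v c"
  shows "u = v"
  using assms tangent_eq_chart_vector by metis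

lemma chart_vector_linear:
  assumes "differentiable_atlas M" "c \<in> charts_at M x"
  shows "linear (\<lambda>e. chart_vector M c x e d)"
proof (cases "d \<in> charts_at M x")
  case True
  then have "linear (frechet_derivative (snd d \<circ> chart_inv c) (at (snd c x)))"
    using transition_has_derivative [OF assms True] has_derivative_linear by blast
  with True show ?thesis by (simp add: chart_vector_def)
qed (simp add: chart_vector_def module_hom_zero linear_zero)

lemma chart_vector_add:
  assumes "differentiable_atlas M" "c \<in> charts_at M x"
  shows "(\<lambda>d. chart_vector M c x e d + chart_vector M c x f d) = chart_vector M c x (e + f)"
  using linear_add [OF chart_vector_linear [OF assms]] by auto

lemma chart_vector_scale:
  assumes "differentiable_atlas M" "c \<in> charts_at M x"
  shows "(\<lambda>d. r *\<^sub>R chart_vector M c x e d) = chart_vector M c x (r *\<^sub>R e)"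
  using linear_cmul [OF chart_vector_linear [OF assms]] by auto

lemma tangent_space_add:
  assumes M: "differentiable_atlas M" and c: "c \<in> charts_at M x"
    and "u \<in> tangent_space M x" "v \<in> tangent_space M x"
  shows "(\<lambda>d. u d + v d) \<in> tangent_space M x"
  using chart_vector_add [OF M c, of "u c" "v c"] chart_vector_in_tangent_space [OF M c, of "u c + v c"]
    tangent_eq_chart_vector [OF assms(3) c] tangent_eq_chart_vector [OF assms(4) c]
  by simp

lemma tangent_space_scale:
  assumes M: "differentiable_atlas M" and c: "c \<in> charts_at M x" and "v \<in> tangent_space M x"
  shows "(\<lambda>d. r *\<^sub>R v d) \<in> tangent_space M x"
  using chart_vector_scale [OF M c, of r "v c"] chart_vector_in_tangent_space [OF M c, of "r *\<^sub>R v c"]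
    tangent_eq_chart_vector [OF assms(3) c]
  by simp

text \<open>Frees \<open>tangent_map\<close> from the chart that it selects: the entries of
  \<open>v\<close> in the selected chart and in \<open>c\<close> are related by the transition law
  of tangent vectors. The inclusion \<open>sub\<close> holds for the projections of products and of
  cotangent bundles, which are the maps whose tangent maps occur.\<close>

lemma tangent_map_eq_chart_vector:
  assumes M: "differentiable_atlas M" and N: "differentiable_atlas N"
    and c: "c \<in> charts_at M x" and d: "d \<in> charts_at N (F x)" and sub: "F ` fst c \<subseteq> fst d"
    and D: "(snd d \<circ> F \<circ> chart_inv c has_derivative D) (at (snd c x))"
    and v: "v \<in> tangent_space M x"
  shows "tangent_map M N F x v = chart_vector N d (F x) (D (v c))"
proof
  fix b
  define c0 where "c0 = (SOME c. c \<in> charts_at M x)"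
  have c0: "c0 \<in> charts_at M x" using c unfolding c0_def by (metis someI)
  show "tangent_map M N F x v b = chart_vector N d (F x) (D (v c)) b"
  proof (cases "b \<in> charts_at N (F x)")
    case True
    let ?T = "frechet_derivative (snd b \<circ> chart_inv d) (at (snd d (F x)))"
    have cc: "is_chart c" "x \<in> fst c" using is_chart_at [OF M c] charts_atD [OF c] by auto
    have "((snd b \<circ> chart_inv d) \<circ> (snd d \<circ> F \<circ> chart_inv c) has_derivative ?T \<circ> D) (at (snd c x))"
      using transition_has_derivative [OF N d True] cc by (intro diff_chain_at [OF D]) simp
    then have "(snd b \<circ> F \<circ> chart_inv c has_derivative ?T \<circ> D) (at (snd c x))"
    proof (rule has_derivative_transform_within_open)
      show "open (snd c ` fst c)" "snd c x \<in> snd c ` fst c" using cc by (auto simp: is_chart_def)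
      show "((snd b \<circ> chart_inv d) \<circ> (snd d \<circ> F \<circ> chart_inv c)) y = (snd b \<circ> F \<circ> chart_inv c) y"
        if "y \<in> snd c ` fst c" for y
        using that cc(1) sub is_chart_at [OF N d] by auto
    qed
    from frechet_derivative_at [OF has_derivative_change_chart [OF M c0 c this]]
    have "frechet_derivative (snd b \<circ> F \<circ> chart_inv c0) (at (snd c0 x)) (v c0) =
      ?T (D (frechet_derivative (snd c \<circ> chart_inv c0) (at (snd c0 x)) (v c0)))"
      by (metis comp_apply)
    also have "frechet_derivative (snd c \<circ> chart_inv c0) (at (snd c0 x)) (v c0) = v c"
      by (rule tangent_change_chart [OF v c0 c])
    finally show ?thesis
      using True unfolding tangent_map_def chart_vector_def c0_def [symmetric] Let_def
      by (simp only: if_True)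
  qed (simp add: tangent_map_def chart_vector_def Let_def)
qed

section \<open>Velocities of curves\<close>

text \<open>What \<open>smooth_map\<close> from an interval amounts to, without the topology of the
  interval and without the inverse of its chart: continuity is expressed by the openness of the
  times spent in each chart.\<close>

definition smooth_curve :: "('m, 'e::real_normed_vector) atlas \<Rightarrow> real \<Rightarrow> (real \<Rightarrow> 'm) \<Rightarrow> bool"
  where "smooth_curve M \<epsilon> \<gamma> \<longleftrightarrow> \<gamma> ` {-\<epsilon><..<\<epsilon>} \<subseteq> points M \<and>
    (\<forall>c\<in>M. open {t\<in>{-\<epsilon><..<\<epsilon>}. \<gamma> t \<in> fst c} \<and> smooth_on (snd c \<circ> \<gamma>) {t\<in>{-\<epsilon><..<\<epsilon>}. \<gamma> t \<in> fst c})"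

text \<open>The defining family can be read off from \<open>topology\<close> once it is known to be
  a topology; closure under intersections rests on the injectivity of charts.\<close>

lemma openin_manifold_topology:
  assumes "differentiable_atlas M"
  shows "openin (manifold_topology M) W \<longleftrightarrow> W \<subseteq> points M \<and> (\<forall>c\<in>M. open (snd c ` (W \<inter> fst c)))"
proof -
  let ?P = "\<lambda>W. W \<subseteq> points M \<and> (\<forall>c\<in>M. open (snd c ` (W \<inter> fst c)))"
  have "istopology ?P"
    unfolding istopology_def
  proof (intro conjI allI impI ballI)
    fix S T c assume *: "?P S" "?P T"
    show "S \<inter> T \<subseteq> points M" using * by blast
    assume "c \<in> M"
    then have "inj_on (snd c) (fst c)" using assms by (simp add: differentiable_atlas_def is_chart_def)
    then have "snd c ` ((S \<inter> T) \<inter> fst c) = snd c ` (S \<inter> fst c) \<inter> snd c ` (T \<inter> fst c)"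
      by (auto simp: inj_on_def)
    then show "open (snd c ` ((S \<inter> T) \<inter> fst c))" using * \<open>c \<in> M\<close> by auto
  next
    fix K c assume *: "\<forall>S\<in>K. ?P S"
    show "\<Union>K \<subseteq> points M" using * by blast
    assume "c \<in> M"
    have "snd c ` (\<Union>K \<inter> fst c) = (\<Union>S\<in>K. snd c ` (S \<inter> fst c))" by auto
    then show "open (snd c ` (\<Union>K \<inter> fst c))" using * \<open>c \<in> M\<close> by auto
  qed
  then show ?thesis unfolding manifold_topology_def by (simp add: topology_inverse')
qed

lemma topspace_manifold_topology:
  assumes "differentiable_atlas M"
  shows "topspace (manifold_topology M) = points M"
proof (rule antisym)
  show "topspace (manifold_topology M) \<subseteq> points M"
    using openin_topspace [of "manifold_topology M"] openin_manifold_topology [OF assms] by blast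
  have "snd c ` (points M \<inter> fst c) = snd c ` fst c" if "c \<in> M" for c
    using that by (auto simp: points_def)
  then have "openin (manifold_topology M) (points M)"
    using assms unfolding openin_manifold_topology [OF assms]
    by (simp add: differentiable_atlas_def is_chart_def)
  then show "points M \<subseteq> topspace (manifold_topology M)" by (rule openin_subset)
qed

lemma openin_chart_domain:
  assumes "differentiable_atlas M" "c \<in> M"
  shows "openin (manifold_topology M) (fst c)"
  using assms unfolding openin_manifold_topology [OF assms(1)] differentiable_atlas_def
  by (auto simp: points_def Int_commute)

lemma differentiable_atlas_interval: "differentiable_atlas {({-\<epsilon><..<\<epsilon>::real}, \<lambda>t. t)}"
proof -
  have "((\<lambda>t. t) \<circ> chart_inv ({-\<epsilon><..<\<epsilon>}, \<lambda>t. t)) differentiable at y" if "y \<in> {-\<epsilon><..<\<epsilon>}" for y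
  proof -
    have "((\<lambda>t. t) has_derivative (\<lambda>t. t)) (at y)" by simp
    then have "((\<lambda>t. t) \<circ> chart_inv ({-\<epsilon><..<\<epsilon>}, \<lambda>t. t) has_derivative (\<lambda>t. t)) (at y)"
      by (rule has_derivative_transform_within_open [OF _ open_greaterThanLessThan that])
        (use coord_chart_inv [of _ "({-\<epsilon><..<\<epsilon>}, \<lambda>t. t)"] in auto)
    then show ?thesis by (rule differentiableI)
  qed
  then show ?thesis by (auto simp: differentiable_atlas_def is_chart_def)
qed

lemma smooth_map_interval_iff:
  assumes M: "differentiable_atlas M"
  shows "smooth_map {({-\<epsilon><..<\<epsilon>}, \<lambda>t. t)} M \<gamma> \<longleftrightarrow> smooth_curve M \<epsilon> \<gamma>"
proof -
  let ?I = "{-\<epsilon><..<\<epsilon>}" and ?R = "{({-\<epsilon><..<\<epsilon>}, \<lambda>t::real. t)}"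
  have pR: "points ?R = ?I" by (simp add: points_def)
  have oR: "openin (manifold_topology ?R) W \<longleftrightarrow> W \<subseteq> ?I \<and> open (W \<inter> ?I)" for W
    unfolding openin_manifold_topology [OF differentiable_atlas_interval] pR by simp
  have tR: "topspace (manifold_topology ?R) = ?I"
    using topspace_manifold_topology [OF differentiable_atlas_interval] pR by metis
  have inv: "chart_inv ({-\<epsilon><..<\<epsilon>}, \<lambda>t. t) t = t" if "t \<in> ?I" for t
    using coord_chart_inv [of t "({-\<epsilon><..<\<epsilon>}, \<lambda>t. t)"] that by simp
  have sm: "smooth_on (snd d \<circ> \<gamma> \<circ> chart_inv ({-\<epsilon><..<\<epsilon>}, \<lambda>t. t)) (?I \<inter> \<gamma> -` fst d) \<longleftrightarrow>
      smooth_on (snd d \<circ> \<gamma>) {t\<in>?I. \<gamma> t \<in> fst d}"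
    if o: "open {t\<in>?I. \<gamma> t \<in> fst d}" for d
  proof -
    have eq: "?I \<inter> \<gamma> -` fst d = {t\<in>?I. \<gamma> t \<in> fst d}" by auto
    show ?thesis
      unfolding eq using smooth_on_cong [OF o] inv by (smt (verit, best) comp_apply mem_Collect_eq)
  qed
  show ?thesis
  proof
    assume L: "smooth_map ?R M \<gamma>"
    have o: "open {t\<in>?I. \<gamma> t \<in> fst c}" if "c \<in> M" for c
    proof -
      have "openin (manifold_topology ?R) {t\<in>topspace (manifold_topology ?R). \<gamma> t \<in> fst c}"
        using L openin_chart_domain [OF M that] unfolding smooth_map_def
        by (intro openin_continuous_map_preimage) auto
      then have "open ({t\<in>?I. \<gamma> t \<in> fst c} \<inter> ?I)" unfolding oR tR by blast
      moreover have "{t\<in>?I. \<gamma> t \<in> fst c} \<inter> ?I = {t\<in>?I. \<gamma> t \<in> fst c}" by auto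
      ultimately show ?thesis by simp
    qed
    show "smooth_curve M \<epsilon> \<gamma>"
      using L o sm [OF o] unfolding smooth_map_def smooth_curve_def pR by simp
  next
    assume R: "smooth_curve M \<epsilon> \<gamma>"
    have "continuous_map (manifold_topology ?R) (manifold_topology M) \<gamma>"
      unfolding continuous_map_def
    proof (intro conjI allI impI)
      show "\<gamma> \<in> topspace (manifold_topology ?R) \<rightarrow> topspace (manifold_topology M)"
        using R unfolding tR topspace_manifold_topology [OF M] smooth_curve_def by auto
      fix W assume W: "openin (manifold_topology M) W"
      \<comment> \<open>Continuity is recovered chart by chart: while the curve is in
        \<open>c\<close>, membership in \<open>W\<close> is an open condition on the coordinate
        curve, and injectivity of \<open>c\<close> allows to read it back on the manifold.\<close>
      have "{t\<in>?I. \<gamma> t \<in> W} = (\<Union>c\<in>M. {t\<in>?I. \<gamma> t \<in> fst c} \<inter> (snd c \<circ> \<gamma>) -` (snd c ` (W \<inter> fst c)))"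
        (is "_ = (\<Union>c\<in>M. ?Q c)")
      proof (rule set_eqI, rule iffI)
        fix t assume "t \<in> {t\<in>?I. \<gamma> t \<in> W}"
        moreover have "W \<subseteq> points M" using W openin_manifold_topology [OF M] by blast
        ultimately obtain c where "c \<in> M" "\<gamma> t \<in> W \<inter> fst c" "t \<in> ?I"
          by (auto simp: points_def)
        then show "t \<in> (\<Union>c\<in>M. ?Q c)" by auto
      next
        fix t assume "t \<in> (\<Union>c\<in>M. ?Q c)"
        then obtain c x where c: "c \<in> M" "t \<in> ?I" "\<gamma> t \<in> fst c" "x \<in> W \<inter> fst c" "snd c (\<gamma> t) = snd c x"
          by auto
        then have "\<gamma> t = x"
          using M unfolding differentiable_atlas_def is_chart_def by (meson IntD2 inj_onD)
        then show "t \<in> {t\<in>?I. \<gamma> t \<in> W}" using c by simp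
      qed
      moreover have "open (?Q c)" if "c \<in> M" for c
        using R W that unfolding smooth_curve_def openin_manifold_topology [OF M]
        by (intro continuous_open_preimage smooth_on_imp_continuous_on) auto
      ultimately have "open {t\<in>?I. \<gamma> t \<in> W}" by auto
      moreover have "{t\<in>?I. \<gamma> t \<in> W} \<inter> ?I = {t\<in>?I. \<gamma> t \<in> W}" by auto
      ultimately show "openin (manifold_topology ?R) {t \<in> topspace (manifold_topology ?R). \<gamma> t \<in> W}"
        unfolding oR tR by auto
    qed
    moreover have "smooth_on (snd d \<circ> \<gamma> \<circ> chart_inv ({-\<epsilon><..<\<epsilon>}, \<lambda>t. t)) (?I \<inter> \<gamma> -` fst d)" if "d \<in> M" for d
      using R sm [of d] that unfolding smooth_curve_def by blast
    ultimately show "smooth_map ?R M \<gamma>"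
      using R unfolding smooth_map_def smooth_curve_def pR by simp
  qed
qed

lemma sub_tangent_space_eq:
  assumes "differentiable_atlas M"
  shows "sub_tangent_space M H x =
    {velocity M \<gamma> | \<gamma>. \<exists>\<epsilon>>0. smooth_curve M \<epsilon> \<gamma> \<and> \<gamma> ` {-\<epsilon><..<\<epsilon>} \<subseteq> H \<and> \<gamma> 0 = x}"
  unfolding sub_tangent_space_def smooth_map_interval_iff [OF assms] ..

lemma smooth_curve_has_vector_derivative:
  assumes "smooth_curve M \<epsilon> \<gamma>" "\<epsilon> > 0" "c \<in> charts_at M (\<gamma> 0)"
  shows "(snd c \<circ> \<gamma> has_vector_derivative vector_derivative (snd c \<circ> \<gamma>) (at 0)) (at 0)"
proof -
  have "smooth_on (snd c \<circ> \<gamma>) {t\<in>{-\<epsilon><..<\<epsilon>}. \<gamma> t \<in> fst c}"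
    using assms(1) charts_atD [OF assms(3)] unfolding smooth_curve_def by blast
  moreover have "0 \<in> {t\<in>{-\<epsilon><..<\<epsilon>}. \<gamma> t \<in> fst c}" using assms(2) charts_atD [OF assms(3)] by auto
  ultimately have "(snd c \<circ> \<gamma>) differentiable at 0" by (rule smooth_on_imp_differentiable)
  then show ?thesis by (rule vector_derivative_works [THEN iffD1])
qed

lemma velocity_in_tangent_space:
  assumes M: "differentiable_atlas M" and \<gamma>: "smooth_curve M \<epsilon> \<gamma>" "\<epsilon> > 0"
  shows "velocity M \<gamma> \<in> tangent_space M (\<gamma> 0)"
proof -
  have eq: "vector_derivative (snd d \<circ> \<gamma>) (at 0) =
      frechet_derivative (snd d \<circ> chart_inv c) (at (snd c (\<gamma> 0))) (vector_derivative (snd c \<circ> \<gamma>) (at 0))"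
    if c: "c \<in> charts_at M (\<gamma> 0)" and d: "d \<in> charts_at M (\<gamma> 0)" for c d
  proof -
    let ?T = "frechet_derivative (snd d \<circ> chart_inv c) (at (snd c (\<gamma> 0)))"
    let ?w = "vector_derivative (snd c \<circ> \<gamma>) (at 0)"
    have D: "(snd d \<circ> chart_inv c has_derivative ?T) (at ((snd c \<circ> \<gamma>) 0))"
      using transition_has_derivative [OF M c d] by simp
    have "((snd d \<circ> chart_inv c) \<circ> (snd c \<circ> \<gamma>) has_derivative ?T \<circ> (\<lambda>t. t *\<^sub>R ?w)) (at 0)"
      using diff_chain_at [where f = "snd c \<circ> \<gamma>" and x = 0, OF _ D] smooth_curve_has_vector_derivative [OF \<gamma> c]
      unfolding has_vector_derivative_def by blast
    then have "(snd d \<circ> \<gamma> has_derivative ?T \<circ> (\<lambda>t. t *\<^sub>R ?w)) (at 0)"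
    proof (rule has_derivative_transform_within_open)
      show "open {t\<in>{-\<epsilon><..<\<epsilon>}. \<gamma> t \<in> fst c}"
        using \<gamma>(1) charts_atD [OF c] unfolding smooth_curve_def by blast
      show "0 \<in> {t\<in>{-\<epsilon><..<\<epsilon>}. \<gamma> t \<in> fst c}" using \<gamma>(2) charts_atD [OF c] by auto
    qed (use is_chart_at [OF M c] in auto)
    moreover have "?T \<circ> (\<lambda>t. t *\<^sub>R ?w) = (\<lambda>t. t *\<^sub>R ?T ?w)"
      using linear_cmul [OF has_derivative_linear [OF D]] by auto
    ultimately have "(snd d \<circ> \<gamma> has_vector_derivative ?T ?w) (at 0)"
      unfolding has_vector_derivative_def by simp
    then show ?thesis by (rule vector_derivative_at)
  qed
  have vel: "velocity M \<gamma> c = vector_derivative (snd c \<circ> \<gamma>) (at 0)" if "c \<in> charts_at M (\<gamma> 0)" for c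
    using that by (simp add: velocity_def)
  show ?thesis
  proof (rule tangent_spaceI)
    show "velocity M \<gamma> c = 0" if "c \<notin> charts_at M (\<gamma> 0)" for c
      using that by (simp add: velocity_def)
    fix c d assume c: "c \<in> charts_at M (\<gamma> 0)" and d: "d \<in> charts_at M (\<gamma> 0)"
    show "velocity M \<gamma> d =
        frechet_derivative (snd d \<circ> chart_inv c) (at (snd c (\<gamma> 0))) (velocity M \<gamma> c)"
      unfolding vel [OF c] vel [OF d] by (rule eq [OF c d])
  qed
qed

lemma sub_tangent_space_subset:
  "differentiable_atlas M \<Longrightarrow> sub_tangent_space M H x \<subseteq> tangent_space M x"
  unfolding sub_tangent_space_eq using velocity_in_tangent_space by fastforce

lemma sub_tangent_space_mono:
  "H \<subseteq> H' \<Longrightarrow> sub_tangent_space M H x \<subseteq> sub_tangent_space M H' x"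
  unfolding sub_tangent_space_def by blast

text \<open>Tangent vectors are families over all charts; a single entry determines the family, so
  linear algebra can take place in the model space. A priori this is only a set of vectors, not a
  subspace.\<close>

definition coord_tangent ::
    "('m, 'e::real_normed_vector) atlas \<Rightarrow> 'm set \<Rightarrow> ('m, 'e) chart \<Rightarrow> 'm \<Rightarrow> 'e set"
  where "coord_tangent M H c x = (\<lambda>v. v c) ` sub_tangent_space M H x"

lemma coord_tangent_mono: "H \<subseteq> H' \<Longrightarrow> coord_tangent M H c x \<subseteq> coord_tangent M H' c x"
  unfolding coord_tangent_def by (intro image_mono sub_tangent_space_mono)

lemma coord_tangent_eq:
  assumes "differentiable_atlas M" "c \<in> charts_at M x"
  shows "coord_tangent M H c x =
    {vector_derivative (snd c \<circ> \<gamma>) (at 0) | \<gamma>. \<exists>\<epsilon>>0. smooth_curve M \<epsilon> \<gamma> \<and> \<gamma> ` {-\<epsilon><..<\<epsilon>} \<subseteq> H \<and> \<gamma> 0 = x}"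
proof -
  have vel: "velocity M \<gamma> c = vector_derivative (snd c \<circ> \<gamma>) (at 0)" if "\<gamma> 0 = x" for \<gamma>
    using assms(2) that by (simp add: velocity_def)
  show ?thesis (is "_ = ?R")
  proof (intro set_eqI iffI)
    fix e assume "e \<in> coord_tangent M H c x"
    then obtain \<gamma> \<epsilon> where "e = velocity M \<gamma> c" and *: "\<epsilon> > 0" "smooth_curve M \<epsilon> \<gamma>"
        "\<gamma> ` {-\<epsilon><..<\<epsilon>} \<subseteq> H" "\<gamma> 0 = x"
      unfolding coord_tangent_def sub_tangent_space_eq [OF assms(1)] by blast
    then show "e \<in> ?R" unfolding vel [of \<gamma>, OF *(4)] by blast
  next
    fix e assume "e \<in> ?R"
    then obtain \<gamma> \<epsilon> where e: "e = vector_derivative (snd c \<circ> \<gamma>) (at 0)" and *: "\<epsilon> > 0" "smooth_curve M \<epsilon> \<gamma>"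
        "\<gamma> ` {-\<epsilon><..<\<epsilon>} \<subseteq> H" "\<gamma> 0 = x"
      by blast
    then have "velocity M \<gamma> \<in> sub_tangent_space M H x"
      unfolding sub_tangent_space_eq [OF assms(1)] by blast
    then show "e \<in> coord_tangent M H c x"
      unfolding coord_tangent_def e vel [of \<gamma>, OF *(4), symmetric] by (rule imageI)
  qed
qed

lemma in_sub_tangent_space_iff:
  assumes "differentiable_atlas M" "c \<in> charts_at M x"
  shows "v \<in> sub_tangent_space M H x \<longleftrightarrow> v \<in> tangent_space M x \<and> v c \<in> coord_tangent M H c x"
proof
  assume "v \<in> sub_tangent_space M H x"
  then show "v \<in> tangent_space M x \<and> v c \<in> coord_tangent M H c x"
    using sub_tangent_space_subset [OF assms(1)] unfolding coord_tangent_def by blast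
next
  assume v: "v \<in> tangent_space M x \<and> v c \<in> coord_tangent M H c x"
  then obtain w where "w \<in> sub_tangent_space M H x" "v c = w c"
    unfolding coord_tangent_def by blast
  then show "v \<in> sub_tangent_space M H x"
    using v sub_tangent_space_subset [OF assms(1)] tangent_eqI [OF assms(2), of v w] by blast
qed

text \<open>Every vector of the model space is the entry of a tangent vector, so the orthogonal
  within the tangent space turns into the orthogonal within the whole model space.\<close>

lemma sub_tangent_space_orthogonal_iff:
  assumes M: "differentiable_atlas M" and c: "c \<in> charts_at M x"
    and \<omega>: "\<And>u v. u \<in> tangent_space M x \<Longrightarrow> v \<in> tangent_space M x \<Longrightarrow> \<omega> x u v = W (u c) (v c)"
  shows "sub_tangent_space M H x = {u \<in> tangent_space M x. \<forall>v\<in>sub_tangent_space M H x. \<omega> x u v = 0} \<longleftrightarrow>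
    coord_tangent M H c x = {e. \<forall>k\<in>coord_tangent M H c x. W e k = 0}"
proof -
  let ?K = "coord_tangent M H c x"
  note in_iff = in_sub_tangent_space_iff [OF M c]
  have vec: "chart_vector M c x e \<in> tangent_space M x" "chart_vector M c x e c = e" for e
    using chart_vector_in_tangent_space [OF M c] chart_vector_at_chart [OF M c] by auto
  have orth: "(\<forall>v\<in>sub_tangent_space M H x. \<omega> x u v = 0) \<longleftrightarrow> (\<forall>k\<in>?K. W (u c) k = 0)"
    if "u \<in> tangent_space M x" for u
    using \<omega> [OF that] sub_tangent_space_subset [OF M] unfolding coord_tangent_def by (auto simp: subset_iff)
  show ?thesis (is "?L \<longleftrightarrow> ?R")
  proof
    assume ?L
    then have "chart_vector M c x e \<in> sub_tangent_space M H x \<longleftrightarrow> (\<forall>k\<in>?K. W e k = 0)" for e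
      using orth [OF vec(1) [of e]] vec by auto
    moreover have "chart_vector M c x e \<in> sub_tangent_space M H x \<longleftrightarrow> e \<in> ?K" for e
      unfolding in_iff vec(2) using vec(1) by simp
    ultimately show ?R by blast
  next
    assume R: ?R
    have "u \<in> sub_tangent_space M H x \<longleftrightarrow> u \<in> tangent_space M x \<and> (\<forall>v\<in>sub_tangent_space M H x. \<omega> x u v = 0)"
      for u
      using orth [of u] in_iff [of u H] R by blast
    then show ?L by blast
  qed
qed

section \<open>Products of atlases\<close>

definition smooth_atlas :: "('m, 'e::real_normed_vector) atlas \<Rightarrow> bool"
  where "smooth_atlas M \<longleftrightarrow> (\<forall>c\<in>M. is_chart c) \<and> (\<forall>c\<in>M. \<forall>d\<in>M. compatible c d)"

lemma smooth_manifold_imp_smooth_atlas: "smooth_manifold M \<Longrightarrow> smooth_atlas M"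
  by (simp add: smooth_manifold_def smooth_atlas_def)

lemma smooth_atlas_imp_differentiable_atlas: "smooth_atlas M \<Longrightarrow> differentiable_atlas M"
  unfolding smooth_atlas_def differentiable_atlas_def compatible_def
  by (blast intro: smooth_on_imp_differentiable)

definition prod_chart :: "('m, 'e) chart \<Rightarrow> ('n, 'f) chart \<Rightarrow> ('m \<times> 'n, 'e \<times> 'f) chart"
  where "prod_chart c d = (fst c \<times> fst d, map_prod (snd c) (snd d))"

lemma fst_prod_chart [simp]: "fst (prod_chart c d) = fst c \<times> fst d"
  by (simp add: prod_chart_def)

lemma snd_prod_chart [simp]: "snd (prod_chart c d) (x, y) = (snd c x, snd d y)"
  by (simp add: prod_chart_def)

lemma prod_atlas_eq: "prod_atlas M N = {prod_chart c d | c d. c \<in> M \<and> d \<in> N}"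
  by (simp add: prod_atlas_def prod_chart_def)

lemma charts_at_prod_iff:
  fixes M :: "('a, 'c) atlas" and N :: "('b, 'd) atlas"
  shows "K \<in> charts_at (prod_atlas M N) (x, y) \<longleftrightarrow>
    (\<exists>c d. K = prod_chart c d \<and> c \<in> charts_at M x \<and> d \<in> charts_at N y)"
proof -
  have "(x, y) \<in> fst (prod_chart c d) \<longleftrightarrow> x \<in> fst c \<and> y \<in> fst d" for c :: "('a, 'c) chart" and d :: "('b, 'd) chart"
    by simp
  then show ?thesis unfolding charts_at_def prod_atlas_eq mem_Collect_eq by blast
qed

lemma points_prod: "points (prod_atlas M N) = points M \<times> points N"
  unfolding points_def prod_atlas_eq by fastforce

lemma image_prod_chart: "snd (prod_chart c d) ` (U \<times> V) = snd c ` U \<times> snd d ` V"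
  by (auto simp: image_iff prod_chart_def)

lemma is_chart_prod:
  assumes "is_chart c" "is_chart d"
  shows "is_chart (prod_chart c d)"
  using assms unfolding is_chart_def fst_prod_chart image_prod_chart
  by (auto simp: inj_on_def open_Times)

lemma chart_inv_prod:
  assumes "is_chart c" "is_chart d" "y \<in> snd c ` fst c" "z \<in> snd d ` fst d"
  shows "chart_inv (prod_chart c d) (y, z) = (chart_inv c y, chart_inv d z)"
proof -
  have "chart_inv (prod_chart c d) (snd (prod_chart c d) (chart_inv c y, chart_inv d z)) =
    (chart_inv c y, chart_inv d z)"
    using assms by (intro chart_inv_coord is_chart_prod) (simp_all add: chart_inv_in)
  then show ?thesis using assms by (simp add: coord_chart_inv)
qed

lemma prod_transition:
  assumes "is_chart c" "is_chart d" "w \<in> snd c ` fst c \<times> snd d ` fst d"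
  shows "(snd (prod_chart c' d') \<circ> chart_inv (prod_chart c d)) w =
    ((snd c' \<circ> chart_inv c) (fst w), (snd d' \<circ> chart_inv d) (snd w))"
  using assms by (auto simp: chart_inv_prod)

lemma prod_overlap:
  "snd (prod_chart c d) ` (fst (prod_chart c d) \<inter> fst (prod_chart c' d')) =
    snd c ` (fst c \<inter> fst c') \<times> snd d ` (fst d \<inter> fst d')"
  unfolding fst_prod_chart Times_Int_Times image_prod_chart ..

text \<open>Stated for differentiable atlases because it has to apply to products of cotangent
  bundles.\<close>

lemma differentiable_atlas_prod:
  assumes M: "differentiable_atlas M" and N: "differentiable_atlas N"
  shows "differentiable_atlas (prod_atlas M N)"
  unfolding differentiable_atlas_def
proof (intro conjI ballI)
  fix K assume "K \<in> prod_atlas M N"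
  then obtain c d where K: "K = prod_chart c d" "c \<in> M" "d \<in> N" unfolding prod_atlas_eq by blast
  then have cd: "is_chart c" "is_chart d" using M N by (auto simp: differentiable_atlas_def)
  show "is_chart K" unfolding K(1) using cd by (rule is_chart_prod)
  fix K' assume "K' \<in> prod_atlas M N"
  then obtain c' d' where K': "K' = prod_chart c' d'" "c' \<in> M" "d' \<in> N" unfolding prod_atlas_eq by blast
  let ?U = "snd c ` (fst c \<inter> fst c')" and ?V = "snd d ` (fst d \<inter> fst d')"
  have open_UV: "open ?U" "open ?V"
    and diff: "\<And>y. y \<in> ?U \<Longrightarrow> (snd c' \<circ> chart_inv c) differentiable at y"
      "\<And>y. y \<in> ?V \<Longrightarrow> (snd d' \<circ> chart_inv d) differentiable at y"
    using M N K K' unfolding differentiable_atlas_def by blast+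
  show "open (snd K ` (fst K \<inter> fst K'))"
    unfolding K(1) K'(1) prod_overlap using open_UV by (rule open_Times)
  fix w assume "w \<in> snd K ` (fst K \<inter> fst K')"
  then have w: "w \<in> ?U \<times> ?V" unfolding K(1) K'(1) prod_overlap .
  have fst_snd: "fst w \<in> ?U" "snd w \<in> ?V" using w by auto
  obtain D1 where D1: "(snd c' \<circ> chart_inv c has_derivative D1) (at (fst w))"
    using diff(1) [OF fst_snd(1)] unfolding differentiable_def by blast
  obtain D2 where D2: "(snd d' \<circ> chart_inv d has_derivative D2) (at (snd w))"
    using diff(2) [OF fst_snd(2)] unfolding differentiable_def by blast
  have "((\<lambda>w. ((snd c' \<circ> chart_inv c) (fst w), (snd d' \<circ> chart_inv d) (snd w))) has_derivative
      (\<lambda>h. (D1 (fst h), D2 (snd h)))) (at w)"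
    by (intro has_derivative_Pair has_derivative_compose [where f = fst, OF _ D1]
        has_derivative_compose [where f = snd, OF _ D2] bounded_linear_imp_has_derivative
        bounded_linear_fst bounded_linear_snd)
  then have "(snd K' \<circ> chart_inv K has_derivative (\<lambda>h. (D1 (fst h), D2 (snd h)))) (at w)"
  proof (rule has_derivative_transform_within_open [OF _ open_Times [OF open_UV] w])
    fix w' assume "w' \<in> ?U \<times> ?V"
    then have "w' \<in> snd c ` fst c \<times> snd d ` fst d" by auto
    from prod_transition [OF cd this, of c' d']
    show "((snd c' \<circ> chart_inv c) (fst w'), (snd d' \<circ> chart_inv d) (snd w')) = (snd K' \<circ> chart_inv K) w'"
      unfolding K(1) K'(1) by simp
  qed
  then show "(snd K' \<circ> chart_inv K) differentiable at w" by (rule differentiableI)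
qed

lemma smooth_on_prod_transition:
  assumes "is_chart c" "is_chart d"
    and "open U" "smooth_on (snd c' \<circ> chart_inv c) U" "U \<subseteq> snd c ` fst c"
    and "open V" "smooth_on (snd d' \<circ> chart_inv d) V" "V \<subseteq> snd d ` fst d"
  shows "smooth_on (snd (prod_chart c' d') \<circ> chart_inv (prod_chart c d)) (U \<times> V)"
proof (rule smooth_on_cong)
  show o: "open (U \<times> V)" using assms(3,6) by (rule open_Times)
  have "smooth_on (\<lambda>w. (snd c' \<circ> chart_inv c) (fst w)) (U \<times> V)"
    by (rule smooth_on_subset [OF smooth_on_linear_right [OF assms(3) bounded_linear_fst assms(4)]]) auto
  moreover have "smooth_on (\<lambda>w. (snd d' \<circ> chart_inv d) (snd w)) (U \<times> V)"
    by (rule smooth_on_subset [OF smooth_on_linear_right [OF assms(6) bounded_linear_snd assms(7)]]) auto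
  ultimately
  show "smooth_on (\<lambda>w. ((snd c' \<circ> chart_inv c) (fst w), (snd d' \<circ> chart_inv d) (snd w))) (U \<times> V)"
    by (rule smooth_on_Pair [OF o])
  fix w assume "w \<in> U \<times> V"
  then have "w \<in> snd c ` fst c \<times> snd d ` fst d" using assms(5,8) by auto
  from prod_transition [OF assms(1,2) this, of c' d']
  show "((snd c' \<circ> chart_inv c) (fst w), (snd d' \<circ> chart_inv d) (snd w)) =
      (snd (prod_chart c' d') \<circ> chart_inv (prod_chart c d)) w"
    by simp
qed

lemma compatible_prod:
  assumes "is_chart c" "is_chart d" "is_chart c'" "is_chart d'" "compatible c c'" "compatible d d'"
  shows "compatible (prod_chart c d) (prod_chart c' d')"
proof -
  have overlap': "snd (prod_chart c' d') ` (fst (prod_chart c d) \<inter> fst (prod_chart c' d')) =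
    snd c' ` (fst c \<inter> fst c') \<times> snd d' ` (fst d \<inter> fst d')"
    unfolding fst_prod_chart Times_Int_Times image_prod_chart ..
  show ?thesis
    using assms(5,6) unfolding compatible_def prod_overlap overlap'
    by (intro conjI open_Times smooth_on_prod_transition assms(1-4)) auto
qed

text \<open>As the base of a cotangent bundle, the product has to be smooth and not merely
  differentiable: changes of cotangent charts involve first derivatives of the transition
  maps.\<close>

lemma smooth_atlas_prod:
  assumes "smooth_atlas M" "smooth_atlas N"
  shows "smooth_atlas (prod_atlas M N)"
  using assms unfolding smooth_atlas_def prod_atlas_eq
  by (auto intro!: is_chart_prod compatible_prod)

lemma tangent_map_fst:
  assumes M: "differentiable_atlas M" and N: "differentiable_atlas N"
    and c: "c \<in> charts_at M x" and d: "d \<in> charts_at N y"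
    and v: "v \<in> tangent_space (prod_atlas M N) (x, y)"
  shows "tangent_map (prod_atlas M N) M fst (x, y) v = chart_vector M c x (fst (v (prod_chart c d)))"
proof -
  have K: "prod_chart c d \<in> charts_at (prod_atlas M N) (x, y)"
    unfolding charts_at_prod_iff using c d by blast
  have ch: "is_chart c" "is_chart d" using is_chart_at [OF M c] is_chart_at [OF N d] .
  have "(fst has_derivative fst) (at (snd (prod_chart c d) (x, y)))"
    by (intro bounded_linear_imp_has_derivative bounded_linear_fst)
  then have "(snd c \<circ> fst \<circ> chart_inv (prod_chart c d) has_derivative fst) (at (snd (prod_chart c d) (x, y)))"
  proof (rule has_derivative_transform_within_open)
    show "open (snd c ` fst c \<times> snd d ` fst d)"
      using ch by (intro open_Times) (auto simp: is_chart_def)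
    show "snd (prod_chart c d) (x, y) \<in> snd c ` fst c \<times> snd d ` fst d"
      using charts_atD [OF c] charts_atD [OF d] by simp
  qed (use ch in \<open>auto simp: chart_inv_prod coord_chart_inv\<close>)
  then show ?thesis
    using tangent_map_eq_chart_vector [OF differentiable_atlas_prod [OF M N] M K, where F = fst and d = c] c v
    by simp
qed

lemma tangent_map_snd:
  assumes M: "differentiable_atlas M" and N: "differentiable_atlas N"
    and c: "c \<in> charts_at M x" and d: "d \<in> charts_at N y"
    and v: "v \<in> tangent_space (prod_atlas M N) (x, y)"
  shows "tangent_map (prod_atlas M N) N snd (x, y) v = chart_vector N d y (snd (v (prod_chart c d)))"
proof -
  have K: "prod_chart c d \<in> charts_at (prod_atlas M N) (x, y)"
    unfolding charts_at_prod_iff using c d by blast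
  have ch: "is_chart c" "is_chart d" using is_chart_at [OF M c] is_chart_at [OF N d] .
  have "(snd has_derivative snd) (at (snd (prod_chart c d) (x, y)))"
    by (intro bounded_linear_imp_has_derivative bounded_linear_snd)
  then have "(snd d \<circ> snd \<circ> chart_inv (prod_chart c d) has_derivative snd) (at (snd (prod_chart c d) (x, y)))"
  proof (rule has_derivative_transform_within_open)
    show "open (snd c ` fst c \<times> snd d ` fst d)"
      using ch by (intro open_Times) (auto simp: is_chart_def)
    show "snd (prod_chart c d) (x, y) \<in> snd c ` fst c \<times> snd d ` fst d"
      using charts_atD [OF c] charts_atD [OF d] by simp
  qed (use ch in \<open>auto simp: chart_inv_prod coord_chart_inv\<close>)
  then show ?thesis
    using tangent_map_eq_chart_vector [OF differentiable_atlas_prod [OF M N] N K, where F = snd and d = d] d v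
    by simp
qed

section \<open>Cotangent charts\<close>

text \<open>The inverse of the fibre coordinate in \<open>cotangent_chart\<close>, given explicitly,
  whereas the coordinate itself is specified by \<open>THE\<close>.\<close>

definition covector ::
    "('m, 'e::real_inner) atlas \<Rightarrow> ('m, 'e) chart \<Rightarrow> 'm \<Rightarrow> 'e \<Rightarrow> ('m, 'e) covec"
  where "covector M c x g = (\<lambda>v. if v \<in> tangent_space M x then g \<bullet> v c else 0)"

lemma covector_in_cotangent_space:
  assumes "differentiable_atlas M" "c \<in> charts_at M x"
  shows "covector M c x g \<in> cotangent_space M x"
  using tangent_space_add [OF assms] tangent_space_scale [OF assms]
  by (simp add: cotangent_space_def covector_def inner_add_right)

text \<open>Composed with \<open>chart_vector\<close>, a covector is a linear functional on the
  model space and hence an inner product. The convention that covectors vanish off the tangent space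
  makes the equality one of total functions.\<close>

lemma cotangent_eq_covector:
  fixes M :: "('m, 'e::finite_dim_inner) atlas"
  assumes M: "differentiable_atlas M" and c: "c \<in> charts_at M x" and p: "p \<in> cotangent_space M x"
  shows "\<exists>g. p = covector M c x g"
proof -
  have vec: "chart_vector M c x e \<in> tangent_space M x" for e
    by (rule chart_vector_in_tangent_space [OF M c])
  have "linear (\<lambda>e. p (chart_vector M c x e))"
  proof (rule linearI)
    show "p (chart_vector M c x (e + f)) = p (chart_vector M c x e) + p (chart_vector M c x f)" for e f
      using p vec [of e] vec [of f] unfolding cotangent_space_def chart_vector_add [OF M c, symmetric] by blast
    show "p (chart_vector M c x (r *\<^sub>R e)) = r *\<^sub>R p (chart_vector M c x e)" for r e
      using p vec [of e] unfolding cotangent_space_def chart_vector_scale [OF M c, symmetric] by simp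
  qed
  then obtain g where g: "\<And>e. p (chart_vector M c x e) = g \<bullet> e"
    using riesz_finite_dim by blast
  have "p v = covector M c x g v" for v
  proof (cases "v \<in> tangent_space M x")
    case True
    then show ?thesis using g [of "v c"] tangent_eq_chart_vector [OF True c] by (simp add: covector_def)
  next
    case False
    then show ?thesis using p unfolding cotangent_space_def covector_def by simp
  qed
  then show ?thesis by blast
qed

text \<open>The coefficient vector is unique because chart vectors realize every vector of the model
  space.\<close>

lemma cotangent_chart_covector:
  assumes M: "differentiable_atlas M" and c: "c \<in> charts_at M x"
  shows "snd (cotangent_chart M c) (x, covector M c x g) = (snd c x, g)"
proof -
  have "(THE h. \<forall>v\<in>tangent_space M x. covector M c x g v = h \<bullet> v c) = g"
  proof (rule the_equality)
    fix h assume h: "\<forall>v\<in>tangent_space M x. covector M c x g v = h \<bullet> v c"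
    have "h \<bullet> e = g \<bullet> e" for e
      using h [rule_format, OF chart_vector_in_tangent_space [OF M c, of e]]
      by (simp add: covector_def chart_vector_in_tangent_space [OF M c] chart_vector_at_chart [OF M c])
    then show "h = g" using vector_eq_rdot by blast
  qed (simp add: covector_def)
  then show ?thesis by (simp add: cotangent_chart_def)
qed

lemma fst_cotangent_chart: "fst (cotangent_chart M c) = {(x, p). x \<in> fst c \<and> p \<in> cotangent_space M x}"
  by (simp add: cotangent_chart_def)

lemma charts_at_cotangent_bundle_iff:
  "K \<in> charts_at (cotangent_bundle M) (x, p) \<longleftrightarrow>
    (\<exists>c. K = cotangent_chart M c \<and> c \<in> charts_at M x \<and> p \<in> cotangent_space M x)"
proof -
  have "(x, p) \<in> fst (cotangent_chart M c) \<longleftrightarrow> x \<in> fst c \<and> p \<in> cotangent_space M x" for c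
    by (simp add: fst_cotangent_chart)
  then show ?thesis unfolding charts_at_def cotangent_bundle_def by blast
qed

lemma points_cotangent_bundle:
  "points (cotangent_bundle M) = {(x, p). x \<in> points M \<and> p \<in> cotangent_space M x}"
  unfolding points_def cotangent_bundle_def by (auto simp: fst_cotangent_chart)

lemma cotangent_chart_domain_eq:
  fixes M :: "('m, 'e::finite_dim_inner) atlas"
  assumes M: "differentiable_atlas M" and c: "c \<in> M"
  shows "fst (cotangent_chart M c) = {(x, covector M c x g) | x g. x \<in> fst c}"
proof -
  have "c \<in> charts_at M x" if "x \<in> fst c" for x using c that by (simp add: charts_at_def)
  then show ?thesis
    using cotangent_eq_covector [OF M] covector_in_cotangent_space [OF M] unfolding fst_cotangent_chart
    by blast
qed

text \<open>The set \<open>U\<close> in the base covers two cases at once: \<open>U = UNIV\<close>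
  gives the image of the whole chart, and the domain of a second chart gives the overlap.\<close>

lemma image_cotangent_chart:
  fixes M :: "('m, 'e::finite_dim_inner) atlas"
  assumes M: "differentiable_atlas M" and c: "c \<in> M"
  shows "snd (cotangent_chart M c) ` (fst (cotangent_chart M c) \<inter> {z. fst z \<in> U}) = snd c ` (fst c \<inter> U) \<times> UNIV"
proof -
  have ch: "c \<in> charts_at M x" if "x \<in> fst c" for x using c that by (simp add: charts_at_def)
  show ?thesis
  proof (intro set_eqI iffI)
    fix w assume "w \<in> snd (cotangent_chart M c) ` (fst (cotangent_chart M c) \<inter> {z. fst z \<in> U})"
    then obtain x g where "x \<in> fst c \<inter> U" "w = snd (cotangent_chart M c) (x, covector M c x g)"
      unfolding cotangent_chart_domain_eq [OF M c] by auto
    then show "w \<in> snd c ` (fst c \<inter> U) \<times> UNIV"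
      using cotangent_chart_covector [OF M ch] by auto
  next
    fix w assume "w \<in> snd c ` (fst c \<inter> U) \<times> (UNIV :: 'e set)"
    then obtain x g where x: "x \<in> fst c \<inter> U" "w = (snd c x, g)" by auto
    then have "w = snd (cotangent_chart M c) (x, covector M c x g)"
      using cotangent_chart_covector [OF M ch] by auto
    moreover have "(x, covector M c x g) \<in> fst (cotangent_chart M c) \<inter> {z. fst z \<in> U}"
      unfolding cotangent_chart_domain_eq [OF M c] using x by auto
    ultimately show "w \<in> snd (cotangent_chart M c) ` (fst (cotangent_chart M c) \<inter> {z. fst z \<in> U})" by blast
  qed
qed

lemma is_chart_cotangent:
  fixes M :: "('m, 'e::finite_dim_inner) atlas"
  assumes M: "differentiable_atlas M" and c: "c \<in> M"
  shows "is_chart (cotangent_chart M c)"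
  unfolding is_chart_def
proof
  have ch: "c \<in> charts_at M x" if "x \<in> fst c" for x using c that by (simp add: charts_at_def)
  have isc: "is_chart c" using M c by (simp add: differentiable_atlas_def)
  show "inj_on (snd (cotangent_chart M c)) (fst (cotangent_chart M c))"
  proof (rule inj_onI)
    fix z w assume "z \<in> fst (cotangent_chart M c)" "w \<in> fst (cotangent_chart M c)"
      and eq: "snd (cotangent_chart M c) z = snd (cotangent_chart M c) w"
    then obtain x g y h where z: "z = (x, covector M c x g)" "x \<in> fst c"
      and w: "w = (y, covector M c y h)" "y \<in> fst c"
      unfolding cotangent_chart_domain_eq [OF M c] by blast
    have "snd c x = snd c y" "g = h"
      using eq unfolding z(1) w(1) cotangent_chart_covector [OF M ch [OF z(2)]]
        cotangent_chart_covector [OF M ch [OF w(2)]] by auto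
    moreover have "x = y" using \<open>snd c x = snd c y\<close> isc z(2) w(2) by (metis chart_inv_coord)
    ultimately show "z = w" using z w by simp
  qed
  show "open (snd (cotangent_chart M c) ` fst (cotangent_chart M c))"
    using image_cotangent_chart [OF M c, of UNIV] isc by (simp add: open_Times is_chart_def)
qed

lemma chart_inv_cotangent:
  fixes M :: "('m, 'e::finite_dim_inner) atlas"
  assumes M: "differentiable_atlas M" and c: "c \<in> M" and q: "q \<in> snd c ` fst c"
  shows "chart_inv (cotangent_chart M c) (q, g) = (chart_inv c q, covector M c (chart_inv c q) g)"
proof -
  let ?x = "chart_inv c q"
  have x: "?x \<in> fst c" "snd c ?x = q" using q by (simp_all add: chart_inv_in coord_chart_inv)
  then have "c \<in> charts_at M ?x" using c by (simp add: charts_at_def)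
  from cotangent_chart_covector [OF M this, of g]
  have eq: "snd (cotangent_chart M c) (?x, covector M c ?x g) = (q, g)" using x by simp
  have "(?x, covector M c ?x g) \<in> fst (cotangent_chart M c)"
    unfolding cotangent_chart_domain_eq [OF M c] using x by blast
  from chart_inv_coord [OF is_chart_cotangent [OF M c] this] show ?thesis unfolding eq .
qed

lemma covector_change_chart:
  assumes M: "differentiable_atlas M" and c: "c \<in> charts_at M x" and d: "d \<in> charts_at M x"
    and "\<And>e. h \<bullet> frechet_derivative (snd d \<circ> chart_inv c) (at (snd c x)) e = g \<bullet> e"
  shows "covector M c x g = covector M d x h"
proof
  fix v
  have "g \<bullet> v c = h \<bullet> v d" if "v \<in> tangent_space M x"
    using assms(4) [of "v c"] unfolding tangent_change_chart [OF that c d] by simp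
  then show "covector M c x g v = covector M d x h v" by (simp add: covector_def)
qed

text \<open>The fibre coordinate transforms by the adjoint of the derivative of the inverse transition,
  written out in an orthogonal spanning set \<open>B\<close> (which may contain 0, where \<open>x / 0 = 0\<close>).\<close>

lemma cotangent_transition:
  fixes M :: "('m, 'e::finite_dim_inner) atlas" and g e :: 'e
  assumes M: "differentiable_atlas M" and c: "c \<in> M" and d: "d \<in> M"
    and q: "q \<in> snd c ` (fst c \<inter> fst d)"
    and B: "finite B" "\<And>x. x = (\<Sum>b\<in>B. (x \<bullet> b / (b \<bullet> b)) *\<^sub>R b)"
  defines "\<tau> \<equiv> snd d \<circ> chart_inv c" and "\<sigma> \<equiv> snd c \<circ> chart_inv d"
  defines "h \<equiv> \<Sum>b\<in>B. ((g \<bullet> frechet_derivative \<sigma> (at (\<tau> q)) b) / (b \<bullet> b)) *\<^sub>R b"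
  shows "(snd (cotangent_chart M d) \<circ> chart_inv (cotangent_chart M c)) (q, g) = (\<tau> q, h)"
    and "h \<bullet> frechet_derivative \<tau> (at q) e = g \<bullet> e"
proof -
  let ?x = "chart_inv c q"
  have isc: "is_chart c" using M c by (simp add: differentiable_atlas_def)
  have q': "q \<in> snd c ` fst c" using q by blast
  have x: "?x \<in> fst c" "?x \<in> fst d" "snd c ?x = q" using q isc by auto
  then have cx: "c \<in> charts_at M ?x" and dx: "d \<in> charts_at M ?x" using c d by (auto simp: charts_at_def)
  have \<tau>q: "\<tau> q = snd d ?x" by (simp add: \<tau>_def)
  have lin: "linear (frechet_derivative \<sigma> (at (\<tau> q)))"
    using has_derivative_linear [OF transition_has_derivative [OF M dx cx]] unfolding \<sigma>_def \<tau>q .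
  have adj: "h \<bullet> f = g \<bullet> frechet_derivative \<sigma> (at (\<tau> q)) f" for f
  proof -
    have "g \<bullet> frechet_derivative \<sigma> (at (\<tau> q)) f =
        g \<bullet> frechet_derivative \<sigma> (at (\<tau> q)) (\<Sum>b\<in>B. (f \<bullet> b / (b \<bullet> b)) *\<^sub>R b)"
      using B(2) [of f] by simp
    also have "\<dots> = (\<Sum>b\<in>B. (f \<bullet> b / (b \<bullet> b)) * (g \<bullet> frechet_derivative \<sigma> (at (\<tau> q)) b))"
      by (simp add: linear_sum [OF lin] linear_cmul [OF lin] inner_sum_right)
    also have "\<dots> = h \<bullet> f"
      unfolding h_def inner_sum_left by (rule sum.cong) (simp_all add: inner_commute)
    finally show ?thesis by simp
  qed
  have hg: "h \<bullet> frechet_derivative \<tau> (at q) e = g \<bullet> e" for e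
  proof -
    have "frechet_derivative \<sigma> (at (\<tau> q)) (frechet_derivative \<tau> (at q) e) = e"
      using transition_derivative_comp [OF M cx dx cx, of e] transition_derivative_refl [OF M cx, of e]
      unfolding \<sigma>_def [symmetric] \<tau>_def [symmetric] \<tau>q [symmetric] x(3) by simp
    then show ?thesis unfolding adj by simp
  qed
  then show "h \<bullet> frechet_derivative \<tau> (at q) e = g \<bullet> e" .
  have "covector M c ?x g = covector M d ?x h"
    using covector_change_chart [OF M cx dx] hg unfolding \<tau>_def x(3) by blast
  then show "(snd (cotangent_chart M d) \<circ> chart_inv (cotangent_chart M c)) (q, g) = (\<tau> q, h)"
    by (simp add: chart_inv_cotangent [OF M c q'] cotangent_chart_covector [OF M dx] \<tau>q)
qed

lemma cotangent_overlap:
  fixes M :: "('m, 'e::finite_dim_inner) atlas"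
  assumes M: "differentiable_atlas M" and c: "c \<in> M"
  shows "snd (cotangent_chart M c) ` (fst (cotangent_chart M c) \<inter> fst (cotangent_chart M d)) =
    snd c ` (fst c \<inter> fst d) \<times> UNIV"
proof -
  have "fst (cotangent_chart M c) \<inter> fst (cotangent_chart M d) =
      fst (cotangent_chart M c) \<inter> {z. fst z \<in> fst d}"
    by (auto simp: fst_cotangent_chart)
  then show ?thesis using image_cotangent_chart [OF M c] by simp
qed

text \<open>The fibre part of a transition contains the derivative of the inverse base transition,
  so its differentiability uses second derivatives on the base.\<close>

lemma differentiable_atlas_cotangent_bundle:
  fixes M :: "('m, 'e::finite_dim_inner) atlas"
  assumes S: "smooth_atlas M"
  shows "differentiable_atlas (cotangent_bundle M)"
proof -
  have M: "differentiable_atlas M" using S by (rule smooth_atlas_imp_differentiable_atlas)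
  obtain B :: "'e set" where B: "finite B" "\<And>x. x = (\<Sum>b\<in>B. (x \<bullet> b / (b \<bullet> b)) *\<^sub>R b)"
    using orthogonal_expansion by blast
  show ?thesis
    unfolding differentiable_atlas_def
  proof (intro conjI ballI)
    fix C assume "C \<in> cotangent_bundle M"
    then obtain c where C: "C = cotangent_chart M c" "c \<in> M" unfolding cotangent_bundle_def by blast
    show "is_chart C" unfolding C(1) by (rule is_chart_cotangent [OF M C(2)])
    fix D assume "D \<in> cotangent_bundle M"
    then obtain d where D: "D = cotangent_chart M d" "d \<in> M" unfolding cotangent_bundle_def by blast
    let ?U = "snd c ` (fst c \<inter> fst d)" and ?V = "snd d ` (fst c \<inter> fst d)"
    let ?\<tau> = "snd d \<circ> chart_inv c" and ?\<sigma> = "snd c \<circ> chart_inv d"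
    have cd: "is_chart c" "compatible c d" using S C(2) D(2) by (auto simp: smooth_atlas_def)
    have U: "open ?U" and V: "open ?V" and sm: "smooth_on ?\<tau> ?U" "smooth_on ?\<sigma> ?V"
      using cd(2) unfolding compatible_def by auto
    show "open (snd C ` (fst C \<inter> fst D))"
      unfolding C(1) D(1) cotangent_overlap [OF M C(2)] using U by (simp add: open_Times)
    fix y assume "y \<in> snd C ` (fst C \<inter> fst D)"
    then have y: "y \<in> ?U \<times> UNIV" unfolding C(1) D(1) cotangent_overlap [OF M C(2)] .
    then have fy: "fst y \<in> ?U" by auto
    have \<tau>V: "?\<tau> (fst y) \<in> ?V" using fy cd(1) by auto
    obtain T where T: "(?\<tau> has_derivative T) (at (fst y))"
      using smooth_on_imp_differentiable [OF sm(1) fy] unfolding differentiable_def by blast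
    have T': "((\<lambda>w. ?\<tau> (fst w)) has_derivative (\<lambda>w. T (fst w))) (at y)"
      by (rule has_derivative_compose [where f = fst, OF _ T])
        (intro bounded_linear_imp_has_derivative bounded_linear_fst)
    \<comment> \<open>The value on \<open>b\<close> of the derivative of the inverse transition, as
      a function of the bundle coordinates. In terms of \<open>k\<close> the fibre part of the
      transition is an explicit finite sum that can be differentiated term by term.\<close>
    define k where "k = (\<lambda>b (w :: 'e \<times> 'e). frechet_derivative ?\<sigma> (at (?\<tau> (fst w))) b)"
    have "\<exists>K. (k b has_derivative K) (at y)" for b
    proof -
      obtain R where R: "((\<lambda>p. frechet_derivative ?\<sigma> (at p) b) has_derivative R) (at (?\<tau> (fst y)))"
        using smooth_on_imp_differentiable [OF smooth_on_derivative [OF sm(2)] \<tau>V]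
        unfolding differentiable_def by blast
      show ?thesis
        unfolding k_def
        using has_derivative_compose [where f = "\<lambda>w. ?\<tau> (fst w)", OF T' R] by blast
    qed
    then obtain K where K: "\<And>b. (k b has_derivative K b) (at y)" by metis
    \<comment> \<open>Division by \<open>b \<bullet> b\<close> is written as multiplication by its
      inverse, a constant factor, so that \<open>b = 0\<close> needs no separate treatment.\<close>
    have "((\<lambda>w. \<Sum>b\<in>B. ((snd w \<bullet> k b w) * inverse (b \<bullet> b)) *\<^sub>R b) has_derivative
        (\<lambda>w. \<Sum>b\<in>B. ((snd y \<bullet> K b w + snd w \<bullet> k b y) * inverse (b \<bullet> b)) *\<^sub>R b)) (at y)"
      by (intro has_derivative_sum has_derivative_scaleR_left has_derivative_mult_left
          has_derivative_inner K bounded_linear_imp_has_derivative bounded_linear_snd)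
    then have "((\<lambda>w. (?\<tau> (fst w), \<Sum>b\<in>B. ((snd w \<bullet> k b w) * inverse (b \<bullet> b)) *\<^sub>R b)) has_derivative
        (\<lambda>w. (T (fst w), \<Sum>b\<in>B. ((snd y \<bullet> K b w + snd w \<bullet> k b y) * inverse (b \<bullet> b)) *\<^sub>R b))) (at y)"
      by (rule has_derivative_Pair [OF T'])
    then have "(snd D \<circ> chart_inv C has_derivative
        (\<lambda>w. (T (fst w), \<Sum>b\<in>B. ((snd y \<bullet> K b w + snd w \<bullet> k b y) * inverse (b \<bullet> b)) *\<^sub>R b))) (at y)"
    proof (rule has_derivative_transform_within_open)
      show "open (?U \<times> (UNIV :: 'e set))" using U by (simp add: open_Times)
      show "y \<in> ?U \<times> UNIV" by (rule y)
      fix w assume "w \<in> ?U \<times> (UNIV :: 'e set)"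
      then have "fst w \<in> ?U" by auto
      from cotangent_transition(1) [OF M C(2) D(2) this B, of "snd w"]
      show "(?\<tau> (fst w), \<Sum>b\<in>B. ((snd w \<bullet> k b w) * inverse (b \<bullet> b)) *\<^sub>R b) = (snd D \<circ> chart_inv C) w"
        unfolding C(1) D(1) k_def by (simp add: divide_inverse)
    qed
    then show "(snd D \<circ> chart_inv C) differentiable at y" by (rule differentiableI)
  qed
qed

lemma tangent_map_cotangent_fst:
  fixes M :: "('m, 'e::finite_dim_inner) atlas"
  assumes S: "smooth_atlas M" and c: "c \<in> charts_at M (fst z)"
    and C: "cotangent_chart M c \<in> charts_at (cotangent_bundle M) z"
    and v: "v \<in> tangent_space (cotangent_bundle M) z"
  shows "tangent_map (cotangent_bundle M) M fst z v = chart_vector M c (fst z) (fst (v (cotangent_chart M c)))"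
proof -
  let ?C = "cotangent_chart M c"
  have M: "differentiable_atlas M" using S by (rule smooth_atlas_imp_differentiable_atlas)
  have N: "differentiable_atlas (cotangent_bundle M)" using S by (rule differentiable_atlas_cotangent_bundle)
  have cM: "c \<in> M" using charts_atD [OF c] by blast
  have sub: "fst ` fst ?C \<subseteq> fst c" by (auto simp: fst_cotangent_chart)
  have "(fst has_derivative fst) (at (snd ?C z))"
    by (intro bounded_linear_imp_has_derivative bounded_linear_fst)
  then have "(snd c \<circ> fst \<circ> chart_inv ?C has_derivative fst) (at (snd ?C z))"
  proof (rule has_derivative_transform_within_open)
    show "open (snd ?C ` fst ?C)" using is_chart_at [OF N C] by (simp add: is_chart_def)
    show "snd ?C z \<in> snd ?C ` fst ?C" using charts_atD [OF C] by blast
    fix w assume "w \<in> snd ?C ` fst ?C"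
    then have "fst w \<in> snd c ` fst c"
      using image_cotangent_chart [OF M cM, of UNIV] by auto
    then show "fst w = (snd c \<circ> fst \<circ> chart_inv ?C) w"
      using chart_inv_cotangent [OF M cM, of "fst w" "snd w"] by (simp add: coord_chart_inv)
  qed
  from tangent_map_eq_chart_vector [OF N M C c sub this v] show ?thesis .
qed

section \<open>The canonical symplectic form\<close>

text \<open>The familiar \<open>p dq\<close>: the fibre coordinate is paired with the base component
  of the vector.\<close>

lemma liouville_form_chart_vector:
  fixes M :: "('m, 'e::finite_dim_inner) atlas"
  assumes S: "smooth_atlas M" and c: "c \<in> charts_at M x"
  shows "liouville_form M (x, covector M c x g)
    (chart_vector (cotangent_bundle M) (cotangent_chart M c) (x, covector M c x g) e) = g \<bullet> fst e"
proof -
  let ?z = "(x, covector M c x g)" and ?C = "cotangent_chart M c"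
  have M: "differentiable_atlas M" using S by (rule smooth_atlas_imp_differentiable_atlas)
  have N: "differentiable_atlas (cotangent_bundle M)" using S by (rule differentiable_atlas_cotangent_bundle)
  have C: "?C \<in> charts_at (cotangent_bundle M) ?z"
    unfolding charts_at_cotangent_bundle_iff using c covector_in_cotangent_space [OF M c] by blast
  have "tangent_map (cotangent_bundle M) M fst ?z (chart_vector (cotangent_bundle M) ?C ?z e) =
      chart_vector M c x (fst e)"
    using tangent_map_cotangent_fst [OF S _ C chart_vector_in_tangent_space [OF N C], of e] c
    by (simp add: chart_vector_at_chart [OF N C])
  then show ?thesis
    by (simp add: liouville_form_def covector_def chart_vector_in_tangent_space [OF M c]
        chart_vector_at_chart [OF M c])
qed

text \<open>The constant form \<open>dp \<and> dq = d(p dq)\<close> on pairs of base and fibre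
  components.\<close>

definition canonical_form :: "'e::real_inner \<times> 'e \<Rightarrow> 'e \<times> 'e \<Rightarrow> real"
  where "canonical_form u v = snd u \<bullet> fst v - snd v \<bullet> fst u"

text \<open>Symplectic forms are evaluated in a chart selected by \<open>SOME\<close>.  Independence of the chart follows
  by differentiating \<open>h(q, g) \<bullet> D\<tau>(q) e = g \<bullet> e\<close>: the terms with second derivatives of \<open>\<tau>\<close>
  cancel by symmetry.\<close>

lemma canonical_form_change_chart:
  fixes M :: "('m, 'e::finite_dim_inner) atlas"
  assumes S: "smooth_atlas M" and c: "c \<in> charts_at M x" and d: "d \<in> charts_at M x"
    and p: "p \<in> cotangent_space M x"
    and u: "u \<in> tangent_space (cotangent_bundle M) (x, p)" and v: "v \<in> tangent_space (cotangent_bundle M) (x, p)"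
  shows "canonical_form (u (cotangent_chart M c)) (v (cotangent_chart M c)) =
    canonical_form (u (cotangent_chart M d)) (v (cotangent_chart M d))"
proof -
  let ?C = "cotangent_chart M c" and ?D = "cotangent_chart M d"
  have M: "differentiable_atlas M" using S by (rule smooth_atlas_imp_differentiable_atlas)
  have N: "differentiable_atlas (cotangent_bundle M)" using S by (rule differentiable_atlas_cotangent_bundle)
  have cM: "c \<in> M" "d \<in> M" "x \<in> fst c" "x \<in> fst d" using charts_atD [OF c] charts_atD [OF d] by auto
  have C: "?C \<in> charts_at (cotangent_bundle M) (x, p)" and D: "?D \<in> charts_at (cotangent_bundle M) (x, p)"
    unfolding charts_at_cotangent_bundle_iff using c d p by blast+
  obtain g where g: "p = covector M c x g" using cotangent_eq_covector [OF M c p] by blast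
  obtain B :: "'e set" where B: "finite B" "\<And>x. x = (\<Sum>b\<in>B. (x \<bullet> b / (b \<bullet> b)) *\<^sub>R b)"
    using orthogonal_expansion by blast
  define y where "y = (snd c x, g)"
  have y: "snd ?C (x, p) = y" unfolding y_def g by (rule cotangent_chart_covector [OF M c])
  define \<tau> where "\<tau> = snd d \<circ> chart_inv c"
  define tr where "tr = snd ?D \<circ> chart_inv ?C"
  define U where "U = snd c ` (fst c \<inter> fst d)"
  define T where "T = frechet_derivative tr (at y)"
  define D\<tau> where "D\<tau> = (\<lambda>e q. frechet_derivative \<tau> (at q) e)"
  define D2 where "D2 = (\<lambda>e. frechet_derivative (D\<tau> e) (at (fst y)))"
  have U: "open U" "fst y \<in> U" using open_chart_overlap [OF M c d] by (auto simp: U_def y_def)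
  have UU: "open (U \<times> (UNIV :: 'e set))" "y \<in> U \<times> UNIV" using U by (auto simp: open_Times mem_Times_iff)
  have sm: "smooth_on \<tau> U"
    using S cM(1,2) unfolding smooth_atlas_def compatible_def \<tau>_def U_def by blast
  have T: "(tr has_derivative T) (at y)"
    using transition_has_derivative [OF N C D] unfolding y T_def tr_def .
  have tr: "fst (tr w) = \<tau> (fst w)" "snd (tr w) \<bullet> D\<tau> e (fst w) = snd w \<bullet> e" if "w \<in> U \<times> UNIV" for w e
  proof -
    have "fst w \<in> snd c ` (fst c \<inter> fst d)" using that by (auto simp: U_def)
    from cotangent_transition [OF M cM(1,2) this B, of "snd w"]
    show "fst (tr w) = \<tau> (fst w)" "snd (tr w) \<bullet> D\<tau> e (fst w) = snd w \<bullet> e"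
      by (simp_all add: tr_def \<tau>_def D\<tau>_def)
  qed
  have \<tau>': "(\<tau> has_derivative (\<lambda>e. D\<tau> e (fst y))) (at (fst y))"
    using smooth_on_imp_differentiable [OF sm U(2)] unfolding D\<tau>_def frechet_derivative_works .
  have fstT: "fst (T w) = D\<tau> (fst w) (fst y)" for w
  proof -
    have "((\<lambda>w. \<tau> (fst w)) has_derivative (\<lambda>w. D\<tau> (fst w) (fst y))) (at y)"
      by (rule has_derivative_compose [where f = fst, OF _ \<tau>'])
        (intro bounded_linear_imp_has_derivative bounded_linear_fst)
    then have "((\<lambda>w. fst (tr w)) has_derivative (\<lambda>w. D\<tau> (fst w) (fst y))) (at y)"
      by (rule has_derivative_transform_within_open [OF _ UU]) (simp add: tr)
    moreover have "((\<lambda>w. fst (tr w)) has_derivative (\<lambda>w. fst (T w))) (at y)"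
      using T by (rule has_derivative_fst)
    ultimately show ?thesis by (rule has_derivative_eq_at [symmetric])
  qed
  \<comment> \<open>Product rule for the invariance of \<open>p dq\<close> recorded in
    \<open>tr\<close>: the first summand differentiates the derivative of the base transition, the
    second one the fibre coordinate.\<close>
  have sndT: "snd w \<bullet> e = snd (tr y) \<bullet> D2 e (fst w) + snd (T w) \<bullet> D\<tau> e (fst y)" for w e
  proof -
    have D2: "(D\<tau> e has_derivative D2 e) (at (fst y))"
      using smooth_on_imp_differentiable [OF smooth_on_derivative [OF sm] U(2)]
      unfolding D2_def D\<tau>_def frechet_derivative_works .
    have "((\<lambda>w. D\<tau> e (fst w)) has_derivative (\<lambda>w. D2 e (fst w))) (at y)"
      by (rule has_derivative_compose [where f = fst, OF _ D2])
        (intro bounded_linear_imp_has_derivative bounded_linear_fst)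
    from has_derivative_inner [OF has_derivative_snd [OF T] this]
    have "((\<lambda>w. snd (tr w) \<bullet> D\<tau> e (fst w)) has_derivative
        (\<lambda>w. snd (tr y) \<bullet> D2 e (fst w) + snd (T w) \<bullet> D\<tau> e (fst y))) (at y)" .
    then have "((\<lambda>w. snd w \<bullet> e) has_derivative
        (\<lambda>w. snd (tr y) \<bullet> D2 e (fst w) + snd (T w) \<bullet> D\<tau> e (fst y))) (at y)"
      by (rule has_derivative_transform_within_open [OF _ UU]) (simp add: tr)
    moreover have "((\<lambda>w. snd w \<bullet> e) has_derivative (\<lambda>w. snd w \<bullet> e)) (at y)"
      by (intro has_derivative_inner_left bounded_linear_imp_has_derivative bounded_linear_snd)
    ultimately show ?thesis by (rule has_derivative_eq_at [symmetric])
  qed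
  have D2_sym: "D2 e f = D2 f e" for e f
    unfolding D2_def D\<tau>_def by (rule symmetric_second_derivative [OF U sm])
  have uv: "u ?D = T (u ?C)" "v ?D = T (v ?C)"
    using tangent_change_chart [OF u C D] tangent_change_chart [OF v C D] unfolding y T_def tr_def by auto
  \<comment> \<open>With \<open>e\<close> the base component of the other vector, the last summand
    of \<open>sndT\<close> is a summand of the form in chart \<open>d\<close>; the difference of the
    two instances leaves only the \<open>D2\<close> terms, which agree by symmetry.\<close>
  show ?thesis
    unfolding canonical_form_def uv fstT
    using sndT [of "u ?C" "fst (v ?C)"] sndT [of "v ?C" "fst (u ?C)"] D2_sym by simp
qed

lemma symplectic_form_chart:
  fixes M :: "('m, 'e::finite_dim_inner) atlas"
  assumes S: "smooth_atlas M" and d: "d \<in> charts_at M x" and p: "p \<in> cotangent_space M x"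
    and u: "u \<in> tangent_space (cotangent_bundle M) (x, p)" and v: "v \<in> tangent_space (cotangent_bundle M) (x, p)"
  shows "symplectic_form M (x, p) u v = canonical_form (u (cotangent_chart M d)) (v (cotangent_chart M d))"
proof -
  have M: "differentiable_atlas M" using S by (rule smooth_atlas_imp_differentiable_atlas)
  define C where "C = (SOME c. c \<in> charts_at (cotangent_bundle M) (x, p))"
  have "\<exists>c. c \<in> charts_at (cotangent_bundle M) (x, p)"
    unfolding charts_at_cotangent_bundle_iff using d p by blast
  then have "C \<in> charts_at (cotangent_bundle M) (x, p)" unfolding C_def by (rule someI_ex)
  then obtain c where C: "C = cotangent_chart M c" and c: "c \<in> charts_at M x"
    unfolding charts_at_cotangent_bundle_iff by blast
  have cM: "c \<in> M" "x \<in> fst c" using charts_atD [OF c] by auto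
  have isC: "is_chart C" unfolding C by (rule is_chart_cotangent [OF M cM(1)])
  \<comment> \<open>For a constant field \<open>e\<close> the coefficient of the Liouville form is
    the linear function \<open>w \<mapsto> snd w \<bullet> fst e\<close> on the image of the chart,
    hence its own derivative.\<close>
  have der: "frechet_derivative (\<lambda>y. liouville_form M (chart_inv C y)
      (chart_vector (cotangent_bundle M) C (chart_inv C y) e)) (at (snd C (x, p))) w = snd w \<bullet> fst e" for e w
  proof -
    have "((\<lambda>w. snd w \<bullet> fst e) has_derivative (\<lambda>w. snd w \<bullet> fst e)) (at (snd C (x, p)))"
      by (intro has_derivative_inner_left bounded_linear_imp_has_derivative bounded_linear_snd)
    then have "((\<lambda>y. liouville_form M (chart_inv C y)
      (chart_vector (cotangent_bundle M) C (chart_inv C y) e)) has_derivative (\<lambda>w. snd w \<bullet> fst e)) (at (snd C (x, p)))"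
    proof (rule has_derivative_transform_within_open)
      show "open (snd C ` fst C)" using isC by (simp add: is_chart_def)
      show "snd C (x, p) \<in> snd C ` fst C" using cM p unfolding C by (auto simp: fst_cotangent_chart)
      fix y assume "y \<in> snd C ` fst C"
      then have q: "fst y \<in> snd c ` fst c"
        using image_cotangent_chart [OF M cM(1), of UNIV] unfolding C by auto
      have "c \<in> charts_at M (chart_inv c (fst y))" using chart_inv_in [OF q] cM(1) by (simp add: charts_at_def)
      from liouville_form_chart_vector [OF S this, of "snd y" e]
      show "snd y \<bullet> fst e = liouville_form M (chart_inv C y)
          (chart_vector (cotangent_bundle M) C (chart_inv C y) e)"
        using chart_inv_cotangent [OF M cM(1) q, of "snd y"] unfolding C by simp
    qed
    from fun_cong [OF frechet_derivative_at [OF this], of w] show ?thesis by simp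
  qed
  have "symplectic_form M (x, p) u v = canonical_form (u C) (v C)"
    unfolding symplectic_form_def ext_deriv_def C_def [symmetric] Let_def der canonical_form_def ..
  then show ?thesis unfolding C canonical_form_change_chart [OF S c d p u v] .
qed

section \<open>Tangent spaces of subsets in a chart\<close>

lemma in_coord_tangent_iff:
  assumes M: "differentiable_atlas M" and c: "c \<in> charts_at M x"
  shows "w \<in> coord_tangent M H c x \<longleftrightarrow>
    (\<exists>\<gamma> \<epsilon>. \<epsilon> > 0 \<and> smooth_curve M \<epsilon> \<gamma> \<and> \<gamma> ` {-\<epsilon><..<\<epsilon>} \<subseteq> H \<and> \<gamma> 0 = x \<and>
      (snd c \<circ> \<gamma> has_vector_derivative w) (at 0))" (is "_ \<longleftrightarrow> ?R")
proof
  assume "w \<in> coord_tangent M H c x"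
  then obtain \<gamma> \<epsilon> where *: "w = vector_derivative (snd c \<circ> \<gamma>) (at 0)" "\<epsilon> > 0" "smooth_curve M \<epsilon> \<gamma>"
    "\<gamma> ` {-\<epsilon><..<\<epsilon>} \<subseteq> H" "\<gamma> 0 = x"
    unfolding coord_tangent_eq [OF assms] by blast
  have "(snd c \<circ> \<gamma> has_vector_derivative w) (at 0)"
    unfolding *(1) by (rule smooth_curve_has_vector_derivative [OF *(3,2)]) (simp add: *(5) c)
  with * show ?R by blast
next
  assume ?R
  then obtain \<gamma> \<epsilon> where *: "\<epsilon> > 0" "smooth_curve M \<epsilon> \<gamma>" "\<gamma> ` {-\<epsilon><..<\<epsilon>} \<subseteq> H" "\<gamma> 0 = x"
      "(snd c \<circ> \<gamma> has_vector_derivative w) (at 0)"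
    by blast
  then show "w \<in> coord_tangent M H c x"
    unfolding coord_tangent_eq [OF assms] using vector_derivative_at [OF *(5)] by blast
qed

text \<open>Gives upper bounds for tangent spaces: along a curve in \<open>H\<close> the function
  \<open>f\<close> vanishes for all small times, so its derivative annihilates the velocity.\<close>

lemma coord_tangent_constraint:
  assumes M: "differentiable_atlas M" and c: "c \<in> charts_at M x" and w: "w \<in> coord_tangent M H c x"
    and D: "(f has_derivative D) (at (snd c x))" and zero: "\<And>z. z \<in> H \<Longrightarrow> z \<in> fst c \<Longrightarrow> f (snd c z) = 0"
  shows "D w = 0"
proof -
  obtain \<gamma> \<epsilon> where *: "\<epsilon> > 0" "smooth_curve M \<epsilon> \<gamma>" "\<gamma> ` {-\<epsilon><..<\<epsilon>} \<subseteq> H" "\<gamma> 0 = x"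
      "(snd c \<circ> \<gamma> has_vector_derivative w) (at 0)"
    using w unfolding in_coord_tangent_iff [OF M c] by blast
  have "((\<lambda>t. f ((snd c \<circ> \<gamma>) t)) has_derivative (\<lambda>t. D (t *\<^sub>R w))) (at 0)"
    by (rule has_derivative_compose [where f = "snd c \<circ> \<gamma>" and g = f])
      (use *(4,5) D in \<open>simp_all add: has_vector_derivative_def\<close>)
  then have "((\<lambda>t. 0) has_derivative (\<lambda>t. D (t *\<^sub>R w))) (at 0)"
  proof (rule has_derivative_transform_within_open)
    show "open {t\<in>{-\<epsilon><..<\<epsilon>}. \<gamma> t \<in> fst c}" using *(2) charts_atD [OF c] unfolding smooth_curve_def by blast
    show "0 \<in> {t\<in>{-\<epsilon><..<\<epsilon>}. \<gamma> t \<in> fst c}" using * charts_atD [OF c] by auto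
    show "f ((snd c \<circ> \<gamma>) t) = 0" if "t \<in> {t\<in>{-\<epsilon><..<\<epsilon>}. \<gamma> t \<in> fst c}" for t
    proof -
      have "\<gamma> t \<in> H" "\<gamma> t \<in> fst c" using *(3) that by blast+
      then show ?thesis using zero by simp
    qed
  qed
  from has_derivative_eq_at [OF this has_derivative_const, of 1] show ?thesis by simp
qed

text \<open>As \<open>F\<close> is linear in charts, it takes smooth curves to smooth curves without
  a general chain rule. The charts have to match on \<open>H\<close> only, so that the lemma covers
  the embedding of the base as zero section and the projection back from it as well as isomorphisms
  of atlases.\<close>

lemma coord_tangent_image:
  assumes M: "differentiable_atlas M" and N: "differentiable_atlas N" and l: "bounded_linear l"
    and sub: "F ` H \<subseteq> points N"
    and corr: "\<And>d. d \<in> N \<Longrightarrow> \<exists>c\<in>M. \<forall>z\<in>H. (F z \<in> fst d \<longleftrightarrow> z \<in> fst c) \<and> (z \<in> fst c \<longrightarrow> snd d (F z) = l (snd c z))"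
    and c: "c \<in> charts_at M x" and d: "d \<in> charts_at N (F x)"
    and cd: "\<And>z. z \<in> H \<Longrightarrow> z \<in> fst c \<Longrightarrow> snd d (F z) = l (snd c z)"
    and w: "w \<in> coord_tangent M H c x"
  shows "l w \<in> coord_tangent N (F ` H) d (F x)"
proof -
  obtain \<gamma> \<epsilon> where *: "\<epsilon> > 0" "smooth_curve M \<epsilon> \<gamma>" "\<gamma> ` {-\<epsilon><..<\<epsilon>} \<subseteq> H" "\<gamma> 0 = x"
      "(snd c \<circ> \<gamma> has_vector_derivative w) (at 0)"
    using w unfolding in_coord_tangent_iff [OF M c] by blast
  have H: "\<gamma> t \<in> H" if "t \<in> {-\<epsilon><..<\<epsilon>}" for t using *(3) that by blast
  have "smooth_curve N \<epsilon> (F \<circ> \<gamma>)"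
    unfolding smooth_curve_def
  proof (intro conjI ballI)
    show "(F \<circ> \<gamma>) ` {-\<epsilon><..<\<epsilon>} \<subseteq> points N" using H sub by auto
    fix d' assume "d' \<in> N"
    then obtain c' where c': "c' \<in> M"
      "\<And>z. z \<in> H \<Longrightarrow> (F z \<in> fst d' \<longleftrightarrow> z \<in> fst c') \<and> (z \<in> fst c' \<longrightarrow> snd d' (F z) = l (snd c' z))"
      using corr by blast
    have eq: "{t\<in>{-\<epsilon><..<\<epsilon>}. (F \<circ> \<gamma>) t \<in> fst d'} = {t\<in>{-\<epsilon><..<\<epsilon>}. \<gamma> t \<in> fst c'}"
      using c'(2) [OF H] by auto
    have o: "open {t\<in>{-\<epsilon><..<\<epsilon>}. \<gamma> t \<in> fst c'}"
      and s: "smooth_on (snd c' \<circ> \<gamma>) {t\<in>{-\<epsilon><..<\<epsilon>}. \<gamma> t \<in> fst c'}"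
      using *(2) c'(1) unfolding smooth_curve_def by blast+
    show "open {t\<in>{-\<epsilon><..<\<epsilon>}. (F \<circ> \<gamma>) t \<in> fst d'}" unfolding eq by (rule o)
    show "smooth_on (snd d' \<circ> (F \<circ> \<gamma>)) {t\<in>{-\<epsilon><..<\<epsilon>}. (F \<circ> \<gamma>) t \<in> fst d'}"
      unfolding eq
      by (rule smooth_on_cong [OF o smooth_on_linear_left [OF o l s]]) (use c'(2) [OF H] in auto)
  qed
  moreover have "(snd d \<circ> (F \<circ> \<gamma>) has_vector_derivative l w) (at 0)"
  proof -
    have "((\<lambda>t. l ((snd c \<circ> \<gamma>) t)) has_vector_derivative l w) (at 0)"
      by (rule bounded_linear.has_vector_derivative [OF l *(5)])
    then show ?thesis
    proof (rule has_vector_derivative_transform_within_open)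
      show "open {t\<in>{-\<epsilon><..<\<epsilon>}. \<gamma> t \<in> fst c}" using *(2) charts_atD [OF c] unfolding smooth_curve_def by blast
      show "0 \<in> {t\<in>{-\<epsilon><..<\<epsilon>}. \<gamma> t \<in> fst c}" using * charts_atD [OF c] by auto
    qed (use cd [OF H] in auto)
  qed
  moreover have "(F \<circ> \<gamma>) ` {-\<epsilon><..<\<epsilon>} \<subseteq> F ` H" using H by auto
  ultimately show ?thesis
    unfolding in_coord_tangent_iff [OF N d] using *(1,4) by (metis comp_apply)
qed

text \<open>Gives lower bounds for tangent spaces: straight lines in the parameter chart
  \<open>b\<close> are mapped by \<open>\<Phi>\<close> to curves with the required
  velocities.\<close>

lemma coord_tangent_parametrized:
  assumes Y: "differentiable_atlas Y" and b: "is_chart b" "x \<in> fst b" and d: "d \<in> charts_at Y (\<Phi> x)"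
    and P: "fst b \<subseteq> P" "\<Phi> ` P \<subseteq> points Y"
    and smooth: "\<And>d. d \<in> Y \<Longrightarrow> open (snd b ` (fst b \<inter> \<Phi> -` fst d)) \<and>
      smooth_on (snd d \<circ> \<Phi> \<circ> chart_inv b) (snd b ` (fst b \<inter> \<Phi> -` fst d))"
    and D: "(snd d \<circ> \<Phi> \<circ> chart_inv b has_derivative D) (at (snd b x))"
  shows "D w \<in> coord_tangent Y (\<Phi> ` P) d (\<Phi> x)"
proof -
  let ?q = "snd b x" and ?\<beta> = "\<lambda>t::real. chart_inv b (snd b x + t *\<^sub>R w)"
  have bl: "bounded_linear (\<lambda>t::real. t *\<^sub>R w)" by (rule bounded_linear_scaleR_left)
  have "open (snd b ` fst b)" "?q \<in> snd b ` fst b" using b by (auto simp: is_chart_def)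
  then have "open {t::real. ?q + t *\<^sub>R w \<in> snd b ` fst b}" "0 \<in> {t::real. ?q + t *\<^sub>R w \<in> snd b ` fst b}"
    using open_affine_vimage [OF _ bl] by auto
  \<comment> \<open>The interval is so short that the straight line stays in the open image of
    \<open>b\<close>, where \<open>chart_inv\<close> is a true inverse.\<close>
  then obtain \<epsilon> where e: "\<epsilon> > 0" "\<And>t. dist t 0 < \<epsilon> \<Longrightarrow> ?q + t *\<^sub>R w \<in> snd b ` fst b"
    unfolding open_dist by blast
  have I: "?q + t *\<^sub>R w \<in> snd b ` fst b" if "t \<in> {-\<epsilon><..<\<epsilon>}" for t
    using e(2) [of t] that by (auto simp: dist_real_def)
  have in_iff: "?q + t *\<^sub>R w \<in> snd b ` (fst b \<inter> V) \<longleftrightarrow> ?\<beta> t \<in> V" if "t \<in> {-\<epsilon><..<\<epsilon>}" for t V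
    using I [OF that] b(1) by (auto simp: image_iff) (metis chart_inv_coord)+
  have \<beta>: "?\<beta> t \<in> P" if "t \<in> {-\<epsilon><..<\<epsilon>}" for t
    using chart_inv_in [OF I [OF that]] P(1) by blast
  then have im: "(\<Phi> \<circ> ?\<beta>) ` {-\<epsilon><..<\<epsilon>} \<subseteq> \<Phi> ` P" by auto
  have "smooth_curve Y \<epsilon> (\<Phi> \<circ> ?\<beta>)"
    unfolding smooth_curve_def
  proof (intro conjI ballI)
    show "(\<Phi> \<circ> ?\<beta>) ` {-\<epsilon><..<\<epsilon>} \<subseteq> points Y" using im P(2) by (rule order_trans)
    fix d' assume d': "d' \<in> Y"
    let ?V = "snd b ` (fst b \<inter> \<Phi> -` fst d')"
    have eq: "{t\<in>{-\<epsilon><..<\<epsilon>}. (\<Phi> \<circ> ?\<beta>) t \<in> fst d'} = {-\<epsilon><..<\<epsilon>} \<inter> {t. ?q + t *\<^sub>R w \<in> ?V}"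
      using in_iff [of _ "\<Phi> -` fst d'"] b(1) by auto
    have o: "open {t. ?q + t *\<^sub>R w \<in> ?V}" using open_affine_vimage [OF _ bl] smooth [OF d'] by blast
    then show "open {t\<in>{-\<epsilon><..<\<epsilon>}. (\<Phi> \<circ> ?\<beta>) t \<in> fst d'}" unfolding eq by auto
    have "smooth_on (\<lambda>t. (snd d' \<circ> \<Phi> \<circ> chart_inv b) (?q + t *\<^sub>R w)) {t. ?q + t *\<^sub>R w \<in> ?V}"
      using smooth_on_affine_right [OF _ bl] smooth [OF d'] by blast
    then have "smooth_on (snd d' \<circ> (\<Phi> \<circ> ?\<beta>)) {t. ?q + t *\<^sub>R w \<in> ?V}" by (simp only: comp_def)
    then show "smooth_on (snd d' \<circ> (\<Phi> \<circ> ?\<beta>)) {t\<in>{-\<epsilon><..<\<epsilon>}. (\<Phi> \<circ> ?\<beta>) t \<in> fst d'}"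
      unfolding eq by (rule smooth_on_subset) blast
  qed
  moreover note im
  moreover have "(\<Phi> \<circ> ?\<beta>) 0 = \<Phi> x" using b by simp
  moreover have "(snd d \<circ> (\<Phi> \<circ> ?\<beta>) has_vector_derivative D w) (at 0)"
  proof -
    have "((\<lambda>t. ?q + t *\<^sub>R w) has_derivative (\<lambda>t. t *\<^sub>R w)) (at 0)"
      by (auto intro!: derivative_eq_intros)
    then have "((\<lambda>t. (snd d \<circ> \<Phi> \<circ> chart_inv b) (?q + t *\<^sub>R w)) has_derivative (\<lambda>t. D (t *\<^sub>R w))) (at 0)"
      by (rule has_derivative_compose) (use D in \<open>simp add: comp_def\<close>)
    then show ?thesis
      unfolding has_vector_derivative_def comp_def
      using linear_cmul [OF has_derivative_linear [OF D]] by simp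
  qed
  ultimately show ?thesis unfolding in_coord_tangent_iff [OF Y d] using e(1) by blast
qed

section \<open>Tangent spaces of the whole manifold, of zero sections and of graphs\<close>

lemma coord_tangent_points:
  assumes S: "smooth_atlas M" and c: "c \<in> charts_at M x"
  shows "coord_tangent M (points M) c x = UNIV"
proof -
  have M: "differentiable_atlas M" using S by (rule smooth_atlas_imp_differentiable_atlas)
  have cM: "c \<in> M" "x \<in> fst c" using charts_atD [OF c] by auto
  have "e \<in> coord_tangent M (id ` points M) c (id x)" for e
  proof (rule coord_tangent_parametrized [OF M is_chart_at [OF M c] cM(2), where D = "\<lambda>e. e"])
    show "fst c \<subseteq> points M" using cM by (auto simp: points_def)
    show "(snd c \<circ> id \<circ> chart_inv c has_derivative (\<lambda>e. e)) (at (snd c x))"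
      using transition_has_derivative [OF M c c]
      unfolding ext [of "frechet_derivative (snd c \<circ> chart_inv c) (at (snd c x))" "\<lambda>e. e",
          OF transition_derivative_refl [OF M c]]
      by simp
    show "open (snd c ` (fst c \<inter> id -` fst d)) \<and>
        smooth_on (snd d \<circ> id \<circ> chart_inv c) (snd c ` (fst c \<inter> id -` fst d))" if "d \<in> M" for d
      using S cM(1) that unfolding smooth_atlas_def compatible_def by simp
  qed (use c in simp_all)
  then show ?thesis by auto
qed

text \<open>Curves in the base lift to the zero section with vanishing fibre coordinate. Conversely
  the fibre coordinate vanishes on the zero section, hence also on velocities there, and the
  projection brings curves back to \<open>C\<close>. Used for \<open>C\<close> the whole base and
  for \<open>C\<close> the graph.\<close>

lemma coord_tangent_zero_covector:
  fixes M :: "('m, 'e::finite_dim_inner) atlas"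
  assumes S: "smooth_atlas M" and c: "c \<in> charts_at M x" and C: "C \<subseteq> points M"
  shows "coord_tangent (cotangent_bundle M) (zero_covector ` C) (cotangent_chart M c) (zero_covector x) =
    (\<lambda>e. (e, 0)) ` coord_tangent M C c x"
proof -
  let ?N = "cotangent_bundle M" and ?Z = "zero_covector :: 'm \<Rightarrow> ('m, 'e) cotangent"
  have M: "differentiable_atlas M" using S by (rule smooth_atlas_imp_differentiable_atlas)
  have N: "differentiable_atlas ?N" using S by (rule differentiable_atlas_cotangent_bundle)
  have zero_in: "(\<lambda>_. 0) \<in> cotangent_space M z" for z by (simp add: cotangent_space_def)
  have dom: "?Z z \<in> fst (cotangent_chart M d) \<longleftrightarrow> z \<in> fst d" for z d
    by (simp add: zero_covector_def fst_cotangent_chart zero_in)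
  have coord: "snd (cotangent_chart M d) (?Z z) = (snd d z, 0)" if "d \<in> M" "z \<in> fst d" for z d
  proof -
    have "d \<in> charts_at M z" using that by (simp add: charts_at_def)
    moreover have "covector M d z 0 = (\<lambda>_. 0)" by (auto simp: covector_def fun_eq_iff)
    ultimately show ?thesis using cotangent_chart_covector [OF M, of d z 0] by (simp add: zero_covector_def)
  qed
  have cM: "c \<in> M" "x \<in> fst c" using charts_atD [OF c] by auto
  have K: "cotangent_chart M c \<in> charts_at ?N (?Z x)"
    unfolding zero_covector_def charts_at_cotangent_bundle_iff using c zero_in by blast
  have "(e, 0) \<in> coord_tangent ?N (?Z ` C) (cotangent_chart M c) (?Z x)" if "e \<in> coord_tangent M C c x" for e
  proof (rule coord_tangent_image [where F = ?Z and x = x and l = "\<lambda>e. (e, 0)", OF M N _ _ _ c K _ that])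
    show "bounded_linear (\<lambda>e::'e. (e, 0::'e))" by (intro bounded_linear_Pair bounded_linear_ident bounded_linear_zero)
    show "?Z ` C \<subseteq> points ?N" using C by (auto simp: points_cotangent_bundle zero_covector_def zero_in)
    show "\<exists>c\<in>M. \<forall>z\<in>C. (?Z z \<in> fst d \<longleftrightarrow> z \<in> fst c) \<and> (z \<in> fst c \<longrightarrow> snd d (?Z z) = (snd c z, 0))"
      if "d \<in> ?N" for d
      using that dom coord unfolding cotangent_bundle_def by blast
  qed (simp add: coord cM)
  moreover have "w \<in> (\<lambda>e. (e, 0)) ` coord_tangent M C c x"
    if w: "w \<in> coord_tangent ?N (?Z ` C) (cotangent_chart M c) (?Z x)" for w
  proof -
    have "(snd has_derivative snd) (at (snd (cotangent_chart M c) (?Z x)))"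
      by (intro bounded_linear_imp_has_derivative bounded_linear_snd)
    then have "snd w = 0"
      by (rule coord_tangent_constraint [OF N K w]) (use dom [of _ c] coord [OF cM(1)] in auto)
    moreover have fstZ: "fst ` ?Z ` C = C" by (force simp: zero_covector_def image_iff)
    have "fst w \<in> coord_tangent M (fst ` ?Z ` C) c (fst (?Z x))"
    proof (rule coord_tangent_image [where F = fst and x = "?Z x", OF N M bounded_linear_fst _ _ K _ _ w])
      show "fst ` ?Z ` C \<subseteq> points M" unfolding fstZ by (rule C)
      show "\<exists>c\<in>?N. \<forall>z\<in>?Z ` C. (fst z \<in> fst d \<longleftrightarrow> z \<in> fst c) \<and> (z \<in> fst c \<longrightarrow> snd d (fst z) = fst (snd c z))"
        if "d \<in> M" for d
      proof (rule bexI)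
        show "cotangent_chart M d \<in> ?N" using that by (simp add: cotangent_bundle_def)
        show "\<forall>z\<in>?Z ` C. (fst z \<in> fst d \<longleftrightarrow> z \<in> fst (cotangent_chart M d)) \<and>
            (z \<in> fst (cotangent_chart M d) \<longrightarrow> snd d (fst z) = fst (snd (cotangent_chart M d) z))"
          using dom [of _ d] coord [OF that] by (auto simp: zero_covector_def)
      qed
      show "c \<in> charts_at M (fst (?Z x))" using c by (simp add: zero_covector_def)
      show "snd c (fst z) = fst (snd (cotangent_chart M c) z)" if "z \<in> ?Z ` C" "z \<in> fst (cotangent_chart M c)" for z
        using that dom [of _ c] coord [OF cM(1)] by (auto simp: zero_covector_def)
    qed
    then have "fst w \<in> coord_tangent M C c x" unfolding fstZ by (simp add: zero_covector_def)
    ultimately show ?thesis by (metis imageI prod.collapse)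
  qed
  ultimately show ?thesis by blast
qed

text \<open>Smoothness is demanded in \<open>smooth_map\<close> on a set whose openness comes from
  the continuity of \<open>F\<close>.\<close>

lemma smooth_map_chart:
  assumes M: "differentiable_atlas M" and N: "differentiable_atlas N" and F: "smooth_map M N F"
    and c: "c \<in> M" and d: "d \<in> N"
  shows "open (snd c ` (fst c \<inter> F -` fst d))"
    and "smooth_on (snd d \<circ> F \<circ> chart_inv c) (snd c ` (fst c \<inter> F -` fst d))"
proof -
  have "openin (manifold_topology M) {z \<in> topspace (manifold_topology M). F z \<in> fst d}"
    using F openin_chart_domain [OF N d] unfolding smooth_map_def
    by (intro openin_continuous_map_preimage) auto
  then have "open (snd c ` ({z \<in> points M. F z \<in> fst d} \<inter> fst c))"
    using c unfolding openin_manifold_topology [OF M] topspace_manifold_topology [OF M] by blast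
  moreover have "{z \<in> points M. F z \<in> fst d} \<inter> fst c = fst c \<inter> F -` fst d"
    using c by (auto simp: points_def)
  ultimately show "open (snd c ` (fst c \<inter> F -` fst d))" by simp
  show "smooth_on (snd d \<circ> F \<circ> chart_inv c) (snd c ` (fst c \<inter> F -` fst d))"
    using F c d unfolding smooth_map_def by blast
qed

text \<open>Here \<open>D\<close> is the derivative of \<open>\<phi>\<close> in charts. One
  inclusion comes from the equation of the graph, \<open>y - \<phi> x = 0\<close> in coordinates,
  the other from the parametrization \<open>x \<mapsto> (\<phi> x, x)\<close>.\<close>

lemma coord_tangent_gr:
  assumes SA: "smooth_atlas A" and SB: "smooth_atlas B" and \<phi>: "smooth_map B A \<phi>"
    and a: "a \<in> charts_at A (\<phi> x)" and b: "b \<in> charts_at B x"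
  shows "\<exists>D. linear D \<and> coord_tangent (prod_atlas A B) (gr B \<phi>) (prod_chart a b) (\<phi> x, x) = range (\<lambda>w. (D w, w))"
proof -
  have A: "differentiable_atlas A" and B: "differentiable_atlas B"
    using SA SB smooth_atlas_imp_differentiable_atlas by blast+
  have AB: "differentiable_atlas (prod_atlas A B)" by (rule differentiable_atlas_prod [OF A B])
  have aA: "a \<in> A" "\<phi> x \<in> fst a" and bB: "b \<in> B" "x \<in> fst b" using charts_atD [OF a] charts_atD [OF b] by auto
  have isb: "is_chart b" by (rule is_chart_at [OF B b])
  have K: "prod_chart a b \<in> charts_at (prod_atlas A B) (\<phi> x, x)"
    unfolding charts_at_prod_iff using a b by blast
  let ?f = "snd a \<circ> \<phi> \<circ> chart_inv b"
  note sm = smooth_map_chart [OF B A \<phi>]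
  have "snd b x \<in> snd b ` (fst b \<inter> \<phi> -` fst a)" using aA bB by blast
  from smooth_on_imp_differentiable [OF sm(2) [OF bB(1) aA(1)] this]
  obtain D where D: "(?f has_derivative D) (at (snd b x))" unfolding differentiable_def by blast
  have "w \<in> range (\<lambda>w. (D w, w))"
    if w: "w \<in> coord_tangent (prod_atlas A B) (gr B \<phi>) (prod_chart a b) (\<phi> x, x)" for w
  proof -
    have "((\<lambda>w. ?f (snd w)) has_derivative (\<lambda>w. D (snd w))) (at (snd (prod_chart a b) (\<phi> x, x)))"
      by (rule has_derivative_compose [where f = snd and g = ?f])
        (auto intro: bounded_linear_imp_has_derivative bounded_linear_snd D)
    then have "((\<lambda>w. fst w - ?f (snd w)) has_derivative (\<lambda>w. fst w - D (snd w)))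
        (at (snd (prod_chart a b) (\<phi> x, x)))"
      by (intro has_derivative_diff bounded_linear_imp_has_derivative bounded_linear_fst)
    from coord_tangent_constraint [OF AB K w this]
    have "fst w - D (snd w) = 0" using isb by (auto simp: gr_def)
    then show ?thesis by (intro range_eqI [of _ _ "snd w"]) (simp add: prod_eq_iff)
  qed
  moreover have "(D w, w) \<in> coord_tangent (prod_atlas A B) (gr B \<phi>) (prod_chart a b) (\<phi> x, x)" for w
  proof -
    let ?\<Phi> = "\<lambda>x. (\<phi> x, x)"
    have "(D w, w) \<in> coord_tangent (prod_atlas A B) (?\<Phi> ` points B) (prod_chart a b) (?\<Phi> x)"
    proof (rule coord_tangent_parametrized [where \<Phi> = ?\<Phi> and D = "\<lambda>w. (D w, w)", OF AB isb bB(2) K])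
      show "fst b \<subseteq> points B" using bB by (auto simp: points_def)
      show "?\<Phi> ` points B \<subseteq> points (prod_atlas A B)"
        using \<phi> unfolding points_prod smooth_map_def by auto
      show "(snd (prod_chart a b) \<circ> ?\<Phi> \<circ> chart_inv b has_derivative (\<lambda>w. (D w, w))) (at (snd b x))"
      proof (rule has_derivative_transform_within_open [OF has_derivative_Pair [OF D has_derivative_ident]])
        show "open (snd b ` fst b)" "snd b x \<in> snd b ` fst b" using isb bB by (auto simp: is_chart_def)
      qed (simp add: coord_chart_inv)
      fix K' assume "K' \<in> prod_atlas A B"
      then obtain a' b' where K': "K' = prod_chart a' b'" "a' \<in> A" "b' \<in> B" unfolding prod_atlas_eq by blast
      let ?U = "snd b ` (fst b \<inter> \<phi> -` fst a')" and ?V = "snd b ` (fst b \<inter> fst b')"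
      have eq: "snd b ` (fst b \<inter> ?\<Phi> -` fst K') = ?U \<inter> ?V"
        using isb unfolding K'(1) is_chart_def by (auto simp: inj_on_def image_iff)
      have UV: "open ?U" "open ?V" "smooth_on (snd a' \<circ> \<phi> \<circ> chart_inv b) ?U"
          "smooth_on (snd b' \<circ> chart_inv b) ?V"
        using sm [OF bB(1) K'(2)] SB bB(1) K'(3) unfolding smooth_atlas_def compatible_def by blast+
      have o: "open (?U \<inter> ?V)" using UV(1,2) by (rule open_Int)
      moreover have "smooth_on (\<lambda>y. ((snd a' \<circ> \<phi> \<circ> chart_inv b) y, (snd b' \<circ> chart_inv b) y)) (?U \<inter> ?V)"
        by (rule smooth_on_Pair [OF o smooth_on_subset [OF UV(3)] smooth_on_subset [OF UV(4)]]) auto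
      moreover have "(\<lambda>y. ((snd a' \<circ> \<phi> \<circ> chart_inv b) y, (snd b' \<circ> chart_inv b) y)) =
          snd K' \<circ> ?\<Phi> \<circ> chart_inv b"
        unfolding K'(1) by auto
      ultimately show "open (snd b ` (fst b \<inter> ?\<Phi> -` fst K')) \<and>
          smooth_on (snd K' \<circ> ?\<Phi> \<circ> chart_inv b) (snd b ` (fst b \<inter> ?\<Phi> -` fst K'))"
        unfolding eq by simp
    qed
    moreover have "?\<Phi> ` points B = gr B \<phi>" by (auto simp: gr_def)
    ultimately show ?thesis by simp
  qed
  ultimately have "coord_tangent (prod_atlas A B) (gr B \<phi>) (prod_chart a b) (\<phi> x, x) = range (\<lambda>w. (D w, w))"
    by blast
  with has_derivative_linear [OF D] show ?thesis by blast
qed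

section \<open>Isomorphisms of atlases\<close>

lemma embedded_submanifold_subset: "embedded_submanifold M H \<Longrightarrow> H \<subseteq> points M"
  unfolding embedded_submanifold_def by (rule conjunct1)

lemma germ_subset:
  assumes "H' \<in> germ M H B"
  shows "H' \<subseteq> points M"
proof -
  have "microfold_in M H' B" using assms unfolding germ_def by blast
  then show ?thesis unfolding microfold_in_def by (elim conjE) (rule embedded_submanifold_subset)
qed

text \<open>Tangent vectors are indexed by charts, so a diffeomorphism is transported together with a
  matching of the charts, in which it is given by one fixed linear map \<open>L\<close>.  The matching is
  by an index set, as several indices may yield the same chart with empty domain.\<close>

locale atlas_iso =
  fixes I :: "'i set"
    and m :: "'i \<Rightarrow> ('m, 'e::real_normed_vector) chart"
    and n :: "'i \<Rightarrow> ('n, 'f::real_normed_vector) chart"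
    and \<Psi> :: "'m \<Rightarrow> 'n" and L :: "'e \<Rightarrow> 'f" and L' :: "'f \<Rightarrow> 'e"
  assumes diff_m: "differentiable_atlas (m ` I)" and diff_n: "differentiable_atlas (n ` I)"
    and bounded_linear_L: "bounded_linear L" and bounded_linear_L': "bounded_linear L'"
    and L'_L: "\<And>x. L' (L x) = x" and L_L': "\<And>y. L (L' y) = y"
    and inj: "inj_on \<Psi> (points (m ` I))"
    and dom: "\<And>i. i \<in> I \<Longrightarrow> fst (n i) = \<Psi> ` fst (m i)"
    and coord: "\<And>i z. i \<in> I \<Longrightarrow> z \<in> fst (m i) \<Longrightarrow> snd (n i) (\<Psi> z) = L (snd (m i) z)"
begin

abbreviation "M \<equiv> m ` I"
abbreviation "N \<equiv> n ` I"

lemma points_image: "points N = \<Psi> ` points M"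
  unfolding points_def using dom by auto

lemma domain_subset: "i \<in> I \<Longrightarrow> fst (m i) \<subseteq> points M"
  by (auto simp: points_def)

lemma \<Psi>_mem_iff: "A \<subseteq> points M \<Longrightarrow> z \<in> points M \<Longrightarrow> \<Psi> z \<in> \<Psi> ` A \<longleftrightarrow> z \<in> A"
  using inj by (rule inj_on_image_mem_iff)

lemma \<Psi>_Int: "A \<subseteq> points M \<Longrightarrow> B \<subseteq> points M \<Longrightarrow> \<Psi> ` (A \<inter> B) = \<Psi> ` A \<inter> \<Psi> ` B"
  using inj by (rule inj_on_image_Int)

lemma L_image: "L ` S = L' -` S"
  using L_L' L'_L by (auto simp: image_iff) metis

lemma open_L_image: "open S \<Longrightarrow> open (L ` S)"
  unfolding L_image by (intro continuous_open_vimage linear_continuous_at bounded_linear_L')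

text \<open>The assumptions are symmetric in the two atlases, so every implication proved for
  \<open>\<Psi>\<close> also holds for its inverse and becomes an equivalence.\<close>

lemma swap: "atlas_iso I n m (inv_into (points M) \<Psi>) L' L"
proof (rule atlas_iso.intro)
  have inv: "inv_into (points M) \<Psi> (\<Psi> z) = z" if "z \<in> points M" for z
    using inj that by simp
  show "inj_on (inv_into (points M) \<Psi>) (points N)"
    unfolding points_image by (rule inj_on_inv_into) simp
  fix i assume i: "i \<in> I"
  show "fst (m i) = inv_into (points M) \<Psi> ` fst (n i)"
    unfolding dom [OF i] using inv_into_image_cancel [OF inj domain_subset [OF i]] by simp
  fix z assume "z \<in> fst (n i)"
  then obtain y where y: "z = \<Psi> y" "y \<in> fst (m i)" using dom [OF i] by blast
  then show "snd (m i) (inv_into (points M) \<Psi> z) = L' (snd (n i) z)"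
    using inv domain_subset [OF i] coord [OF i] L'_L by auto
qed (rule diff_m diff_n bounded_linear_L bounded_linear_L' L'_L L_L')+

lemma openin_image:
  assumes "openin (manifold_topology M) W"
  shows "openin (manifold_topology N) (\<Psi> ` W)"
proof -
  have W: "W \<subseteq> points M" "\<And>i. i \<in> I \<Longrightarrow> open (snd (m i) ` (W \<inter> fst (m i)))"
    using assms unfolding openin_manifold_topology [OF diff_m] by auto
  have "open (snd (n i) ` (\<Psi> ` W \<inter> fst (n i)))" if i: "i \<in> I" for i
  proof -
    have "snd (n i) ` (\<Psi> ` W \<inter> fst (n i)) = L ` snd (m i) ` (W \<inter> fst (m i))"
      unfolding dom [OF i] \<Psi>_Int [OF W(1) domain_subset [OF i], symmetric] image_image
      by (rule image_cong) (simp_all add: coord [OF i])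
    then show ?thesis using open_L_image [OF W(2) [OF i]] by simp
  qed
  then show ?thesis
    using W(1) unfolding openin_manifold_topology [OF diff_n] points_image by auto
qed

lemma smooth_transition_image:
  assumes c: "is_chart c" "is_chart c'" "fst c \<subseteq> points M" "fst d \<subseteq> points M"
    and "fst c' = \<Psi> ` fst c" "\<And>z. z \<in> fst c \<Longrightarrow> snd c' (\<Psi> z) = L (snd c z)"
    and "fst d' = \<Psi> ` fst d" "\<And>z. z \<in> fst d \<Longrightarrow> snd d' (\<Psi> z) = L (snd d z)"
    and U: "open (snd c ` (fst c \<inter> fst d))"
    and s: "smooth_on (snd d \<circ> chart_inv c) (snd c ` (fst c \<inter> fst d))"
  shows "open (snd c' ` (fst c' \<inter> fst d')) \<and> smooth_on (snd d' \<circ> chart_inv c') (snd c' ` (fst c' \<inter> fst d'))"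
proof -
  let ?U = "snd c ` (fst c \<inter> fst d)"
  have im: "snd c' ` (fst c' \<inter> fst d') = L ` ?U"
    unfolding assms(5,7) \<Psi>_Int [OF c(3,4), symmetric] image_image
    by (rule image_cong) (simp_all add: assms(6))
  have o: "open (L ` ?U)" by (rule open_L_image [OF U])
  have "smooth_on (\<lambda>y. L ((snd d \<circ> chart_inv c) (L' y))) (L ` ?U)"
    by (rule smooth_on_linear_left [OF o bounded_linear_L])
      (use smooth_on_linear_right [OF U bounded_linear_L' s] in \<open>simp add: L_image\<close>)
  then have "smooth_on (snd d' \<circ> chart_inv c') (L ` ?U)"
  proof (rule smooth_on_cong [OF o])
    fix y assume "y \<in> L ` ?U"
    then obtain z where z: "z \<in> fst c" "z \<in> fst d" "y = L (snd c z)" by auto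
    then have "\<Psi> z \<in> fst c'" "y = snd c' (\<Psi> z)" using assms(5,6) by auto
    then have "chart_inv c' y = \<Psi> z" using c(2) by simp
    then show "L ((snd d \<circ> chart_inv c) (L' y)) = (snd d' \<circ> chart_inv c') y"
      using z assms(8) c(1) L'_L by simp
  qed
  with o show ?thesis unfolding im by blast
qed

lemma embedded_submanifold_image:
  assumes "embedded_submanifold M H"
  shows "embedded_submanifold N (\<Psi> ` H)"
proof -
  have H: "H \<subseteq> points M" using assms unfolding embedded_submanifold_def by (rule conjunct1)
  obtain k where k: "\<forall>x\<in>H. \<exists>c S. x \<in> fst c \<and> fst c \<subseteq> points M \<and> is_chart c \<and>
      (\<forall>d\<in>M. compatible c d) \<and> subspace S \<and> dim S = k \<and> snd c ` (fst c \<inter> H) = snd c ` fst c \<inter> S"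
    using conjunct2 [OF assms [unfolded embedded_submanifold_def]] by (rule exE)
  have lin: "linear L" using bounded_linear_L by (rule bounded_linear.linear)
  have injL: "inj L" using L'_L by (metis injI)
  have "\<exists>c S. y \<in> fst c \<and> fst c \<subseteq> points N \<and> is_chart c \<and>
      (\<forall>d\<in>N. compatible c d) \<and> subspace S \<and> dim S = k \<and> snd c ` (fst c \<inter> \<Psi> ` H) = snd c ` fst c \<inter> S"
    if y: "y \<in> \<Psi> ` H" for y
  proof -
    obtain x where x: "x \<in> H" "y = \<Psi> x" using y by blast
    obtain c S where c: "x \<in> fst c" "fst c \<subseteq> points M" "is_chart c" "\<forall>d\<in>M. compatible c d"
      "subspace S" "dim S = k" "snd c ` (fst c \<inter> H) = snd c ` fst c \<inter> S"
      using bspec [OF k x(1)] by (elim exE conjE) (rule that)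
    define c' where "c' = (\<Psi> ` fst c, \<lambda>w. L (snd c (inv_into (points M) \<Psi> w)))"
    have fst_c': "fst c' = \<Psi> ` fst c" by (simp add: c'_def)
    have snd_c': "snd c' (\<Psi> z) = L (snd c z)" if "z \<in> fst c" for z
      using that c(2) inj by (auto simp: c'_def)
    have im_c': "snd c' ` \<Psi> ` A = L ` snd c ` A" if "A \<subseteq> fst c" for A
      unfolding image_image by (rule image_cong) (use that snd_c' in auto)
    have isc': "is_chart c'"
      unfolding is_chart_def
    proof
      show "inj_on (snd c') (fst c')"
      proof (rule inj_onI)
        fix u v assume "u \<in> fst c'" "v \<in> fst c'" and eq: "snd c' u = snd c' v"
        then obtain z w where "u = \<Psi> z" "v = \<Psi> w" "z \<in> fst c" "w \<in> fst c" unfolding fst_c' by blast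
        then show "u = v" using eq snd_c' injL c(3) unfolding is_chart_def by (metis injD inj_onD)
      qed
      show "open (snd c' ` fst c')"
        unfolding fst_c' im_c' [OF subset_refl] using c(3) open_L_image by (simp add: is_chart_def)
    qed
    have "compatible c' (n i)" if i: "i \<in> I" for i
    proof -
      have mi: "is_chart (m i)" "is_chart (n i)" using diff_m diff_n i by (auto simp: differentiable_atlas_def)
      have comp: "compatible c (m i)" using c(4) i by blast
      have "open (snd c' ` (fst c' \<inter> fst (n i))) \<and> smooth_on (snd (n i) \<circ> chart_inv c') (snd c' ` (fst c' \<inter> fst (n i)))"
        using comp unfolding compatible_def
        by (intro smooth_transition_image [OF c(3) isc' c(2) domain_subset [OF i] fst_c' snd_c' dom [OF i] coord [OF i]]) auto
      moreover have "open (snd (n i) ` (fst (n i) \<inter> fst c')) \<and> smooth_on (snd c' \<circ> chart_inv (n i)) (snd (n i) ` (fst (n i) \<inter> fst c'))"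
        using comp unfolding compatible_def
        by (intro smooth_transition_image [OF mi domain_subset [OF i] c(2) dom [OF i] coord [OF i] fst_c' snd_c'])
          (auto simp: Int_commute)
      ultimately show ?thesis unfolding compatible_def by (simp add: Int_commute)
    qed
    then have "\<forall>d\<in>N. compatible c' d" by blast
    moreover have "subspace (L ` S)" "dim (L ` S) = k"
      using linear_subspace_image [OF lin c(5)] dim_image_linear_inj [OF lin injL] c(6) by auto
    moreover have "snd c' ` (fst c' \<inter> \<Psi> ` H) = snd c' ` fst c' \<inter> L ` S"
      unfolding fst_c' \<Psi>_Int [OF c(2) H, symmetric] im_c' [OF Int_lower1] im_c' [OF subset_refl] c(7)
      by (rule image_Int [OF injL])
    moreover have "y \<in> fst c'" "fst c' \<subseteq> points N"
      unfolding fst_c' points_image using c(1,2) x(2) by auto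
    ultimately show ?thesis using isc' by (intro exI [of _ c'] exI [of _ "L ` S"] conjI)
  qed
  moreover have "\<Psi> ` H \<subseteq> points N" unfolding points_image using H by (rule image_mono)
  ultimately show ?thesis
    unfolding embedded_submanifold_def by (intro conjI exI [of _ k] ballI)
qed

lemma closedin_image:
  assumes H: "H \<subseteq> points M" and B: "closedin (subtopology (manifold_topology M) H) B"
  shows "closedin (subtopology (manifold_topology N) (\<Psi> ` H)) (\<Psi> ` B)"
proof -
  obtain T where T: "closedin (manifold_topology M) T" "B = T \<inter> H"
    using B unfolding closedin_subtopology by blast
  then have T': "T \<subseteq> points M" "openin (manifold_topology M) (points M - T)"
    unfolding closedin_def topspace_manifold_topology [OF diff_m] by auto
  have "\<Psi> ` (points M - T) = points N - \<Psi> ` T"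
    unfolding points_image by (rule inj_on_image_set_diff [OF inj Diff_subset T'(1)])
  then have "closedin (manifold_topology N) (\<Psi> ` T)"
    using openin_image [OF T'(2)] T'(1)
    unfolding closedin_def topspace_manifold_topology [OF diff_n] points_image by auto
  then show ?thesis
    unfolding closedin_subtopology T(2) \<Psi>_Int [OF T'(1) H] by blast
qed

lemma microfold_in_image:
  "microfold_in M H B \<Longrightarrow> microfold_in N (\<Psi> ` H) (\<Psi> ` B)"
  unfolding microfold_in_def using embedded_submanifold_image closedin_image
  by (auto simp: embedded_submanifold_def)

lemma germ_image_subset:
  assumes "H \<subseteq> points M" "H' \<in> germ M H B"
  shows "\<Psi> ` H' \<in> germ N (\<Psi> ` H) (\<Psi> ` B)"
proof -
  obtain W where W: "microfold_in M H' B" "openin (manifold_topology M) W" "B \<subseteq> W" "H \<inter> W = H' \<inter> W"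
    using assms(2) unfolding germ_def by blast
  have "H' \<subseteq> points M" by (rule germ_subset [OF assms(2)])
  moreover have "W \<subseteq> points M" using W(2) unfolding openin_manifold_topology [OF diff_m] by blast
  ultimately have "\<Psi> ` H \<inter> \<Psi> ` W = \<Psi> ` H' \<inter> \<Psi> ` W"
    using W(4) \<Psi>_Int assms(1) by metis
  then show ?thesis
    unfolding germ_def using microfold_in_image [OF W(1)] openin_image [OF W(2)] W(3) by blast
qed

lemma coord_tangent_image_subset:
  assumes H: "H \<subseteq> points M" and i: "i \<in> I" and x: "x \<in> fst (m i)" and w: "w \<in> coord_tangent M H (m i) x"
  shows "L w \<in> coord_tangent N (\<Psi> ` H) (n i) (\<Psi> x)"
proof (rule coord_tangent_image [where F = \<Psi>, OF diff_m diff_n bounded_linear_L _ _ _ _ _ w])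
  show "\<Psi> ` H \<subseteq> points N" unfolding points_image using H by (rule image_mono)
  show "m i \<in> charts_at M x" "n i \<in> charts_at N (\<Psi> x)" using i x dom by (auto simp: charts_at_def)
  show "snd (n i) (\<Psi> z) = L (snd (m i) z)" if "z \<in> fst (m i)" for z using coord [OF i that] .
  fix d assume "d \<in> N"
  then obtain j where j: "j \<in> I" "d = n j" by blast
  have "(\<Psi> z \<in> fst d \<longleftrightarrow> z \<in> fst (m j)) \<and> (z \<in> fst (m j) \<longrightarrow> snd d (\<Psi> z) = L (snd (m j) z))" if "z \<in> H" for z
    unfolding j(2) dom [OF j(1)] using \<Psi>_mem_iff [OF domain_subset [OF j(1)]] H coord [OF j(1)] that by blast
  then show "\<exists>c\<in>M. \<forall>z\<in>H. (\<Psi> z \<in> fst d \<longleftrightarrow> z \<in> fst c) \<and> (z \<in> fst c \<longrightarrow> snd d (\<Psi> z) = L (snd c z))"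
    using j(1) by blast
qed

section \<open>Equivalences obtained from the inverse isomorphism\<close>

lemma inverse_image: "H \<subseteq> points M \<Longrightarrow> inv_into (points M) \<Psi> ` \<Psi> ` H = H"
  using inj by (rule inv_into_image_cancel)

lemma image_inverse: "H \<subseteq> points N \<Longrightarrow> \<Psi> ` inv_into (points M) \<Psi> ` H = H"
  unfolding points_image by (rule image_inv_into_cancel [OF refl])

lemma embedded_submanifold_image_iff:
  assumes "H \<subseteq> points M"
  shows "embedded_submanifold N (\<Psi> ` H) \<longleftrightarrow> embedded_submanifold M H"
  using embedded_submanifold_image atlas_iso.embedded_submanifold_image [OF swap, of "\<Psi> ` H"]
    inverse_image [OF assms] by auto

lemma microfold_in_image_iff:
  assumes "H \<subseteq> points M" "B \<subseteq> points M"
  shows "microfold_in N (\<Psi> ` H) (\<Psi> ` B) \<longleftrightarrow> microfold_in M H B"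
  using microfold_in_image atlas_iso.microfold_in_image [OF swap, of "\<Psi> ` H" "\<Psi> ` B"]
    inverse_image [OF assms(1)] inverse_image [OF assms(2)] by auto

lemma submicrofold_rep_image_iff:
  assumes "H \<subseteq> points M" "B \<subseteq> points M" "Z \<subseteq> points M"
  shows "submicrofold_rep N (\<Psi> ` Z) (\<Psi> ` H) (\<Psi> ` B) \<longleftrightarrow> submicrofold_rep M Z H B"
  unfolding submicrofold_rep_def microfold_in_image_iff [OF assms(1,2)]
    \<Psi>_Int [OF assms(1,3), symmetric] inj_on_image_subset_iff [OF inj assms(2,3)]
  using inj_on_image_eq_iff [OF inj, of "H \<inter> Z" B] assms by blast

text \<open>Since a germ is the set of all its representatives, the reverse inclusion requires that
  every representative of the image germ be the image of a representative, which the inverse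
  isomorphism provides.\<close>

lemma germ_image:
  assumes "H \<subseteq> points M" "B \<subseteq> points M"
  shows "germ N (\<Psi> ` H) (\<Psi> ` B) = (`) \<Psi> ` germ M H B"
proof
  show "(`) \<Psi> ` germ M H B \<subseteq> germ N (\<Psi> ` H) (\<Psi> ` B)"
    using germ_image_subset [OF assms(1)] by blast
  show "germ N (\<Psi> ` H) (\<Psi> ` B) \<subseteq> (`) \<Psi> ` germ M H B"
  proof
    fix K assume K: "K \<in> germ N (\<Psi> ` H) (\<Psi> ` B)"
    have "\<Psi> ` H \<subseteq> points N" unfolding points_image using assms(1) by (rule image_mono)
    from atlas_iso.germ_image_subset [OF swap this K]
    have "inv_into (points M) \<Psi> ` K \<in> germ M H B"
      unfolding inverse_image [OF assms(1)] inverse_image [OF assms(2)] .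
    moreover have "K \<subseteq> points N"
      using germ_subset [OF K] .
    ultimately show "K \<in> (`) \<Psi> ` germ M H B" using image_inverse [of K] by (metis imageI)
  qed
qed

lemma coord_tangent_iso:
  assumes H: "H \<subseteq> points M" and i: "i \<in> I" and x: "x \<in> fst (m i)"
  shows "coord_tangent N (\<Psi> ` H) (n i) (\<Psi> x) = L ` coord_tangent M H (m i) x"
proof
  show "L ` coord_tangent M H (m i) x \<subseteq> coord_tangent N (\<Psi> ` H) (n i) (\<Psi> x)"
    using coord_tangent_image_subset [OF assms] by blast
  show "coord_tangent N (\<Psi> ` H) (n i) (\<Psi> x) \<subseteq> L ` coord_tangent M H (m i) x"
  proof
    fix w assume w: "w \<in> coord_tangent N (\<Psi> ` H) (n i) (\<Psi> x)"
    have sub: "\<Psi> ` H \<subseteq> points N" unfolding points_image using H by (rule image_mono)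
    have "\<Psi> x \<in> fst (n i)" using dom [OF i] x by blast
    from atlas_iso.coord_tangent_image_subset [OF swap sub i this w]
    have "L' w \<in> coord_tangent M H (m i) x"
      unfolding inverse_image [OF H] using inj domain_subset [OF i] x by (simp add: subset_iff)
    then show "w \<in> L ` coord_tangent M H (m i) x" using L_L' by (metis imageI)
  qed
qed

text \<open>In matching charts both forms are constant and \<open>L\<close> intertwines them, so
  \<open>L\<close> maps the orthogonal of a set onto the orthogonal of its image.\<close>

lemma lagrangian_image_iff:
  assumes H: "H \<subseteq> points M"
    and W: "\<And>u v. W' (L u) (L v) = W u v"
    and \<omega>: "\<And>i z u v. i \<in> I \<Longrightarrow> z \<in> fst (m i) \<Longrightarrow> u \<in> tangent_space M z \<Longrightarrow> v \<in> tangent_space M z \<Longrightarrow>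
      \<omega> z u v = W (u (m i)) (v (m i))"
    and \<omega>': "\<And>i z u v. i \<in> I \<Longrightarrow> z \<in> fst (n i) \<Longrightarrow> u \<in> tangent_space N z \<Longrightarrow> v \<in> tangent_space N z \<Longrightarrow>
      \<omega>' z u v = W' (u (n i)) (v (n i))"
  shows "lagrangian N \<omega>' (\<Psi> ` H) \<longleftrightarrow> lagrangian M \<omega> H"
proof -
  have "sub_tangent_space N (\<Psi> ` H) (\<Psi> x) =
      {u \<in> tangent_space N (\<Psi> x). \<forall>v\<in>sub_tangent_space N (\<Psi> ` H) (\<Psi> x). \<omega>' (\<Psi> x) u v = 0} \<longleftrightarrow>
    sub_tangent_space M H x = {u \<in> tangent_space M x. \<forall>v\<in>sub_tangent_space M H x. \<omega> x u v = 0}"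
    if "x \<in> H" for x
  proof -
    obtain i where i: "i \<in> I" "x \<in> fst (m i)" using \<open>x \<in> H\<close> H by (auto simp: points_def)
    have ni: "\<Psi> x \<in> fst (n i)" using dom [OF i(1)] i(2) by blast
    have c: "m i \<in> charts_at M x" "n i \<in> charts_at N (\<Psi> x)" using i ni by (auto simp: charts_at_def)
    let ?K = "coord_tangent M H (m i) x"
    have "{e. \<forall>k\<in>L ` ?K. W' e k = 0} = L ` {e. \<forall>k\<in>?K. W e k = 0}"
      unfolding L_image [of "{e. \<forall>k\<in>?K. W e k = 0}"] using W L_L' by (auto, metis+)
    moreover have "inj L" using L'_L by (metis injI)
    ultimately have "L ` ?K = {e. \<forall>k\<in>L ` ?K. W' e k = 0} \<longleftrightarrow> ?K = {e. \<forall>k\<in>?K. W e k = 0}"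
      by (simp add: inj_image_eq_iff)
    moreover have "(sub_tangent_space M H x = {u \<in> tangent_space M x. \<forall>v\<in>sub_tangent_space M H x. \<omega> x u v = 0}) \<longleftrightarrow>
        ?K = {e. \<forall>k\<in>?K. W e k = 0}"
      by (rule sub_tangent_space_orthogonal_iff [OF diff_m c(1)]) (rule \<omega> [OF i])
    moreover have "(sub_tangent_space N (\<Psi> ` H) (\<Psi> x) =
        {u \<in> tangent_space N (\<Psi> x). \<forall>v\<in>sub_tangent_space N (\<Psi> ` H) (\<Psi> x). \<omega>' (\<Psi> x) u v = 0}) \<longleftrightarrow>
        L ` ?K = {e. \<forall>k\<in>L ` ?K. W' e k = 0}"
      unfolding coord_tangent_iso [OF H i, symmetric]
      by (rule sub_tangent_space_orthogonal_iff [OF diff_n c(2)]) (rule \<omega>' [OF i(1) ni])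
    ultimately show ?thesis by argo
  qed
  then show ?thesis unfolding lagrangian_def embedded_submanifold_image_iff [OF H] by blast
qed

end

section \<open>The Schwartz transform in charts\<close>

text \<open>The coordinate expression of \<open>prod_form\<close> in products of cotangent
  charts.\<close>

definition opposite_sum_form :: "('e::real_inner \<times> 'e) \<times> ('f::real_inner \<times> 'f) \<Rightarrow> ('e \<times> 'e) \<times> ('f \<times> 'f) \<Rightarrow> real"
  where "opposite_sum_form u v = - canonical_form (fst u) (fst v) + canonical_form (snd u) (snd v)"

definition schwartz_coord :: "('e::real_vector \<times> 'e) \<times> ('f \<times> 'f) \<Rightarrow> ('e \<times> 'f) \<times> ('e \<times> 'f)"
  where "schwartz_coord = (\<lambda>((q1, g1), (q2, g2)). ((q1, q2), (- g1, g2)))"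

definition schwartz_coord_inv :: "('e::real_vector \<times> 'f) \<times> ('e \<times> 'f) \<Rightarrow> ('e \<times> 'e) \<times> ('f \<times> 'f)"
  where "schwartz_coord_inv = (\<lambda>((q1, q2), (g1, g2)). ((q1, - g1), (q2, g2)))"

lemma schwartz_coord_simps [simp]:
  "schwartz_coord ((q1, g1), (q2, g2)) = ((q1, q2), (- g1, g2))"
  "schwartz_coord_inv ((q1, q2), (g1, g2)) = ((q1, - g1), (q2, g2))"
  by (simp_all add: schwartz_coord_def schwartz_coord_inv_def)

lemma bounded_linear_schwartz_coord:
  "bounded_linear (schwartz_coord :: ('e::real_normed_vector \<times> 'e) \<times> ('f::real_normed_vector \<times> 'f) \<Rightarrow> _)"
  "bounded_linear (schwartz_coord_inv :: ('e \<times> 'f) \<times> ('e \<times> 'f) \<Rightarrow> _)"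
proof -
  have eq: "schwartz_coord = (\<lambda>u :: ('e \<times> 'e) \<times> ('f \<times> 'f).
      ((fst (fst u), fst (snd u)), (- snd (fst u), snd (snd u))))"
    by (auto simp: fun_eq_iff)
  show "bounded_linear (schwartz_coord :: ('e \<times> 'e) \<times> ('f \<times> 'f) \<Rightarrow> _)"
    unfolding eq by (intro bounded_linear_Pair bounded_linear_minus bounded_linear_fst_comp
        bounded_linear_snd_comp bounded_linear_ident)
  have eq': "schwartz_coord_inv = (\<lambda>u :: ('e \<times> 'f) \<times> ('e \<times> 'f).
      ((fst (fst u), - fst (snd u)), (snd (fst u), snd (snd u))))"
    by (auto simp: fun_eq_iff)
  show "bounded_linear (schwartz_coord_inv :: ('e \<times> 'f) \<times> ('e \<times> 'f) \<Rightarrow> _)"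
    unfolding eq' by (intro bounded_linear_Pair bounded_linear_minus bounded_linear_fst_comp
        bounded_linear_snd_comp bounded_linear_ident)
qed

lemma schwartz_coord_inverse:
  "schwartz_coord_inv (schwartz_coord u) = u" "schwartz_coord (schwartz_coord_inv v) = v"
  by (auto simp: schwartz_coord_def schwartz_coord_inv_def split: prod.splits)

lemma canonical_form_schwartz_coord:
  "canonical_form (schwartz_coord u) (schwartz_coord v) = opposite_sum_form u v"
  by (cases u, cases v) (auto simp: schwartz_coord_def canonical_form_def opposite_sum_form_def
      inner_commute split: prod.splits)

text \<open>The inner product of a product space is the sum of those of the factors, so pulling back
  along the two projections juxtaposes the coefficient vectors.\<close>

lemma schwartz_covector:
  assumes A: "differentiable_atlas A" and B: "differentiable_atlas B"
    and a: "a \<in> charts_at A x1" and b: "b \<in> charts_at B x2"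
  shows "schwartz A B ((x1, covector A a x1 g1), (x2, covector B b x2 g2)) =
    ((x1, x2), covector (prod_atlas A B) (prod_chart a b) (x1, x2) (- g1, g2))"
proof -
  have "(if v \<in> tangent_space (prod_atlas A B) (x1, x2)
      then - covector A a x1 g1 (tangent_map (prod_atlas A B) A fst (x1, x2) v) +
        covector B b x2 g2 (tangent_map (prod_atlas A B) B snd (x1, x2) v) else 0) =
    covector (prod_atlas A B) (prod_chart a b) (x1, x2) (- g1, g2) v" for v
  proof (cases "v \<in> tangent_space (prod_atlas A B) (x1, x2)")
    case True
    have "covector A a x1 g1 (tangent_map (prod_atlas A B) A fst (x1, x2) v) = g1 \<bullet> fst (v (prod_chart a b))"
      by (simp add: tangent_map_fst [OF A B a b True] covector_def chart_vector_in_tangent_space [OF A a]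
          chart_vector_at_chart [OF A a])
    moreover have "covector B b x2 g2 (tangent_map (prod_atlas A B) B snd (x1, x2) v) = g2 \<bullet> snd (v (prod_chart a b))"
      by (simp add: tangent_map_snd [OF A B a b True] covector_def chart_vector_in_tangent_space [OF B b]
          chart_vector_at_chart [OF B b])
    ultimately show ?thesis using True by (simp add: covector_def inner_prod_def)
  qed (simp add: covector_def)
  then show ?thesis by (simp add: schwartz_def)
qed

lemma image_case_prod: "(\<lambda>(a, b). f a b) ` (A \<times> B) = {f a b | a b. a \<in> A \<and> b \<in> B}"
  by auto

lemma schwartz_atlas_iso:
  fixes A :: "('a, 'e::finite_dim_inner) atlas" and B :: "('b, 'f::finite_dim_inner) atlas"
  assumes SA: "smooth_atlas A" and SB: "smooth_atlas B"
  shows "atlas_iso (A \<times> B) (\<lambda>(a, b). prod_chart (cotangent_chart A a) (cotangent_chart B b))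
      (\<lambda>(a, b). cotangent_chart (prod_atlas A B) (prod_chart a b))
      (schwartz A B) schwartz_coord schwartz_coord_inv"
    and "(\<lambda>(a, b). prod_chart (cotangent_chart A a) (cotangent_chart B b)) ` (A \<times> B) = cotangent_prod A B"
    and "(\<lambda>(a, b). cotangent_chart (prod_atlas A B) (prod_chart a b)) ` (A \<times> B) = cotangent_bundle (prod_atlas A B)"
proof -
  let ?m = "\<lambda>(a, b). prod_chart (cotangent_chart A a) (cotangent_chart B b)"
  let ?n = "\<lambda>(a, b). cotangent_chart (prod_atlas A B) (prod_chart a b)"
  have A: "differentiable_atlas A" and B: "differentiable_atlas B"
    using SA SB smooth_atlas_imp_differentiable_atlas by blast+
  have SAB: "smooth_atlas (prod_atlas A B)" by (rule smooth_atlas_prod [OF SA SB])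
  have AB: "differentiable_atlas (prod_atlas A B)" by (rule smooth_atlas_imp_differentiable_atlas [OF SAB])
  show m: "?m ` (A \<times> B) = cotangent_prod A B"
    unfolding prod_atlas_eq cotangent_bundle_def image_case_prod by blast
  show n: "?n ` (A \<times> B) = cotangent_bundle (prod_atlas A B)"
    unfolding image_case_prod unfolding cotangent_bundle_def prod_atlas_eq by blast
  have AB_chart: "prod_chart a b \<in> prod_atlas A B" if "a \<in> A" "b \<in> B" for a b
    using that unfolding prod_atlas_eq by blast
  have S: "schwartz A B ((x1, covector A a x1 g1), (x2, covector B b x2 g2)) =
    ((x1, x2), covector (prod_atlas A B) (prod_chart a b) (x1, x2) (- g1, g2))"
    if "a \<in> A" "b \<in> B" "x1 \<in> fst a" "x2 \<in> fst b" for a b x1 x2 g1 g2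
    by (rule schwartz_covector [OF A B]) (use that in \<open>simp_all add: charts_at_def\<close>)
  have dom_m: "z \<in> fst (?m (a, b)) \<longleftrightarrow> (\<exists>x1 x2 g1 g2. x1 \<in> fst a \<and> x2 \<in> fst b \<and>
      z = ((x1, covector A a x1 g1), (x2, covector B b x2 g2)))" if "a \<in> A" "b \<in> B" for a b z
    using cotangent_chart_domain_eq [OF A that(1)] cotangent_chart_domain_eq [OF B that(2)]
    by (cases z) auto
  have dom_n: "w \<in> fst (?n (a, b)) \<longleftrightarrow> (\<exists>x1 x2 g1 g2. x1 \<in> fst a \<and> x2 \<in> fst b \<and>
      w = ((x1, x2), covector (prod_atlas A B) (prod_chart a b) (x1, x2) (g1, g2)))" if "a \<in> A" "b \<in> B" for a b w
    using cotangent_chart_domain_eq [OF AB AB_chart [OF that]] by (cases w) auto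
  show "atlas_iso (A \<times> B) ?m ?n (schwartz A B) schwartz_coord schwartz_coord_inv"
  proof (rule atlas_iso.intro)
    show "differentiable_atlas (?m ` (A \<times> B))"
      unfolding m by (intro differentiable_atlas_prod differentiable_atlas_cotangent_bundle SA SB)
    show "differentiable_atlas (?n ` (A \<times> B))"
      unfolding n by (rule differentiable_atlas_cotangent_bundle [OF SAB])
    show "inj_on (schwartz A B) (points (?m ` (A \<times> B)))"
    proof (rule inj_onI)
      fix z w assume z: "z \<in> points (?m ` (A \<times> B))" and w: "w \<in> points (?m ` (A \<times> B))"
        and eq: "schwartz A B z = schwartz A B w"
      obtain a b x1 x2 g1 g2 where ab: "a \<in> A" "b \<in> B" "x1 \<in> fst a" "x2 \<in> fst b"
        and z': "z = ((x1, covector A a x1 g1), (x2, covector B b x2 g2))"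
        using z dom_m unfolding points_def by fastforce
      \<comment> \<open>The image determines both base points, so \<open>z\<close> and
        \<open>w\<close> can be written in the same charts \<open>a\<close> and \<open>b\<close>,
        where it remains to compare coefficients.\<close>
      have "fst (schwartz A B v) = (fst (fst v), fst (snd v))" for v
        by (auto simp: schwartz_def split: prod.splits)
      then have base: "fst (fst w) = x1" "fst (snd w) = x2" using eq unfolding z' by (metis fst_conv snd_conv)+
      have a: "a \<in> charts_at A x1" and b: "b \<in> charts_at B x2" using ab by (auto simp: charts_at_def)
      have "fst w \<in> points (cotangent_bundle A)" "snd w \<in> points (cotangent_bundle B)"
        using w unfolding m points_prod by auto
      then have "snd (fst w) \<in> cotangent_space A x1" "snd (snd w) \<in> cotangent_space B x2"
        using base unfolding points_cotangent_bundle by auto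
      then obtain h1 h2 where "snd (fst w) = covector A a x1 h1" "snd (snd w) = covector B b x2 h2"
        using cotangent_eq_covector [OF A a] cotangent_eq_covector [OF B b] by blast
      with base have w': "w = ((x1, covector A a x1 h1), (x2, covector B b x2 h2))"
        by (simp add: prod_eq_iff)
      have K: "prod_chart a b \<in> charts_at (prod_atlas A B) (x1, x2)"
        unfolding charts_at_prod_iff using a b by blast
      have "covector (prod_atlas A B) (prod_chart a b) (x1, x2) (- g1, g2) =
          covector (prod_atlas A B) (prod_chart a b) (x1, x2) (- h1, h2)"
        using eq unfolding z' w' S [OF ab] by simp
      then have "(- g1, g2) = (- h1, h2)"
        using cotangent_chart_covector [OF AB K] by (metis Pair_inject)
      then show "z = w" unfolding z' w' by simp
    qed
    fix i assume "i \<in> A \<times> B"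
    then obtain a b where i: "i = (a, b)" "a \<in> A" "b \<in> B" by blast
    show "fst (?n i) = schwartz A B ` fst (?m i)"
    proof (intro set_eqI iffI)
      fix w assume "w \<in> fst (?n i)"
      then obtain x1 x2 g1 g2 where w: "x1 \<in> fst a" "x2 \<in> fst b"
          "w = ((x1, x2), covector (prod_atlas A B) (prod_chart a b) (x1, x2) (g1, g2))"
        unfolding i(1) dom_n [OF i(2,3)] by blast
      \<comment> \<open>The sign is undone in advance, since the transform negates the first
        coefficient.\<close>
      then have "w = schwartz A B ((x1, covector A a x1 (- g1)), (x2, covector B b x2 g2))"
        using S [OF i(2,3), of x1 x2 "- g1" g2] by simp
      moreover have "((x1, covector A a x1 (- g1)), (x2, covector B b x2 g2)) \<in> fst (?m i)"
        unfolding i(1) dom_m [OF i(2,3)] using w by blast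
      ultimately show "w \<in> schwartz A B ` fst (?m i)" by (rule image_eqI)
    next
      fix w assume "w \<in> schwartz A B ` fst (?m i)"
      then obtain z where "w = schwartz A B z" "z \<in> fst (?m (a, b))" unfolding i(1) by blast
      then obtain x1 x2 g1 g2 where w: "x1 \<in> fst a" "x2 \<in> fst b"
          "w = schwartz A B ((x1, covector A a x1 g1), (x2, covector B b x2 g2))"
        unfolding dom_m [OF i(2,3)] by blast
      then show "w \<in> fst (?n i)"
        unfolding i(1) dom_n [OF i(2,3)] using S [OF i(2,3)] by blast
    qed
    fix z assume "z \<in> fst (?m i)"
    then obtain x1 x2 g1 g2 where z: "x1 \<in> fst a" "x2 \<in> fst b"
        "z = ((x1, covector A a x1 g1), (x2, covector B b x2 g2))"
      unfolding i(1) dom_m [OF i(2,3)] by blast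
    have a: "a \<in> charts_at A x1" and b: "b \<in> charts_at B x2" using z i by (auto simp: charts_at_def)
    have K: "prod_chart a b \<in> charts_at (prod_atlas A B) (x1, x2)"
      unfolding charts_at_prod_iff using a b by blast
    show "snd (?n i) (schwartz A B z) = schwartz_coord (snd (?m i) z)"
      unfolding i(1) z(3) S [OF i(2,3) z(1,2)]
      by (simp add: cotangent_chart_covector [OF AB K] cotangent_chart_covector [OF A a]
          cotangent_chart_covector [OF B b])
  qed (rule bounded_linear_schwartz_coord schwartz_coord_inverse)+
qed

section \<open>Transversality and cleanness\<close>

lemma opposite_sum_form_simps [simp]:
  "opposite_sum_form ((q1, g1), (q2, g2)) ((r1, h1), (r2, h2)) =
    - (g1 \<bullet> r1 - h1 \<bullet> q1) + (g2 \<bullet> r2 - h2 \<bullet> q2)"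
  by (simp add: opposite_sum_form_def canonical_form_def)

lemma opposite_sum_form_linear:
  "opposite_sum_form (u + u') v = opposite_sum_form u v + opposite_sum_form u' v"
  "opposite_sum_form (r *\<^sub>R u) v = r * opposite_sum_form u v"
  "opposite_sum_form u (v + v') = opposite_sum_form u v + opposite_sum_form u v'"
  by (simp_all add: opposite_sum_form_def canonical_form_def inner_add_left inner_add_right algebra_simps)

text \<open>By duality, \<open>K + W\<close> is everything iff \<open>K \<inter> W = 0\<close>, where \<open>W\<close> consists of all
  \<open>((e, 0), (0, f))\<close>; a normal vector of \<open>K + W\<close> is turned into an element of \<open>K \<inter> W\<close> by the
  complex structure.\<close>

lemma transverse_iff_clean:
  fixes K :: "(('e::finite_dim_inner \<times> 'e) \<times> ('f::finite_dim_inner \<times> 'f)) set"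
  assumes lag: "K = {u. \<forall>k\<in>K. opposite_sum_form u k = 0}"
    and D: "linear D" and graph: "\<And>w. ((D w, 0), (w, 0)) \<in> K"
  shows "(\<forall>v. \<exists>u\<in>K. \<exists>e f. v = u + ((e, 0), (0, f))) \<longleftrightarrow> (\<forall>e f. ((e, 0), (f, 0)) \<in> K \<longrightarrow> e = D f)"
proof
  have in_K: "u \<in> K \<longleftrightarrow> (\<forall>k\<in>K. opposite_sum_form u k = 0)" for u using lag by blast
  \<comment> \<open>Closure under sums and multiples is read off from the orthogonality that
    characterizes \<open>K\<close>.\<close>
  have K_add: "u + v \<in> K" if "u \<in> K" "v \<in> K" for u v
    using that unfolding in_K by (simp add: opposite_sum_form_linear)
  have K_scale: "r *\<^sub>R u \<in> K" if "u \<in> K" for r u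
    using that unfolding in_K by (simp add: opposite_sum_form_linear)
  {
    assume trans: "\<forall>v. \<exists>u\<in>K. \<exists>e f. v = u + ((e, 0), (0, f))"
    show "\<forall>e f. ((e, 0), (f, 0)) \<in> K \<longrightarrow> e = D f"
    proof (intro allI impI)
      fix e f assume ef: "((e, 0), (f, 0)) \<in> K"
      let ?k = "((e - D f, 0), (0, 0)) :: ('e \<times> 'e) \<times> ('f \<times> 'f)"
      have "((e, 0), (f, 0)) + (-1) *\<^sub>R ((D f, 0), (f, 0)) \<in> K"
        by (rule K_add [OF ef K_scale [OF graph]])
      then have k: "?k \<in> K" by simp
      \<comment> \<open>The vector decomposed here pairs with \<open>?k\<close> to the squared norm
        of \<open>e - D f\<close>. Both summands pair with \<open>?k\<close> to zero:
        \<open>u\<close> because it is orthogonal to \<open>K\<close>, the other because any two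
        vectors \<open>((e, 0), (0, f))\<close> are orthogonal to each other and \<open>?k\<close>
        has this shape.\<close>
      obtain u e' f' where u: "u \<in> K" "((0, e - D f), (0, 0)) = u + ((e', 0), (0, f'))"
        using trans by blast
      have "opposite_sum_form ?k u = 0"
        using k u(1) in_K by blast
      then have "opposite_sum_form ?k (u + ((e', 0), (0, f'))) = 0"
        unfolding opposite_sum_form_linear(3) by simp
      then have "opposite_sum_form ?k ((0, e - D f), (0, 0)) = 0"
        by (simp only: u(2))
      then show "e = D f" by simp
    qed
  next
    assume clean: "\<forall>e f. ((e, 0), (f, 0)) \<in> K \<longrightarrow> e = D f"
    let ?U = "{u + ((e, 0), (0, f)) | u e f. u \<in> K}"
    have "?U = UNIV"
    proof (rule ccontr)
      assume "?U \<noteq> UNIV"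
      moreover have "subspace ?U"
        unfolding subspace_def
      proof (intro conjI ballI allI)
        have "0 \<in> K" unfolding in_K by (simp add: opposite_sum_form_def canonical_form_def)
        then show "0 \<in> ?U" by (intro CollectI exI [of _ 0]) (simp add: zero_prod_def)
        fix x assume "x \<in> ?U"
        then obtain u e f where x: "x = u + ((e, 0), (0, f))" "u \<in> K" by blast
        show "r *\<^sub>R x \<in> ?U" for r
          by (intro CollectI exI [of _ "r *\<^sub>R u"] exI [of _ "r *\<^sub>R e"] exI [of _ "r *\<^sub>R f"])
            (simp add: x K_scale scaleR_add_right)
        fix y assume "y \<in> ?U"
        then obtain u' e' f' where y: "y = u' + ((e', 0), (0, f'))" "u' \<in> K" by blast
        show "x + y \<in> ?U"
          by (intro CollectI exI [of _ "u + u'"] exI [of _ "e + e'"] exI [of _ "f + f'"])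
            (simp add: x y K_add algebra_simps)
      qed
      ultimately obtain n where n: "n \<noteq> 0" "\<And>u. u \<in> ?U \<Longrightarrow> n \<bullet> u = 0"
        using orthogonal_vector_exists by blast
      obtain n1 n2 n3 n4 where n': "n = ((n1, n2), (n3, n4))" by (metis prod.collapse)
      have nK: "n \<bullet> u = 0" if "u \<in> K" for u
      proof -
        have "n \<bullet> (u + ((0, 0), (0, 0))) = 0" by (rule n(2)) (use that in blast)
        then show ?thesis by (simp flip: zero_prod_def)
      qed
      have zero: "0 \<in> K" unfolding in_K by (simp add: opposite_sum_form_def canonical_form_def)
      \<comment> \<open>Testing \<open>n\<close> against its own components in \<open>W\<close>
        leaves only \<open>n2\<close> and \<open>n3\<close>.\<close>
      have "n \<bullet> (0 + ((n1, 0), (0, n4))) = 0" by (rule n(2)) (use zero in blast)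
      then have "n1 \<bullet> n1 + n4 \<bullet> n4 = 0" by (simp add: n' inner_prod_def)
      then have n14: "n1 = 0" "n4 = 0"
        by (metis add_nonneg_eq_0_iff inner_eq_zero_iff inner_ge_zero)+
      \<comment> \<open>The rotation has opposite signs in the two factors because the first one
        carries the opposite form. Orthogonality of \<open>n\<close> to \<open>K\<close> for the
        inner product thus becomes membership of the rotated vector in \<open>K\<close>.\<close>
      have "opposite_sum_form ((n2, - n1), (- n4, n3)) u = n \<bullet> u" for u
        by (cases u) (auto simp: n' inner_prod_def inner_commute)
      then have kK: "((n2, 0), (0, n3)) \<in> K"
        unfolding in_K using nK n14 by simp
      \<comment> \<open>This pairing equals \<open>n3 \<bullet> n3\<close>: the first factor
        contributes nothing, as both fibre components vanish there.\<close>
      have "opposite_sum_form ((n2, 0), (0, n3)) ((D n3, 0), (n3, 0)) = 0"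
        using kK graph in_K by blast
      then have n3: "n3 = 0" by simp
      with kK clean have "n2 = D 0" by blast
      then have "n2 = 0" using linear_0 [OF D] by simp
      with n14 n3 n(1) n' show False by (simp add: zero_prod_def)
    qed
    then show "\<forall>v. \<exists>u\<in>K. \<exists>e f. v = u + ((e, 0), (0, f))" by blast
  }
qed

section \<open>Forms, transversality and cleanness in one chart\<close>

lemma prod_form_chart:
  fixes A :: "('a, 'e::finite_dim_inner) atlas" and B :: "('b, 'f::finite_dim_inner) atlas"
  assumes SA: "smooth_atlas A" and SB: "smooth_atlas B" and a: "a \<in> A" and b: "b \<in> B"
    and z: "z \<in> fst (prod_chart (cotangent_chart A a) (cotangent_chart B b))"
    and u: "u \<in> tangent_space (cotangent_prod A B) z" and v: "v \<in> tangent_space (cotangent_prod A B) z"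
  shows "prod_form A B z u v =
    opposite_sum_form (u (prod_chart (cotangent_chart A a) (cotangent_chart B b)))
      (v (prod_chart (cotangent_chart A a) (cotangent_chart B b)))"
proof -
  obtain x1 p1 x2 p2 where z': "z = ((x1, p1), (x2, p2))" by (metis prod.collapse)
  have x: "x1 \<in> fst a" "p1 \<in> cotangent_space A x1" "x2 \<in> fst b" "p2 \<in> cotangent_space B x2"
    using z unfolding z' by (auto simp: fst_cotangent_chart)
  have ac: "a \<in> charts_at A x1" and bc: "b \<in> charts_at B x2" using a b x by (auto simp: charts_at_def)
  have TA: "differentiable_atlas (cotangent_bundle A)" and TB: "differentiable_atlas (cotangent_bundle B)"
    by (intro differentiable_atlas_cotangent_bundle SA SB)+
  have Ca: "cotangent_chart A a \<in> charts_at (cotangent_bundle A) (x1, p1)"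
    and Cb: "cotangent_chart B b \<in> charts_at (cotangent_bundle B) (x2, p2)"
    unfolding charts_at_cotangent_bundle_iff using ac bc x by blast+
  note uv = u [unfolded z'] v [unfolded z']
  show ?thesis
    unfolding prod_form_def opposite_sum_form_def z' fst_conv snd_conv
      tangent_map_fst [OF TA TB Ca Cb uv(1)] tangent_map_fst [OF TA TB Ca Cb uv(2)]
      tangent_map_snd [OF TA TB Ca Cb uv(1)] tangent_map_snd [OF TA TB Ca Cb uv(2)]
      symplectic_form_chart [OF SA ac x(2) chart_vector_in_tangent_space [OF TA Ca] chart_vector_in_tangent_space [OF TA Ca]]
      symplectic_form_chart [OF SB bc x(4) chart_vector_in_tangent_space [OF TB Cb] chart_vector_in_tangent_space [OF TB Cb]]
      chart_vector_at_chart [OF TA Ca] chart_vector_at_chart [OF TB Cb] ..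
qed

lemma zero_covector_in_cotangent_space: "(\<lambda>_. 0) \<in> cotangent_space M x"
  by (simp add: cotangent_space_def)

lemma cotangent_chart_at_zero_covector:
  "c \<in> charts_at M x \<Longrightarrow> cotangent_chart M c \<in> charts_at (cotangent_bundle M) (zero_covector x)"
  unfolding zero_covector_def charts_at_cotangent_bundle_iff
  using zero_covector_in_cotangent_space [of M x] by blast

lemma coord_tangent_zero_section:
  fixes M :: "('m, 'e::finite_dim_inner) atlas"
  assumes "smooth_atlas M" "c \<in> charts_at M x"
  shows "coord_tangent (cotangent_bundle M) (zero_section M) (cotangent_chart M c) (zero_covector x) = {w. snd w = 0}"
  unfolding zero_section_def coord_tangent_zero_covector [OF assms subset_refl] coord_tangent_points [OF assms]
  by force

text \<open>Vectors tangent to the zero section have no fibre component and vertical vectors no base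
  component, so in the chart \<open>C\<close> this is the space of all
  \<open>((e, 0), (0, f))\<close>.\<close>

lemma zero_vertical_space_iff:
  fixes A :: "('a, 'e::finite_dim_inner) atlas" and B :: "('b, 'f::finite_dim_inner) atlas"
  assumes SA: "smooth_atlas A" and SB: "smooth_atlas B" and a: "a \<in> charts_at A x1" and b: "b \<in> charts_at B x2"
  defines "C \<equiv> prod_chart (cotangent_chart A a) (cotangent_chart B b)"
  shows "w \<in> zero_vertical_space A B (zero_covector x1, zero_covector x2) \<longleftrightarrow>
    w \<in> tangent_space (cotangent_prod A B) (zero_covector x1, zero_covector x2) \<and>
    snd (fst (w C)) = 0 \<and> fst (snd (w C)) = 0"
proof (cases "w \<in> tangent_space (cotangent_prod A B) (zero_covector x1, zero_covector x2)")
  case True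
  have TA: "differentiable_atlas (cotangent_bundle A)" and TB: "differentiable_atlas (cotangent_bundle B)"
    by (intro differentiable_atlas_cotangent_bundle SA SB)+
  have B: "differentiable_atlas B" using SB by (rule smooth_atlas_imp_differentiable_atlas)
  note Ca = cotangent_chart_at_zero_covector [OF a] and Cb = cotangent_chart_at_zero_covector [OF b]
  have b': "b \<in> charts_at B (fst (zero_covector x2))" using b by (simp add: zero_covector_def)
  have zero_iff: "chart_vector B b (fst (zero_covector x2)) e = (\<lambda>_. 0) \<longleftrightarrow> e = 0" for e
  proof
    assume "chart_vector B b (fst (zero_covector x2)) e = (\<lambda>_. 0)"
    from fun_cong [OF this, of b] show "e = 0" unfolding chart_vector_at_chart [OF B b'] .
  next
    assume "e = 0"
    then show "chart_vector B b (fst (zero_covector x2)) e = (\<lambda>_. 0)"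
      by (simp only:) (rule ext, rule linear_0 [OF chart_vector_linear [OF B b']])
  qed
  have "chart_vector (cotangent_bundle A) (cotangent_chart A a) (zero_covector x1) (fst (w C))
      \<in> sub_tangent_space (cotangent_bundle A) (zero_section A) (zero_covector x1) \<longleftrightarrow> snd (fst (w C)) = 0"
    unfolding in_sub_tangent_space_iff [OF TA Ca] chart_vector_at_chart [OF TA Ca]
      coord_tangent_zero_section [OF SA a]
    using chart_vector_in_tangent_space [OF TA Ca] by simp
  moreover have "chart_vector (cotangent_bundle B) (cotangent_chart B b) (zero_covector x2) (snd (w C))
      \<in> vertical_space B (zero_covector x2) \<longleftrightarrow> fst (snd (w C)) = 0"
    unfolding vertical_space_def mem_Collect_eq
      tangent_map_cotangent_fst [OF SB b' Cb chart_vector_in_tangent_space [OF TB Cb]]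
      chart_vector_at_chart [OF TB Cb] zero_iff
    using chart_vector_in_tangent_space [OF TB Cb] by simp
  ultimately show ?thesis
    unfolding zero_vertical_space_def mem_Collect_eq fst_conv snd_conv
      tangent_map_fst [OF TA TB Ca Cb True] tangent_map_snd [OF TA TB Ca Cb True] C_def [symmetric]
    by blast
qed (simp add: zero_vertical_space_def)

text \<open>Evaluation at \<open>c\<close> is a linear bijection from the tangent space onto the
  model space, under which sums of families become sums of vectors.\<close>

lemma transverse_at_iff_coord:
  assumes M: "differentiable_atlas M" and c: "c \<in> charts_at M x"
    and U: "U \<subseteq> tangent_space M x" and W: "\<And>w. w \<in> W \<longleftrightarrow> w \<in> tangent_space M x \<and> w c \<in> Wc"
  shows "transverse_at M x U W \<longleftrightarrow> (\<forall>v. \<exists>u\<in>(\<lambda>u. u c) ` U. \<exists>w\<in>Wc. v = u + w)"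
proof
  assume "transverse_at M x U W"
  then have T: "tangent_space M x = {\<lambda>c. u c + w c | u w. u \<in> U \<and> w \<in> W}"
    by (simp only: transverse_at_def)
  show "\<forall>v. \<exists>u\<in>(\<lambda>u. u c) ` U. \<exists>w\<in>Wc. v = u + w"
  proof
    fix v
    have "chart_vector M c x v \<in> {\<lambda>c. u c + w c | u w. u \<in> U \<and> w \<in> W}"
      unfolding T [symmetric] by (rule chart_vector_in_tangent_space [OF M c])
    then obtain u w where uw: "chart_vector M c x v = (\<lambda>c. u c + w c)" "u \<in> U" "w \<in> W" by blast
    have "v = u c + w c" using fun_cong [OF uw(1), of c] chart_vector_at_chart [OF M c] by metis
    then show "\<exists>u\<in>(\<lambda>u. u c) ` U. \<exists>w\<in>Wc. v = u + w" using uw W by blast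
  qed
next
  assume R: "\<forall>v. \<exists>u\<in>(\<lambda>u. u c) ` U. \<exists>w\<in>Wc. v = u + w"
  show "transverse_at M x U W"
    unfolding transverse_at_def
  proof (intro set_eqI iffI)
    fix t assume t: "t \<in> tangent_space M x"
    obtain u w where u: "u \<in> U" and w: "w \<in> Wc" and tc: "t c = u c + w" using R by blast
    let ?w = "chart_vector M c x w"
    have w': "?w \<in> tangent_space M x" "?w c = w"
      using chart_vector_in_tangent_space [OF M c] chart_vector_at_chart [OF M c] by auto
    have "u \<in> tangent_space M x" using U u by blast
    then have "t = (\<lambda>d. u d + ?w d)"
      using tangent_eqI [OF c t tangent_space_add [OF M c _ w'(1)]] tc w'(2) by simp
    moreover have "?w \<in> W" unfolding W w'(2) using w' w by blast
    ultimately show "t \<in> {\<lambda>c. u c + w c | u w. u \<in> U \<and> w \<in> W}" using u by blast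
  next
    fix t assume "t \<in> {\<lambda>c. u c + w c | u w. u \<in> U \<and> w \<in> W}"
    then obtain u w where "t = (\<lambda>c. u c + w c)" "u \<in> U" "w \<in> W" by blast
    then show "t \<in> tangent_space M x" using tangent_space_add [OF M c, of u w] U W by blast
  qed
qed

lemma clean_iff_coord:
  assumes M: "differentiable_atlas M" and c: "c \<in> charts_at M x"
  shows "sub_tangent_space M H x \<inter> sub_tangent_space M Z x = sub_tangent_space M C x \<longleftrightarrow>
    coord_tangent M H c x \<inter> coord_tangent M Z c x = coord_tangent M C c x"
proof -
  note iff = in_sub_tangent_space_iff [OF M c]
  have vec: "chart_vector M c x e \<in> tangent_space M x" "chart_vector M c x e c = e" for e
    using chart_vector_in_tangent_space [OF M c] chart_vector_at_chart [OF M c] by auto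
  have coord: "e \<in> coord_tangent M H c x \<longleftrightarrow> chart_vector M c x e \<in> sub_tangent_space M H x" for e H
    unfolding iff vec(2) using vec(1) by blast
  show ?thesis
  proof
    assume "sub_tangent_space M H x \<inter> sub_tangent_space M Z x = sub_tangent_space M C x"
    then show "coord_tangent M H c x \<inter> coord_tangent M Z c x = coord_tangent M C c x"
      unfolding set_eq_iff Int_iff coord by blast
  next
    assume "coord_tangent M H c x \<inter> coord_tangent M Z c x = coord_tangent M C c x"
    then show "sub_tangent_space M H x \<inter> sub_tangent_space M Z x = sub_tangent_space M C x"
      unfolding set_eq_iff Int_iff iff by blast
  qed
qed

section \<open>Images of the zero section and of the core\<close>

lemma schwartz_zero_covector:
  "schwartz A B (zero_covector x1, zero_covector x2) = zero_covector (x1, x2)"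
  by (auto simp: schwartz_def zero_covector_def)

lemma schwartz_gr_prod: "schwartz A B ` gr_prod B \<phi> = gr_cot B \<phi>"
  unfolding gr_prod_def gr_cot_def image_image
  by (rule image_cong) (auto simp: schwartz_zero_covector)

lemma schwartz_zero_section:
  "schwartz A B ` (zero_section A \<times> zero_section B) = zero_section (prod_atlas A B)"
proof -
  have "zero_section A \<times> zero_section B = (\<lambda>(x, y). (zero_covector x, zero_covector y)) ` (points A \<times> points B)"
    unfolding zero_section_def by auto
  then have "schwartz A B ` (zero_section A \<times> zero_section B) =
      (\<lambda>z. schwartz A B (case z of (x, y) \<Rightarrow> (zero_covector x, zero_covector y))) ` (points A \<times> points B)"
    by (simp only: image_image)
  also have "\<dots> = zero_section (prod_atlas A B)"
    unfolding zero_section_def points_prod by (rule image_cong) (auto simp: schwartz_zero_covector)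
  finally show ?thesis .
qed

lemma zero_section_subset: "zero_section M \<subseteq> points (cotangent_bundle M)"
  unfolding zero_section_def points_cotangent_bundle
  by (auto simp: zero_covector_def zero_covector_in_cotangent_space)

lemma gr_prod_subset:
  assumes "smooth_map B A \<phi>"
  shows "gr_prod B \<phi> \<subseteq> points (cotangent_prod A B)"
proof -
  have "\<phi> x \<in> points A" if "x \<in> points B" for x using assms that unfolding smooth_map_def by blast
  then have "gr_prod B \<phi> \<subseteq> zero_section A \<times> zero_section B"
    unfolding gr_prod_def gr_def zero_section_def by auto
  also have "\<dots> \<subseteq> points (cotangent_prod A B)"
    unfolding points_prod by (intro Sigma_mono zero_section_subset)
  finally show ?thesis .
qed

text \<open>At a core point everything is expressed in one matching pair of charts: \<open>K\<close>
  for \<open>V\<close>, its image under \<open>schwartz_coord\<close> for the transformed set, and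
  explicit subspaces for the zero section and the core. This brings both conditions into the form
  treated by \<open>transverse_iff_clean\<close>.\<close>

lemma transverse_iff_clean_at:
  fixes A :: "('a, 'e::finite_dim_inner) atlas" and B :: "('b, 'f::finite_dim_inner) atlas"
  assumes SA: "smooth_atlas A" and SB: "smooth_atlas B" and \<phi>: "smooth_map B A \<phi>"
    and V: "V \<subseteq> points (cotangent_prod A B)" and gr: "gr_prod B \<phi> \<subseteq> V"
    and lag: "lagrangian (cotangent_prod A B) (prod_form A B) V"
    and x: "x \<in> points B"
  defines "z \<equiv> (zero_covector (\<phi> x), zero_covector x)" and "N \<equiv> cotangent_bundle (prod_atlas A B)"
  shows "transverse_at (cotangent_prod A B) z (sub_tangent_space (cotangent_prod A B) V z) (zero_vertical_space A B z) \<longleftrightarrow>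
    sub_tangent_space N (schwartz A B ` V) (schwartz A B z) \<inter>
      sub_tangent_space N (zero_section (prod_atlas A B)) (schwartz A B z) =
    sub_tangent_space N (gr_cot B \<phi>) (schwartz A B z)"
proof -
  let ?M = "cotangent_prod A B"
  have SAB: "smooth_atlas (prod_atlas A B)" by (rule smooth_atlas_prod [OF SA SB])
  have M: "differentiable_atlas ?M"
    by (intro differentiable_atlas_prod differentiable_atlas_cotangent_bundle SA SB)
  have N: "differentiable_atlas N" unfolding N_def by (rule differentiable_atlas_cotangent_bundle [OF SAB])
  have \<phi>x: "\<phi> x \<in> points A" using \<phi> x unfolding smooth_map_def by blast
  obtain a where a: "a \<in> charts_at A (\<phi> x)" using charts_at_nonempty [OF \<phi>x] by blast
  obtain b where b: "b \<in> charts_at B x" using charts_at_nonempty [OF x] by blast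
  have ab: "(a, b) \<in> A \<times> B" using charts_atD [OF a] charts_atD [OF b] by blast
  define C where "C = prod_chart (cotangent_chart A a) (cotangent_chart B b)"
  define C' where "C' = cotangent_chart (prod_atlas A B) (prod_chart a b)"
  have Pab: "prod_chart a b \<in> charts_at (prod_atlas A B) (\<phi> x, x)"
    unfolding charts_at_prod_iff using a b by blast
  have C: "C \<in> charts_at ?M z"
    unfolding C_def z_def charts_at_prod_iff
    using cotangent_chart_at_zero_covector [OF a] cotangent_chart_at_zero_covector [OF b] by blast
  have Sz: "schwartz A B z = zero_covector (\<phi> x, x)" unfolding z_def by (rule schwartz_zero_covector)
  have C': "C' \<in> charts_at N (zero_covector (\<phi> x, x))"
    unfolding C'_def N_def by (rule cotangent_chart_at_zero_covector [OF Pab])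
  define K where "K = coord_tangent ?M V C z"
  have zgr: "z \<in> gr_prod B \<phi>" unfolding z_def gr_prod_def gr_def using x by force
  have zV: "z \<in> V" using gr zgr by blast
  note iso = schwartz_atlas_iso [OF SA SB]
  have KV: "coord_tangent N (schwartz A B ` V) C' (zero_covector (\<phi> x, x)) = schwartz_coord ` K"
    using atlas_iso.coord_tangent_iso [OF iso(1), unfolded iso(2,3), OF V ab, of z] charts_atD [OF C]
    unfolding K_def C_def C'_def N_def Sz by simp
  have KZ: "coord_tangent N (zero_section (prod_atlas A B)) C' (zero_covector (\<phi> x, x)) = {w. snd w = 0}"
    unfolding N_def C'_def by (rule coord_tangent_zero_section [OF SAB Pab])
  obtain D where D: "linear D"
    "coord_tangent (prod_atlas A B) (gr B \<phi>) (prod_chart a b) (\<phi> x, x) = range (\<lambda>w. (D w, w))"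
    using coord_tangent_gr [OF SA SB \<phi> a b] by blast
  have "gr B \<phi> \<subseteq> points (prod_atlas A B)"
    using \<phi> unfolding gr_def points_prod smooth_map_def by auto
  from coord_tangent_zero_covector [OF SAB Pab this]
  have KG: "coord_tangent N (gr_cot B \<phi>) C' (zero_covector (\<phi> x, x)) = range (\<lambda>w. ((D w, w), 0))"
    unfolding D(2) N_def C'_def gr_cot_def image_image .
  have "gr_cot B \<phi> \<subseteq> schwartz A B ` V" unfolding schwartz_gr_prod [symmetric, of _ _ A] using gr by (rule image_mono)
  from coord_tangent_mono [OF this]
  have KGV: "range (\<lambda>w. ((D w, w), 0)) \<subseteq> schwartz_coord ` K" unfolding KG [symmetric] KV [symmetric] .
  have in_image: "(p, 0) \<in> schwartz_coord ` K \<longleftrightarrow> ((fst p, 0), (snd p, 0)) \<in> K" for p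
  proof -
    have "schwartz_coord ((fst p, 0), (snd p, 0)) = (p, 0)" by (simp add: zero_prod_def)
    then show ?thesis using schwartz_coord_inverse(1) by (metis image_iff)
  qed
  \<comment> \<open>Curves in the core are curves in \<open>V\<close>, so the velocities computed
    for the graph belong to \<open>K\<close>.\<close>
  have graph: "((D w, 0), (w, 0)) \<in> K" for w
    using KGV in_image [of "(D w, w)"] by auto
  have lagK: "K = {u. \<forall>k\<in>K. opposite_sum_form u k = 0}"
  proof -
    have "sub_tangent_space ?M V z = {u \<in> tangent_space ?M z. \<forall>v\<in>sub_tangent_space ?M V z. prod_form A B z u v = 0}"
      using lag zV unfolding lagrangian_def by blast
    moreover have "prod_form A B z u v = opposite_sum_form (u C) (v C)"
      if "u \<in> tangent_space ?M z" "v \<in> tangent_space ?M z" for u v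
      using prod_form_chart [OF SA SB _ _ _ that] ab charts_atD [OF C] unfolding C_def by blast
    ultimately show ?thesis
      using sub_tangent_space_orthogonal_iff [OF M C, where \<omega> = "prod_form A B" and W = opposite_sum_form and H = V]
      unfolding K_def by blast
  qed
  have "transverse_at ?M z (sub_tangent_space ?M V z) (zero_vertical_space A B z) \<longleftrightarrow>
      (\<forall>v. \<exists>u\<in>(\<lambda>u. u C) ` sub_tangent_space ?M V z. \<exists>w\<in>{w. snd (fst w) = 0 \<and> fst (snd w) = 0}. v = u + w)"
    by (rule transverse_at_iff_coord [OF M C sub_tangent_space_subset [OF M]])
      (simp only: z_def C_def zero_vertical_space_iff [OF SA SB a b] mem_Collect_eq)
  also have "\<dots> \<longleftrightarrow> (\<forall>v. \<exists>u\<in>K. \<exists>e f. v = u + ((e, 0), (0, f)))"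
    unfolding K_def coord_tangent_def
    by (intro all_cong1 bex_cong refl) (metis (mono_tags, lifting) fst_conv mem_Collect_eq prod.collapse snd_conv)
  also have "\<dots> \<longleftrightarrow> (\<forall>e f. ((e, 0), (f, 0)) \<in> K \<longrightarrow> e = D f)"
    by (rule transverse_iff_clean [OF lagK D(1) graph])
  \<comment> \<open>Cleanness at this point. Only the inclusion from left to right has content,
    since the tangent vectors of the core always lie in both sets on the left.\<close>
  also have "\<dots> \<longleftrightarrow> schwartz_coord ` K \<inter> {w. snd w = 0} = range (\<lambda>w. ((D w, w), 0))"
  proof
    assume L: "\<forall>e f. ((e, 0), (f, 0)) \<in> K \<longrightarrow> e = D f"
    have "v \<in> range (\<lambda>w. ((D w, w), 0))" if "v \<in> schwartz_coord ` K" "snd v = 0" for v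
    proof -
      have "v = (fst v, 0)" using that(2) by (simp add: prod_eq_iff)
      then have "((fst (fst v), 0), (snd (fst v), 0)) \<in> K" using that(1) in_image by metis
      then have "fst (fst v) = D (snd (fst v))" using L by blast
      then show ?thesis using that(2) by (intro range_eqI [of _ _ "snd (fst v)"]) (simp add: prod_eq_iff)
    qed
    moreover have "range (\<lambda>w. ((D w, w), 0 :: 'e \<times> 'f)) \<subseteq> {w. snd w = 0}" by auto
    ultimately show "schwartz_coord ` K \<inter> {w. snd w = 0} = range (\<lambda>w. ((D w, w), 0))" using KGV by blast
  next
    assume R: "schwartz_coord ` K \<inter> {w. snd w = 0} = range (\<lambda>w. ((D w, w), 0))"
    show "\<forall>e f. ((e, 0), (f, 0)) \<in> K \<longrightarrow> e = D f"
    proof (intro allI impI)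
      fix e f assume "((e, 0), (f, 0)) \<in> K"
      then have "((e, f), 0) \<in> schwartz_coord ` K \<inter> {w. snd w = 0}" using in_image [of "(e, f)"] by simp
      then show "e = D f" unfolding R by auto
    qed
  qed
  also have "\<dots> \<longleftrightarrow> sub_tangent_space N (schwartz A B ` V) (schwartz A B z) \<inter>
      sub_tangent_space N (zero_section (prod_atlas A B)) (schwartz A B z) =
    sub_tangent_space N (gr_cot B \<phi>) (schwartz A B z)"
    unfolding Sz clean_iff_coord [OF N C'] KV KZ KG ..
  finally show ?thesis .
qed

text \<open>The submicrofold and lagrangian conditions transfer on their own. Transversality and
  cleanness are equivalent in the presence of the other two, so that part is proved under them and
  the three are then combined.\<close>

lemma symplectic_micromorphism_rep_iff:
  fixes A :: "('a, 'e::finite_dim_inner) atlas" and B :: "('b, 'f::finite_dim_inner) atlas"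
  assumes SA: "smooth_atlas A" and SB: "smooth_atlas B" and \<phi>: "smooth_map B A \<phi>"
    and V: "V \<subseteq> points (cotangent_prod A B)"
  defines "N \<equiv> cotangent_bundle (prod_atlas A B)" and "\<Psi> \<equiv> schwartz A B"
  shows "symplectic_micromorphism_rep A B \<phi> V \<longleftrightarrow>
    submicrofold_rep N (zero_section (prod_atlas A B)) (\<Psi> ` V) (gr_cot B \<phi>) \<and>
    lagrangian N (symplectic_form (prod_atlas A B)) (\<Psi> ` V) \<and>
    clean_along N (zero_section (prod_atlas A B)) (\<Psi> ` V) (gr_cot B \<phi>)"
proof -
  let ?M = "cotangent_prod A B"
  note iso = schwartz_atlas_iso [OF SA SB]
  have SAB: "smooth_atlas (prod_atlas A B)" by (rule smooth_atlas_prod [OF SA SB])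
  have Z: "zero_section A \<times> zero_section B \<subseteq> points ?M"
    unfolding points_prod by (intro Sigma_mono zero_section_subset)
  have G: "gr_prod B \<phi> \<subseteq> points ?M"
    by (rule gr_prod_subset [OF \<phi>])
  have sub: "submicrofold_rep N (zero_section (prod_atlas A B)) (\<Psi> ` V) (gr_cot B \<phi>) \<longleftrightarrow>
      submicrofold_rep ?M (zero_section A \<times> zero_section B) V (gr_prod B \<phi>)"
    using atlas_iso.submicrofold_rep_image_iff [OF iso(1), unfolded iso(2,3), OF V G Z]
    unfolding schwartz_gr_prod schwartz_zero_section N_def \<Psi>_def .
  have lag: "lagrangian N (symplectic_form (prod_atlas A B)) (\<Psi> ` V) \<longleftrightarrow> lagrangian ?M (prod_form A B) V"
    unfolding N_def \<Psi>_def
  proof (rule atlas_iso.lagrangian_image_iff [OF iso(1), unfolded iso(2,3),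
        where W' = canonical_form and W = opposite_sum_form, OF V canonical_form_schwartz_coord])
    fix i z u v
    assume "i \<in> A \<times> B" "z \<in> fst (case i of (a, b) \<Rightarrow> prod_chart (cotangent_chart A a) (cotangent_chart B b))"
      and uv: "u \<in> tangent_space ?M z" "v \<in> tangent_space ?M z"
    then show "prod_form A B z u v =
        opposite_sum_form (u (case i of (a, b) \<Rightarrow> prod_chart (cotangent_chart A a) (cotangent_chart B b)))
          (v (case i of (a, b) \<Rightarrow> prod_chart (cotangent_chart A a) (cotangent_chart B b)))"
      using prod_form_chart [OF SA SB _ _ _ uv] by (cases i) (simp only: case_prod_conv mem_Sigma_iff)
  next
    fix i z u v
    assume i: "i \<in> A \<times> B" and z: "z \<in> fst (case i of (a, b) \<Rightarrow> cotangent_chart (prod_atlas A B) (prod_chart a b))"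
      and uv: "u \<in> tangent_space (cotangent_bundle (prod_atlas A B)) z"
        "v \<in> tangent_space (cotangent_bundle (prod_atlas A B)) z"
    obtain a b where ab: "i = (a, b)" "a \<in> A" "b \<in> B" using i by blast
    obtain x p where x: "z = (x, p)" by (cases z)
    have "x \<in> fst (prod_chart a b)" "p \<in> cotangent_space (prod_atlas A B) x"
      using z unfolding ab(1) x by (auto simp: fst_cotangent_chart)
    moreover from this have "prod_chart a b \<in> charts_at (prod_atlas A B) x"
      using ab(2,3) unfolding charts_at_def prod_atlas_eq by blast
    ultimately show "symplectic_form (prod_atlas A B) z u v =
        canonical_form (u (case i of (a, b) \<Rightarrow> cotangent_chart (prod_atlas A B) (prod_chart a b)))
          (v (case i of (a, b) \<Rightarrow> cotangent_chart (prod_atlas A B) (prod_chart a b)))"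
      unfolding ab(1) x case_prod_conv using uv by (intro symplectic_form_chart [OF SAB]) (simp_all only: x)
  qed
  have "(\<forall>z\<in>gr_prod B \<phi>. transverse_at ?M z (sub_tangent_space ?M V z) (zero_vertical_space A B z)) \<longleftrightarrow>
      clean_along N (zero_section (prod_atlas A B)) (\<Psi> ` V) (gr_cot B \<phi>)"
    if s: "submicrofold_rep ?M (zero_section A \<times> zero_section B) V (gr_prod B \<phi>)"
      and l: "lagrangian ?M (prod_form A B) V"
  proof -
    have gr: "gr_prod B \<phi> \<subseteq> V" using s unfolding submicrofold_rep_def by blast
    have ball: "(\<forall>z\<in>gr_prod B \<phi>. P z) \<longleftrightarrow> (\<forall>x\<in>points B. P (zero_covector (\<phi> x), zero_covector x))" for P
      unfolding gr_prod_def gr_def by auto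
    have ball': "(\<forall>y\<in>gr_cot B \<phi>. Q y) \<longleftrightarrow>
        (\<forall>x\<in>points B. Q (schwartz A B (zero_covector (\<phi> x), zero_covector x)))" for Q
      using ball [of "\<lambda>z. Q (schwartz A B z)"] unfolding schwartz_gr_prod [symmetric, of _ _ A] by blast
    show ?thesis
      unfolding clean_along_def ball ball' N_def \<Psi>_def
      by (intro ball_cong refl transverse_iff_clean_at [OF SA SB \<phi> V gr l])
  qed
  then show ?thesis unfolding symplectic_micromorphism_rep_def sub lag by blast
qed

text \<open>Agreement near the core is transitive, by intersecting the neighbourhoods. Hence a germ
  can be formed from any of its members, as the formula for the correspondence requires.\<close>

lemma germ_eq:
  assumes M: "differentiable_atlas M" and V: "V' \<in> germ M V C"
  shows "germ M V' C = germ M V C"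
proof -
  obtain W where W: "openin (manifold_topology M) W" "C \<subseteq> W" "V \<inter> W = V' \<inter> W"
    using V unfolding germ_def by blast
  have "germ M V1 C \<subseteq> germ M V2 C" if eq: "V1 \<inter> W = V2 \<inter> W" for V1 V2
  proof
    fix H assume "H \<in> germ M V1 C"
    then obtain W' where W': "microfold_in M H C" "openin (manifold_topology M) W'" "C \<subseteq> W'" "V1 \<inter> W' = H \<inter> W'"
      unfolding germ_def by blast
    have "openin (manifold_topology M) (W \<inter> W')" using W(1) W'(2) by (rule openin_Int)
    moreover have "C \<subseteq> W \<inter> W'" using W(2) W'(3) by blast
    moreover have "V2 \<inter> (W \<inter> W') = H \<inter> (W \<inter> W')" using eq W'(4) by blast
    ultimately show "H \<in> germ M V2 C" unfolding germ_def using W'(1) by blast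
  qed
  from this [OF W(3)] this [OF W(3) [symmetric]] show ?thesis by blast
qed

theorem theorem17:
  fixes A :: "('a, 'e::finite_dim_inner) atlas"
    and B :: "('b, 'f::finite_dim_inner) atlas"
    and \<phi> :: "'b \<Rightarrow> 'a"
  assumes "smooth_manifold A" and "smooth_manifold B" and "smooth_map B A \<phi>"
  shows "\<exists>F. bij_betw F (symplectic_micromorphisms A B \<phi>)
               (clean_lagrangian_submicrofolds (prod_atlas A B) (gr_cot B \<phi>)) \<and>
             (\<forall>c\<in>symplectic_micromorphisms A B \<phi>. \<forall>V\<in>c.
                F c = germ (cotangent_bundle (prod_atlas A B)) (schwartz A B ` V) (gr_cot B \<phi>))"
proof -
  let ?M = "cotangent_prod A B" and ?N = "cotangent_bundle (prod_atlas A B)" and ?\<Psi> = "schwartz A B"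
  let ?G = "gr_prod B \<phi>" and ?G' = "gr_cot B \<phi> :: ('a \<times> 'b, 'e \<times> 'f) cotangent set"
  have SA: "smooth_atlas A" and SB: "smooth_atlas B"
    using assms(1,2) by (auto intro: smooth_manifold_imp_smooth_atlas)
  have M: "differentiable_atlas ?M"
    by (intro differentiable_atlas_prod differentiable_atlas_cotangent_bundle SA SB)
  note iso = schwartz_atlas_iso [OF SA SB]
  have G: "?G \<subseteq> points ?M" by (rule gr_prod_subset [OF assms(3)])
  have inj: "inj_on ?\<Psi> (points ?M)" using atlas_iso.inj [OF iso(1)] unfolding iso(2) .
  have points_N: "points ?N = ?\<Psi> ` points ?M" using atlas_iso.points_image [OF iso(1)] unfolding iso(2,3) .
  have germ_image: "germ ?N (?\<Psi> ` V) ?G' = (`) ?\<Psi> ` germ ?M V ?G" if "V \<subseteq> points ?M" for V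
    using atlas_iso.germ_image [OF iso(1), unfolded iso(2,3), OF that G] unfolding schwartz_gr_prod .
  have rep_subset: "V \<subseteq> points ?M" if "symplectic_micromorphism_rep A B \<phi> V" for V
    using that unfolding symplectic_micromorphism_rep_def lagrangian_def
    by (elim conjE) (rule embedded_submanifold_subset)
  note rep_iff = symplectic_micromorphism_rep_iff [OF SA SB assms(3)]
  \<comment> \<open>A germ is a set of representatives, which are sets of points, so the transform
    acts on germs by taking images twice.\<close>
  have "bij_betw ((`) ((`) ?\<Psi>)) (symplectic_micromorphisms A B \<phi>)
      (clean_lagrangian_submicrofolds (prod_atlas A B) ?G')"
    unfolding bij_betw_def
  proof
    \<comment> \<open>Injectivity on points lifts to sets of points and once more to sets of such
      sets, among which the germs lie.\<close>
    have "symplectic_micromorphisms A B \<phi> \<subseteq> Pow (Pow (points ?M))"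
      unfolding symplectic_micromorphisms_def using germ_subset by blast
    moreover have "inj_on ((`) ((`) ?\<Psi>)) (Pow (Pow (points ?M)))"
      by (intro inj_on_image_Pow inj)
    ultimately show "inj_on ((`) ((`) ?\<Psi>)) (symplectic_micromorphisms A B \<phi>)" by (rule inj_on_subset [rotated])
    show "(`) ((`) ?\<Psi>) ` symplectic_micromorphisms A B \<phi> =
        clean_lagrangian_submicrofolds (prod_atlas A B) ?G'"
    proof (intro set_eqI iffI)
      fix d assume "d \<in> (`) ((`) ?\<Psi>) ` symplectic_micromorphisms A B \<phi>"
      then obtain V where V: "symplectic_micromorphism_rep A B \<phi> V" "d = (`) ?\<Psi> ` germ ?M V ?G"
        unfolding symplectic_micromorphisms_def by blast
      have "d = germ ?N (?\<Psi> ` V) ?G'" unfolding V(2) germ_image [OF rep_subset [OF V(1)]] ..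
      then show "d \<in> clean_lagrangian_submicrofolds (prod_atlas A B) ?G'"
        using iffD1 [OF rep_iff [OF rep_subset [OF V(1)]] V(1)]
        unfolding clean_lagrangian_submicrofolds_def by (intro CollectI exI [of _ "?\<Psi> ` V"] conjI) simp_all
    next
      fix d assume "d \<in> clean_lagrangian_submicrofolds (prod_atlas A B) ?G'"
      then obtain K where K: "d = germ ?N K ?G'" "submicrofold_rep ?N (zero_section (prod_atlas A B)) K ?G'"
          "lagrangian ?N (symplectic_form (prod_atlas A B)) K"
          "clean_along ?N (zero_section (prod_atlas A B)) K ?G'"
        unfolding clean_lagrangian_submicrofolds_def by blast
      have "K \<subseteq> points ?N" using K(3) unfolding lagrangian_def by (elim conjE) (rule embedded_submanifold_subset)
      \<comment> \<open>The transform maps onto all points of the target bundle, so \<open>K\<close>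
        is an image and the equivalence for representatives applies to its preimage.\<close>
      then obtain V where V: "V \<subseteq> points ?M" "K = ?\<Psi> ` V"
        unfolding points_N by (rule subset_imageE)
      have "symplectic_micromorphism_rep A B \<phi> V"
        unfolding rep_iff [OF V(1)] V(2) [symmetric] using K(2-4) by (intro conjI)
      moreover have "d = (`) ?\<Psi> ` germ ?M V ?G" unfolding K(1) V(2) by (rule germ_image [OF V(1)])
      ultimately show "d \<in> (`) ((`) ?\<Psi>) ` symplectic_micromorphisms A B \<phi>"
        unfolding symplectic_micromorphisms_def by blast
    qed
  qed
  \<comment> \<open>A member \<open>V\<close> of a germ agrees near the core with a representative
    \<open>V0\<close> that satisfies the conditions, but it may violate them elsewhere; the formula
    therefore goes through equality of germs.\<close>
  moreover have "(`) ?\<Psi> ` c = germ ?N (?\<Psi> ` V) ?G'" if c: "c \<in> symplectic_micromorphisms A B \<phi>" "V \<in> c" for c V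
  proof -
    obtain V0 where V0: "c = germ ?M V0 ?G" using c(1) unfolding symplectic_micromorphisms_def by blast
    have V: "V \<in> germ ?M V0 ?G" using c(2) unfolding V0 .
    show ?thesis
      unfolding V0 germ_image [OF germ_subset [OF V]] germ_eq [OF M V] ..
  qed
  ultimately show ?thesis by blast
qed

end
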